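(* Let $N=\begin{pmatrix}0&-L_-\\L_+&0\end{pmatrix}$ with $L_+=-\partial_{xx}-g(x)$, $L_-=-\partial_{xx}-h(x)$ on $[0,\ell]$ with Dirichlet boundary conditions, $g,h\in C^2([0,\ell],\mathbb R)$. Let $P$, $Q$ be the numbers of negative eigenvalues of $L_+$, $L_-$, and $n_+(N)$ the number of positive real eigenvalues of $N$. (1) Suppose $P=1$, $Q=0$ and $0\in\operatorname{Spec}(L_-)\setminus\operatorname{Spec}(L_+)$. Let $v$ span $\ker(L_-)$ and let $\widehat u\in H^2(0,\ell)\cap H^1_0(0,\ell)$ be the unique solution of $L_+\widehat u=v$. If $\int_0^\ell\widehat u\,v\,dx>0$, then $n_+(N)=1$; if $\int_0^\ell\widehat u\,v\,dx<0$, then $\operatorname{Spec}(N)\subset i\mathbb R$. In particular, if $g,h$ arise from the linearisation of the nonlinear Schrödinger equation about a standing wave $\widehat\psi$ (and $0\notin\operatorname{Spec}(L_-)\cap\operatorname{Spec}(L_+)$), then $\widehat\psi$ is spectrally unstable if $\frac2\ell\frac{\langle\widehat u,v\rangle}{(v'(\ell))^2}>0$ and spectrally stable if this quantity is negative. (2) Suppose $Q=1$, $P=0$ and $0\in\operatorname{Spec}(L_+)\setminus\operatorname{Spec}(L_-)$. Let $u$ span $\ker(L_+)$ and let $\widehat v\in H^2(0,\ell)\cap H^1_0(0,\ell)$ be the unique solution of $-L_-\widehat v=u$. If $\int_0^\ell\widehat v\,u\,dx<0$, then $n_+(N)=1$; if $\int_0^\ell\widehat v\,u\,dx>0$, then $\operatorname{Spec}(N)\subset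 i\mathbb R$. In particular, in the same nonlinear Schrödinger setting, $\widehat\psi$ is spectrally unstable if $-\frac2\ell\frac{\langle\widehat v,u\rangle}{(u'(\ell))^2}>0$ and spectrally stable if this quantity is negative.
   Context: $\ell>0$; $L_\pm$ are unbounded operators in $L^2(0,\ell)$ with domain $H^2(0,\ell)\cap H^1_0(0,\ell)$, and $N$ acts in $L^2(0,\ell)^2$ with domain $(H^2(0,\ell)\cap H^1_0(0,\ell))^2$. $\langle\cdot,\cdot\rangle$ is the $L^2(0,\ell)$ inner product; eigenfunctions $u,v$ are real-valued. NLS setting: $f:[0,\infty)\to\mathbb R$ is $C^3$, $\beta\in\mathbb R$, and $\phi:[0,\ell]\to\mathbb R$ solves $\phi_{xx}+f(\phi^2)\phi+\beta\phi=0$, so that $\widehat\psi(x,t)=e^{i\beta t}\phi(x)$ is a standing wave of $i\psi_t=\psi_{xx}+f(|\psi|^2)\psi$. Linearisation gives $N$ with $g(x)=2f'(\phi^2(x))\phi^2(x)+f(\phi^2(x))+\beta$ and $h(x)=f(\phi^2(x))+\beta$. The wave is spectrally unstable if $N$ has spectrum in the open right half plane, and spectrally stable otherwise. *)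

theory Defs
  imports "HOL-Analysis.Analysis"
begin

text \<open>
  The Hilbert spaces \<open>L\<^sup>2(0,l)\<close> and \<open>L\<^sup>2(0,l)\<^sup>2\<close> are both treated as spaces of complex-vector-valued
  functions; the class below is what is needed to speak about complex eigenvalues uniformly.
\<close>

class complex_normed = real_normed_vector +
  fixes scaleC :: "complex \<Rightarrow> 'a \<Rightarrow> 'a"  (infixr "*\<^sub>C" 75)
  assumes scaleC_add_right: "c *\<^sub>C (x + y) = c *\<^sub>C x + c *\<^sub>C y"
    and scaleC_add_left: "(c + d) *\<^sub>C x = c *\<^sub>C x + d *\<^sub>C x"
    and scaleC_scaleC: "c *\<^sub>C d *\<^sub>C x = (c * d) *\<^sub>C x"
    and scaleC_of_real: "complex_of_real r *\<^sub>C x = r *\<^sub>R x"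
    and norm_scaleC: "norm (c *\<^sub>C x) = cmod c * norm x"

instantiation complex :: complex_normed
begin
definition scaleC_complex_def: "c *\<^sub>C (x :: complex) = c * x"
instance
  by standard (simp_all add: scaleC_complex_def algebra_simps norm_mult scaleR_conv_of_real)
end

instantiation prod :: (complex_normed, complex_normed) complex_normed
begin
definition scaleC_prod_def: "c *\<^sub>C x = (c *\<^sub>C fst x, c *\<^sub>C snd x)"
instance
proof
  fix c :: complex and x :: "'a \<times> 'b"
  have "(cmod c * norm (fst x))\<^sup>2 + (cmod c * norm (snd x))\<^sup>2
      = (cmod c)\<^sup>2 * ((norm (fst x))\<^sup>2 + (norm (snd x))\<^sup>2)"
    by (simp add: power_mult_distrib distrib_left)
  then show "norm (c *\<^sub>C x) = cmod c * norm x"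
    by (simp add: scaleC_prod_def norm_prod_def norm_scaleC real_sqrt_mult)
qed (simp_all add: scaleC_prod_def scaleC_add_right scaleC_add_left scaleC_scaleC
      scaleC_of_real prod_eq_iff)
end


section \<open>Square-integrable functions and Sobolev spaces on an interval\<close>

abbreviation interval_measure :: "real \<Rightarrow> real measure" where
  "interval_measure l \<equiv> lebesgue_on {0<..<l}"

text \<open>
  Elements of \<open>L\<^sup>2(0,l)\<close> are represented by functions; identification of functions that agree
  almost everywhere is built into every definition below.
\<close>

definition L2 :: "real \<Rightarrow> (real \<Rightarrow> 'v::complex_normed) set" where
  "L2 l = {u. u \<in> borel_measurable (interval_measure l) \<and>
              integrable (interval_measure l) (\<lambda>x. (norm (u x))\<^sup>2)}"

definition L2_norm :: "real \<Rightarrow> (real \<Rightarrow> 'v::complex_normed) \<Rightarrow> real" where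
  "L2_norm l u = sqrt (LINT x|interval_measure l. (norm (u x))\<^sup>2)"

text \<open>
  Weak derivatives, \<open>H\<^sup>1\<close>, \<open>H\<^sup>2\<close> and \<open>H\<^sup>1\<^sub>0\<close> on an interval follow Brezis, Functional Analysis,
  Sobolev Spaces and Partial Differential Equations, Chapter 8, with \<open>C\<^sup>1\<close> test functions of compact
  support in the open interval.
\<close>

definition test_function :: "real \<Rightarrow> (real \<Rightarrow> complex) \<Rightarrow> bool" where
  "test_function l \<eta> \<longleftrightarrow> \<eta> C1_differentiable_on UNIV \<and>
     (\<exists>K. compact K \<and> K \<subseteq> {0<..<l} \<and> (\<forall>x. x \<notin> K \<longrightarrow> \<eta> x = 0))"

definition weak_deriv :: "real \<Rightarrow> (real \<Rightarrow> complex) \<Rightarrow> (real \<Rightarrow> complex) \<Rightarrow> bool" where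
  "weak_deriv l u w \<longleftrightarrow> u \<in> L2 l \<and> w \<in> L2 l \<and>
     (\<forall>\<eta>. test_function l \<eta> \<longrightarrow>
        (LINT x|interval_measure l. u x * vector_derivative \<eta> (at x))
          = - (LINT x|interval_measure l. w x * \<eta> x))"

definition H1 :: "real \<Rightarrow> (real \<Rightarrow> complex) set" where
  "H1 l = {u. \<exists>w. weak_deriv l u w}"

definition H2 :: "real \<Rightarrow> (real \<Rightarrow> complex) set" where
  "H2 l = {u. \<exists>w. weak_deriv l u w \<and> w \<in> H1 l}"

definition H1_0 :: "real \<Rightarrow> (real \<Rightarrow> complex) set" where
  "H1_0 l = {u. \<exists>w. weak_deriv l u w \<and>
     (\<forall>\<epsilon>>0. \<exists>\<eta>. test_function l \<eta> \<and> L2_norm l (\<lambda>x. u x - \<eta> x) < \<epsilon> \<and>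
        L2_norm l (\<lambda>x. w x - vector_derivative \<eta> (at x)) < \<epsilon>)}"

definition Ck_on :: "nat \<Rightarrow> (real \<Rightarrow> real) \<Rightarrow> real set \<Rightarrow> bool" where
  "Ck_on k f S \<longleftrightarrow> (\<exists>D :: nat \<Rightarrow> real \<Rightarrow> real.
     (\<forall>x\<in>S. D 0 x = f x) \<and>
     (\<forall>i<k. \<forall>x\<in>S. (D i has_real_derivative D (Suc i) x) (at x within S)) \<and>
     continuous_on S (D k))"

text \<open>
  For (the class of) a real-valued \<open>v\<close> in \<open>H\<^sup>2(0,l)\<close>: the number \<open>v'(l)\<close>, computed from the
  representative of \<open>v\<close> that is continuously differentiable on the closed interval.
\<close>

definition right_end_deriv :: "real \<Rightarrow> (real \<Rightarrow> real) \<Rightarrow> real" where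
  "right_end_deriv l v = (THE d. \<exists>w. (AE x in interval_measure l. w x = v x) \<and>
     Ck_on 1 w {0..l} \<and> (w has_real_derivative d) (at l within {0..l}))"


section \<open>Unbounded operators and their spectra\<close>

text \<open>
  An unbounded operator is given by its graph, a set of pairs of representatives that is closed
  under almost-everywhere equality in both components.
\<close>

type_synonym 'v operator = "((real \<Rightarrow> 'v) \<times> (real \<Rightarrow> 'v)) set"

definition op_kernel :: "'v::complex_normed operator \<Rightarrow> (real \<Rightarrow> 'v) set" where
  "op_kernel T = {u. (u, \<lambda>x. 0) \<in> T}"

definition spans :: "real \<Rightarrow> (real \<Rightarrow> 'v::complex_normed) \<Rightarrow> (real \<Rightarrow> 'v) set \<Rightarrow> bool" where
  "spans l v V \<longleftrightarrow> V = {w \<in> L2 l. \<exists>c. AE x in interval_measure l. w x = c *\<^sub>C v x}"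

definition resolvent_set :: "real \<Rightarrow> 'v::complex_normed operator \<Rightarrow> complex set" where
  "resolvent_set l T = {\<mu>.
     (\<forall>w \<in> L2 l. \<exists>u z. (u, z) \<in> T \<and> (AE x in interval_measure l. z x - \<mu> *\<^sub>C u x = w x)) \<and>
     (\<exists>C. \<forall>(u, z) \<in> T. L2_norm l u \<le> C * L2_norm l (\<lambda>x. z x - \<mu> *\<^sub>C u x))}"
  \<comment> \<open>The estimate says that \<open>T - \<mu>\<close> is injective and its inverse is bounded.\<close>

definition Spec :: "real \<Rightarrow> 'v::complex_normed operator \<Rightarrow> complex set" where
  "Spec l T = - resolvent_set l T"

definition eigenvalue :: "real \<Rightarrow> 'v::complex_normed operator \<Rightarrow> complex \<Rightarrow> bool" where
  "eigenvalue l T \<mu> \<longleftrightarrow>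
     (\<exists>u. (u, \<lambda>x. \<mu> *\<^sub>C u x) \<in> T \<and> \<not> (AE x in interval_measure l. u x = 0))"

text \<open>\<open>ker_power l T \<mu> k\<close> is the kernel of \<open>(T - \<mu>)\<^sup>k\<close> on its natural domain.\<close>

primrec ker_power :: "real \<Rightarrow> 'v::complex_normed operator \<Rightarrow> complex \<Rightarrow> nat \<Rightarrow> (real \<Rightarrow> 'v) set" where
  "ker_power l T \<mu> 0 = {u \<in> L2 l. AE x in interval_measure l. u x = 0}"
| "ker_power l T \<mu> (Suc k) = {u. \<exists>z. (u, z) \<in> T \<and> (\<lambda>x. z x - \<mu> *\<^sub>C u x) \<in> ker_power l T \<mu> k}"

text \<open>Complex dimension of a space of functions modulo almost-everywhere equality.\<close>

definition ae_dim :: "real \<Rightarrow> (real \<Rightarrow> 'v::complex_normed) set \<Rightarrow> enat" where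
  "ae_dim l V = (SUP n \<in> {n. \<exists>b :: nat \<Rightarrow> real \<Rightarrow> 'v. (\<forall>i<n. b i \<in> V) \<and>
      (\<forall>c. (AE x in interval_measure l. (\<Sum>i<n. c i *\<^sub>C b i x) = 0) \<longrightarrow> (\<forall>i<n. c i = 0))}. enat n)"

definition multiplicity :: "real \<Rightarrow> 'v::complex_normed operator \<Rightarrow> complex \<Rightarrow> enat" where
  "multiplicity l T \<mu> = ae_dim l (\<Union>k. ker_power l T \<mu> k)"

text \<open>
  Number of eigenvalues in a set, counted with algebraic multiplicity; extended naturals, so that
  an infinite number of eigenvalues is not confused with none.
\<close>

definition num_eigenvalues :: "real \<Rightarrow> 'v::complex_normed operator \<Rightarrow> complex set \<Rightarrow> enat" where
  "num_eigenvalues l T \<Lambda> =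
     (SUP F \<in> {F. finite F \<and> F \<subseteq> {\<mu> \<in> \<Lambda>. eigenvalue l T \<mu>}}. \<Sum>\<mu>\<in>F. multiplicity l T \<mu>)"

definition num_negative :: "real \<Rightarrow> 'v::complex_normed operator \<Rightarrow> enat" where
  "num_negative l T = num_eigenvalues l T (complex_of_real ` {..<0})"

definition num_positive :: "real \<Rightarrow> 'v::complex_normed operator \<Rightarrow> enat" where
  "num_positive l T = num_eigenvalues l T (complex_of_real ` {0<..})"


section \<open>The operators\<close>

definition schroedinger_op :: "real \<Rightarrow> (real \<Rightarrow> real) \<Rightarrow> complex operator" where
  "schroedinger_op l q = {(u, w). u \<in> H2 l \<inter> H1_0 l \<and> w \<in> L2 l \<and>
     (\<exists>u1 u2. weak_deriv l u u1 \<and> weak_deriv l u1 u2 \<and>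
        (AE x in interval_measure l. w x = - u2 x - complex_of_real (q x) * u x))}"

text \<open>\<open>N(u,v) = (-L\<^sub>-v, L\<^sub>+u)\<close> where \<open>L\<^sub>+\<close>, \<open>L\<^sub>-\<close> have the potentials \<open>g\<close>, \<open>h\<close> respectively.\<close>

definition N_op :: "real \<Rightarrow> (real \<Rightarrow> real) \<Rightarrow> (real \<Rightarrow> real) \<Rightarrow> (complex \<times> complex) operator" where
  "N_op l g h = {(\<lambda>x. (u x, v x), \<lambda>x. (- a x, b x)) | u v a b.
     (v, a) \<in> schroedinger_op l h \<and> (u, b) \<in> schroedinger_op l g}"

abbreviation cplx :: "(real \<Rightarrow> real) \<Rightarrow> real \<Rightarrow> complex" where
  "cplx u \<equiv> (\<lambda>x. complex_of_real (u x))"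

definition L2_inner :: "real \<Rightarrow> (real \<Rightarrow> real) \<Rightarrow> (real \<Rightarrow> real) \<Rightarrow> real" where
  "L2_inner l u v = (LINT x|interval_measure l. u x * v x)"


section \<open>Standing waves of the nonlinear Schroedinger equation\<close>

text \<open>The wave is \<open>exp (\<i> * \<beta> * t) * \<phi> x\<close>, for the equation \<open>\<i> \<psi>\<^sub>t = \<psi>\<^sub>x\<^sub>x + f(|\<psi>|\<^sup>2) \<psi>\<close>.\<close>

definition standing_wave :: "real \<Rightarrow> (real \<Rightarrow> real) \<Rightarrow> real \<Rightarrow> (real \<Rightarrow> real) \<Rightarrow> bool" where
  "standing_wave l f \<beta> \<phi> \<longleftrightarrow> Ck_on 3 f {0..} \<and>
     (\<exists>\<phi>1 \<phi>2. \<forall>x\<in>{0..l}. (\<phi> has_real_derivative \<phi>1 x) (at x within {0..l}) \<and>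
        (\<phi>1 has_real_derivative \<phi>2 x) (at x within {0..l}) \<and>
        \<phi>2 x + f ((\<phi> x)\<^sup>2) * \<phi> x + \<beta> * \<phi> x = 0)"

definition nls_g :: "(real \<Rightarrow> real) \<Rightarrow> real \<Rightarrow> (real \<Rightarrow> real) \<Rightarrow> real \<Rightarrow> real" where
  "nls_g f \<beta> \<phi> x =
     2 * vector_derivative f (at ((\<phi> x)\<^sup>2) within {0..}) * (\<phi> x)\<^sup>2 + f ((\<phi> x)\<^sup>2) + \<beta>"

definition nls_h :: "(real \<Rightarrow> real) \<Rightarrow> real \<Rightarrow> (real \<Rightarrow> real) \<Rightarrow> real \<Rightarrow> real" where
  "nls_h f \<beta> \<phi> x = f ((\<phi> x)\<^sup>2) + \<beta>"

definition spectrally_unstable :: "real \<Rightarrow> (real \<Rightarrow> real) \<Rightarrow> real \<Rightarrow> (real \<Rightarrow> real) \<Rightarrow> bool" where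
  "spectrally_unstable l f \<beta> \<phi> \<longleftrightarrow>
     (\<exists>\<mu> \<in> Spec l (N_op l (nls_g f \<beta> \<phi>) (nls_h f \<beta> \<phi>)). Re \<mu> > 0)"

definition spectrally_stable :: "real \<Rightarrow> (real \<Rightarrow> real) \<Rightarrow> real \<Rightarrow> (real \<Rightarrow> real) \<Rightarrow> bool" where
  "spectrally_stable l f \<beta> \<phi> \<longleftrightarrow> \<not> spectrally_unstable l f \<beta> \<phi>"

definition arises_from :: "real \<Rightarrow> (real \<Rightarrow> real) \<Rightarrow> (real \<Rightarrow> real) \<Rightarrow>
    (real \<Rightarrow> real) \<Rightarrow> real \<Rightarrow> (real \<Rightarrow> real) \<Rightarrow> bool" where
  "arises_from l g h f \<beta> \<phi> \<longleftrightarrow> standing_wave l f \<beta> \<phi> \<and>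
     (\<forall>x\<in>{0..l}. g x = nls_g f \<beta> \<phi> x \<and> h x = nls_h f \<beta> \<phi> x)"

end

theory Submission
  imports Defs
begin

text \<open>
  Write \<open>L\<^sub>+\<close>, \<open>L\<^sub>-\<close> for the Dirichlet realisations of \<open>- d\<^sup>2/dx\<^sup>2 - g\<close> and \<open>- d\<^sup>2/dx\<^sup>2 - h\<close>. Conjugation of \<open>N\<close>
  with \<open>(u, v) \<mapsto> (v, - u)\<close> exchanges the two potentials and turns the second part of the theorem into
  the first. So let \<open>L\<^sub>+\<close> have exactly one negative eigenvalue, with eigenfunction \<open>e\<close>, and no kernel, let
  \<open>L\<^sub>-\<close> be nonnegative with kernel spanned by \<open>v\<close>, and let \<open>u_hat = L\<^sub>+\<^sup>-\<^sup>1 v\<close>.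

  \<^emph>\<open>Positivity.\<close> The forms \<open>\<langle>L\<^sub>+ u, u\<rangle>\<close> and \<open>\<langle>L\<^sub>- v, v\<rangle>\<close> are strictly positive on the complements of the
  respective eigenfunctions (\<open>schroedinger_positive_on_complement\<close>), for the following reason. If a
  symmetric operator \<open>L + \<sigma>\<close> is nonnegative and has an inverse bounded by \<open>C\<close>, then it is at least
  \<open>1 / (C + 1)\<close>, so \<open>\<sigma>\<close> can be lowered a little; by \<open>form_descent\<close> it can be lowered to \<open>0\<close> if no
  eigenvalue is met, and on the complement of the eigenfunction none is. Bounded invertibility away from the eigenvalues
  is the Fredholm alternative for boundary value problems of ordinary differential equations, which is
  finite-dimensional linear algebra (\<open>fredholm_alternative\<close>).

  \<^emph>\<open>At most one positive eigenvalue.\<close> \<open>N\<close> is skew with respect to the symplectic form \<open>symp\<close>, so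
  generalised eigenvectors for \<open>\<nu>\<close> and \<open>\<mu>\<close> are symplectically orthogonal unless \<open>\<nu> + cnj \<mu> = 0\<close>. Hence the
  energy \<open>\<langle>L\<^sub>+ u, u\<rangle> + \<langle>L\<^sub>- v, v\<rangle>\<close> vanishes on the sum of the generalised eigenspaces for
  positive eigenvalues. If this sum had dimension two it would contain a vector with \<open>u\<close> orthogonal to \<open>e\<close>,
  and this vector would be a multiple of the kernel vector \<open>(0, v)\<close>; but \<open>(0, v)\<close> is not symplectically
  orthogonal to the generalised kernel vector \<open>(u_hat, 0)\<close> when \<open>\<langle>u_hat, v\<rangle>\<close> is nonzero
  (\<open>generalized_eigenvectors_dependent\<close>).

  \<^emph>\<open>Existence for \<open>\<langle>u_hat, v\<rangle> > 0\<close>.\<close> On the complement of \<open>v\<close>, eigenvalues \<open>r > 0\<close> of \<open>N\<close> are the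
  numbers for which \<open>L\<^sub>+ + r\<^sup>2 L\<^sub>-\<^sup>-\<^sup>1\<close> is not invertible. Without any, the descent argument would show that
  \<open>L\<^sub>+\<close> is nonnegative on the complement of \<open>v\<close>, contrary to the sign of \<open>\<langle>u_hat, v\<rangle>\<close>
  (\<open>positive_eigenvalue_exists\<close>).

  \<^emph>\<open>Stability for \<open>\<langle>u_hat, v\<rangle> < 0\<close>.\<close> In this case \<open>L\<^sub>+\<close> is positive on the complement of \<open>v\<close>. An
  eigenvector for an eigenvalue off the imaginary axis has \<open>u\<close> orthogonal to \<open>v\<close> and zero energy, so there
  is none (\<open>no_unstable_eigenvector\<close>), and the Fredholm alternative excludes other spectrum.

  The statements about standing waves follow because the factor \<open>(2 / l) / (v'(l))\<^sup>2\<close> does not change the sign.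
\<close>

section \<open>Square-integrable functions\<close>

definition ip :: "real \<Rightarrow> (real \<Rightarrow> complex) \<Rightarrow> (real \<Rightarrow> complex) \<Rightarrow> complex" where
  "ip l f g = (LINT x|interval_measure l. f x * cnj (g x))"

lemma finite_measure_interval: "finite_measure (interval_measure l)"
  by (rule finite_measure_lebesgue_on) simp

lemma measurable_interval_closed:
  "f \<in> borel_measurable (lebesgue_on {0..l}) \<Longrightarrow> f \<in> borel_measurable (interval_measure l)"
  by (erule measurable_restrict_mono) (rule greaterThanLessThan_subseteq_atLeastAtMost_iff [THEN iffD2], simp)

lemma continuous_integrable_interval:
  fixes f :: "real \<Rightarrow> 'a::euclidean_space"
  assumes "continuous_on {0..l} f"
  shows "integrable (interval_measure l) f"
proof -
  have "f absolutely_integrable_on {0..l}"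
    by (rule absolutely_integrable_continuous_real [OF assms])
  then have "f absolutely_integrable_on {0<..<l}"
    by (rule set_integrable_subset) auto
  then show ?thesis
    by (simp add: integrable_restrict_space set_integrable_def)
qed

lemma integrable_interval_absolutely:
  fixes f :: "real \<Rightarrow> 'a::euclidean_space"
  assumes "integrable (interval_measure l) f"
  shows "f absolutely_integrable_on {0..l}"
proof -
  have "f absolutely_integrable_on {0<..<l}"
    using assms by (simp add: integrable_restrict_space set_integrable_def)
  then show ?thesis
    by (rule absolutely_integrable_spike_set)
      (auto intro: negligible_subset [of "{0,l}"])
qed

lemma LINT_interval_eq_integral:
  fixes f :: "real \<Rightarrow> 'a::euclidean_space"
  assumes "integrable (interval_measure l) f"
  shows "(LINT x|interval_measure l. f x) = integral {0..l} f"
  by (subst lebesgue_integral_eq_integral [OF assms]) (auto simp: integral_open_interval_real)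

lemma continuous_AE_zero_imp_zero:
  fixes f :: "real \<Rightarrow> 'a::euclidean_space"
  assumes l: "0 < l" and f: "continuous_on {0..l} f" and ae: "AE x in interval_measure l. f x = 0"
    and x: "x \<in> {0..l}"
  shows "f x = 0"
proof -
  have "(LINT x|interval_measure l. norm (f x)) = 0"
    using ae by (intro integral_eq_zero_AE) (auto elim: eventually_mono)
  then have "integral {0..l} (\<lambda>x. norm (f x)) = 0"
    by (subst LINT_interval_eq_integral [symmetric]) (intro continuous_integrable_interval continuous_intros f)
  then have "((\<lambda>x. norm (f x)) has_integral 0) {0..l}"
    using integrable_integral [OF integrable_continuous_real [OF continuous_on_norm [OF f]]] by metis
  then show ?thesis
    using has_integral_0_cbox_imp_0 [of 0 l "\<lambda>x. norm (f x)" x] continuous_on_norm [OF f] x l by auto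
qed

lemma L2_measurable: "u \<in> L2 l \<Longrightarrow> u \<in> borel_measurable (interval_measure l)"
  and L2_integrable_sq: "u \<in> L2 l \<Longrightarrow> integrable (interval_measure l) (\<lambda>x. (norm (u x))\<^sup>2)"
  by (simp_all add: L2_def)

lemma L2_continuous:
  fixes f :: "real \<Rightarrow> 'a::{complex_normed,euclidean_space}"
  assumes "continuous_on {0..l} f"
  shows "f \<in> L2 l"
proof -
  have "f \<in> borel_measurable (lebesgue_on {0..l})"
    by (rule continuous_imp_measurable_on_sets_lebesgue [OF assms]) simp
  moreover have "integrable (interval_measure l) (\<lambda>x. (norm (f x))\<^sup>2)"
    by (intro continuous_integrable_interval continuous_intros assms)
  ultimately show ?thesis
    by (simp add: L2_def measurable_interval_closed)
qed

lemma L2_domin: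
  fixes u :: "real \<Rightarrow> 'v::complex_normed"
  assumes "u \<in> borel_measurable (interval_measure l)" "integrable (interval_measure l) w"
    "AE x in interval_measure l. (norm (u x))\<^sup>2 \<le> w x"
  shows "u \<in> L2 l"
proof -
  have "integrable (interval_measure l) (\<lambda>x. (norm (u x))\<^sup>2)"
  proof (rule Bochner_Integration.integrable_bound [OF assms(2)])
    show "(\<lambda>x. (norm (u x))\<^sup>2) \<in> borel_measurable (interval_measure l)"
      using assms(1) by measurable
    show "AE x in interval_measure l. norm ((norm (u x))\<^sup>2) \<le> norm (w x)"
      using assms(3) by eventually_elim auto
  qed
  with assms(1) show ?thesis by (simp add: L2_def)
qed

lemma L2_add:
  fixes u v :: "real \<Rightarrow> 'v::{complex_normed,second_countable_topology}"
  assumes "u \<in> L2 l" "v \<in> L2 l"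
  shows "(\<lambda>x. u x + v x) \<in> L2 l"
proof (rule L2_domin)
  show "(\<lambda>x. u x + v x) \<in> borel_measurable (interval_measure l)"
    using assms[THEN L2_measurable] by measurable
  show "integrable (interval_measure l) (\<lambda>x. 2 * (norm (u x))\<^sup>2 + 2 * (norm (v x))\<^sup>2)"
    using assms by (auto intro!: L2_integrable_sq)
  have "(norm (u x + v x))\<^sup>2 \<le> 2 * (norm (u x))\<^sup>2 + 2 * (norm (v x))\<^sup>2" for x
  proof -
    have "(norm (u x + v x))\<^sup>2 \<le> (norm (u x) + norm (v x))\<^sup>2"
      by (simp add: norm_triangle_ineq power_mono)
    also have "\<dots> \<le> 2 * (norm (u x))\<^sup>2 + 2 * (norm (v x))\<^sup>2"
      using sum_squares_bound [of "norm (u x)" "norm (v x)"] by (simp add: power2_sum)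
    finally show ?thesis .
  qed
  then show "AE x in interval_measure l.
      (norm (u x + v x))\<^sup>2 \<le> 2 * (norm (u x))\<^sup>2 + 2 * (norm (v x))\<^sup>2" by simp
qed

lemma L2_mult_bounded:
  fixes u :: "real \<Rightarrow> complex"
  assumes "u \<in> L2 l" "q \<in> borel_measurable (interval_measure l)"
    "\<And>x. x \<in> {0..l} \<Longrightarrow> norm (q x) \<le> C"
  shows "(\<lambda>x. q x * u x) \<in> L2 l"
proof (rule L2_domin)
  show "(\<lambda>x. q x * u x) \<in> borel_measurable (interval_measure l)"
    using assms(2) L2_measurable [OF assms(1)] by measurable
  show "integrable (interval_measure l) (\<lambda>x. C\<^sup>2 * (norm (u x))\<^sup>2)"
    using assms by (auto intro!: L2_integrable_sq)
  have "(norm (q x * u x))\<^sup>2 \<le> C\<^sup>2 * (norm (u x))\<^sup>2" if "x \<in> {0<..<l}" for x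
    using that assms(3) [of x] by (auto simp: norm_mult power_mult_distrib intro!: mult_right_mono power_mono)
  then show "AE x in interval_measure l. (norm (q x * u x))\<^sup>2 \<le> C\<^sup>2 * (norm (u x))\<^sup>2"
    by (auto intro: AE_I2)
qed

lemma L2_mult_continuous:
  fixes u q :: "real \<Rightarrow> complex"
  assumes "u \<in> L2 l" "continuous_on {0..l} q"
  shows "(\<lambda>x. q x * u x) \<in> L2 l"
proof -
  have "bounded (q ` {0..l})"
    using compact_imp_bounded [OF compact_continuous_image [OF assms(2)]] by simp
  then obtain C where "\<And>x. x \<in> {0..l} \<Longrightarrow> norm (q x) \<le> C"
    unfolding bounded_iff by blast
  then show ?thesis
    using L2_mult_bounded [OF assms(1) L2_measurable [OF L2_continuous [OF assms(2)]]] by blast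
qed

lemma L2_cmult: "u \<in> L2 l \<Longrightarrow> (\<lambda>x. c * u x :: complex) \<in> L2 l"
  by (rule L2_mult_continuous) auto

lemma L2_uminus: "u \<in> L2 l \<Longrightarrow> (\<lambda>x. - u x :: complex) \<in> L2 l"
  using L2_cmult [of u l "-1"] by simp

lemma L2_diff: "u \<in> L2 l \<Longrightarrow> v \<in> L2 l \<Longrightarrow> (\<lambda>x. u x - v x :: complex) \<in> L2 l"
  using L2_add [of u l "\<lambda>x. - v x"] L2_uminus [of v] by simp

lemma L2_zero [simp]: "(\<lambda>x. 0 :: 'v::{complex_normed,euclidean_space}) \<in> L2 l"
  by (rule L2_continuous) auto

lemma L2_cnj: "u \<in> L2 l \<Longrightarrow> (\<lambda>x. cnj (u x)) \<in> L2 l"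
  by (auto simp: L2_def intro: borel_measurable_continuous_on[OF continuous_on_cnj[OF continuous_on_id]])

lemma L2_AE_cong:
  fixes u v :: "real \<Rightarrow> 'v::{complex_normed,euclidean_space}"
  assumes "u \<in> L2 l" "AE x in interval_measure l. v x = u x"
  shows "v \<in> L2 l"
proof -
  have "v \<in> borel_measurable (interval_measure l)"
  proof -
    have "AE x in lebesgue. (if x \<in> {0<..<l} then u x else 0) = (if x \<in> {0<..<l} then v x else 0)"
      using assms(2) by (subst (asm) AE_restrict_space_iff) (auto elim: eventually_mono)
    moreover have "(\<lambda>x. if x \<in> {0<..<l} then u x else 0) \<in> borel_measurable lebesgue"
      using L2_measurable [OF assms(1)] by (rule borel_measurable_if_I) simp
    ultimately have "(\<lambda>x. if x \<in> {0<..<l} then v x else 0) \<in> borel_measurable lebesgue"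
      by (rule borel_measurable_AE [rotated])
    then show ?thesis by (rule borel_measurable_if_D)
  qed
  then show ?thesis
    using assms(2) L2_integrable_sq [OF assms(1)] by (rule_tac L2_domin) auto
qed

lemma L2_pair:
  fixes w :: "real \<Rightarrow> complex \<times> complex"
  shows "w \<in> L2 l \<longleftrightarrow> (\<lambda>x. fst (w x)) \<in> L2 l \<and> (\<lambda>x. snd (w x)) \<in> L2 l"
proof safe
  assume w: "w \<in> L2 l"
  have m: "(\<lambda>x. fst (w x)) \<in> borel_measurable (interval_measure l)"
    "(\<lambda>x. snd (w x)) \<in> borel_measurable (interval_measure l)"
    using L2_measurable[OF w] by (auto simp: borel_prod[symmetric])
  show "(\<lambda>x. fst (w x)) \<in> L2 l" "(\<lambda>x. snd (w x)) \<in> L2 l"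
    by (rule L2_domin [OF _ L2_integrable_sq [OF w]];
        use m in \<open>auto simp: norm_prod_def\<close>)+
next
  assume a: "(\<lambda>x. fst (w x)) \<in> L2 l" "(\<lambda>x. snd (w x)) \<in> L2 l"
  have "(\<lambda>x. (fst (w x), snd (w x))) \<in> borel_measurable (interval_measure l)"
    using a[THEN L2_measurable] by (rule borel_measurable_Pair)
  then show "w \<in> L2 l"
    using a[THEN L2_integrable_sq]
    by (auto simp: L2_def norm_prod_def)
qed

lemma L2_mult_integrable:
  fixes u v :: "real \<Rightarrow> complex"
  assumes "u \<in> L2 l" "v \<in> L2 l"
  shows "integrable (interval_measure l) (\<lambda>x. u x * v x)"
proof (rule Bochner_Integration.integrable_bound)
  show "integrable (interval_measure l) (\<lambda>x. (norm (u x))\<^sup>2 + (norm (v x))\<^sup>2)"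
    using assms by (auto intro!: L2_integrable_sq)
  show "(\<lambda>x. u x * v x) \<in> borel_measurable (interval_measure l)"
    using assms[THEN L2_measurable] by measurable
  have "norm (u x * v x) \<le> norm ((norm (u x))\<^sup>2 + (norm (v x))\<^sup>2)" for x
  proof -
    have "2 * (norm (u x) * norm (v x)) \<le> (norm (u x))\<^sup>2 + (norm (v x))\<^sup>2"
      using sum_squares_bound [of "norm (u x)" "norm (v x)"] by simp
    moreover have "0 \<le> norm (u x) * norm (v x)" by simp
    ultimately show ?thesis unfolding norm_mult by (simp add: abs_if)
  qed
  then show "AE x in interval_measure l. norm (u x * v x) \<le> norm ((norm (u x))\<^sup>2 + (norm (v x))\<^sup>2)"
    by simp
qed

lemma L2_integrable:
  fixes u :: "real \<Rightarrow> complex"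
  shows "u \<in> L2 l \<Longrightarrow> integrable (interval_measure l) u"
  using L2_mult_integrable [of u l "\<lambda>x. 1"] by (simp add: L2_continuous)

lemma ip_integrable:
  "u \<in> L2 l \<Longrightarrow> v \<in> L2 l \<Longrightarrow> integrable (interval_measure l) (\<lambda>x. u x * cnj (v x))"
  by (intro L2_mult_integrable L2_cnj)

lemma ip_add_left: "u \<in> L2 l \<Longrightarrow> v \<in> L2 l \<Longrightarrow> w \<in> L2 l \<Longrightarrow>
    ip l (\<lambda>x. u x + v x) w = ip l u w + ip l v w"
  by (simp add: ip_def distrib_right ip_integrable)

lemma ip_add_right: "u \<in> L2 l \<Longrightarrow> v \<in> L2 l \<Longrightarrow> w \<in> L2 l \<Longrightarrow>
    ip l w (\<lambda>x. u x + v x) = ip l w u + ip l w v"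
  by (simp add: ip_def distrib_left ip_integrable)

lemma ip_diff_left: "u \<in> L2 l \<Longrightarrow> v \<in> L2 l \<Longrightarrow> w \<in> L2 l \<Longrightarrow>
    ip l (\<lambda>x. u x - v x) w = ip l u w - ip l v w"
  by (simp add: ip_def left_diff_distrib ip_integrable)

lemma ip_diff_right: "u \<in> L2 l \<Longrightarrow> v \<in> L2 l \<Longrightarrow> w \<in> L2 l \<Longrightarrow>
    ip l w (\<lambda>x. u x - v x) = ip l w u - ip l w v"
  by (simp add: ip_def right_diff_distrib ip_integrable)

lemma ip_cmult_left: "ip l (\<lambda>x. c * u x) w = c * ip l u w"
  by (simp add: ip_def mult.assoc)

lemma ip_cmult_right: "ip l w (\<lambda>x. c * u x) = cnj c * ip l w u"
  by (simp add: ip_def mult.left_commute)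

lemma ip_uminus_left: "ip l (\<lambda>x. - u x) w = - ip l u w"
  and ip_uminus_right: "ip l w (\<lambda>x. - u x) = - ip l w u"
  by (simp_all add: ip_def)

lemma ip_cnj: "cnj (ip l u v) = ip l v u"
  unfolding ip_def by (subst Bochner_Integration.integral_cnj[symmetric]) (simp add: mult.commute)

lemma ip_zero [simp]: "ip l (\<lambda>x. 0) w = 0" "ip l w (\<lambda>x. 0) = 0"
  by (simp_all add: ip_def)

lemma ip_AE_cong:
  assumes "u \<in> L2 l" "v \<in> L2 l" "AE x in interval_measure l. u' x = u x"
    "AE x in interval_measure l. v' x = v x"
  shows "ip l u' v' = ip l u v"
  unfolding ip_def
proof (rule integral_cong_AE)
  show "(\<lambda>x. u' x * cnj (v' x)) \<in> borel_measurable (interval_measure l)"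
    using ip_integrable [OF L2_AE_cong L2_AE_cong, of u l u' v v'] assms by auto
  show "(\<lambda>x. u x * cnj (v x)) \<in> borel_measurable (interval_measure l)"
    using ip_integrable [of u l v] assms by auto
  show "AE x in interval_measure l. u' x * cnj (v' x) = u x * cnj (v x)"
    using assms(3,4) by eventually_elim simp
qed

lemma ip_self: "ip l u u = complex_of_real ((L2_norm l u)\<^sup>2)"
proof -
  have "0 \<le> (LINT x|interval_measure l. (norm (u x))\<^sup>2)" by simp
  moreover have "ip l u u = (LINT x|interval_measure l. complex_of_real ((norm (u x))\<^sup>2))"
    by (simp only: ip_def complex_norm_square)
  ultimately show ?thesis
    by (simp add: L2_norm_def del: of_real_power)
qed

lemma L2_norm_nonneg [simp]: "0 \<le> L2_norm l u"
  by (simp add: L2_norm_def)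

lemma L2_norm_sq: "(L2_norm l u)\<^sup>2 = (LINT x|interval_measure l. (norm (u x))\<^sup>2)"
  by (simp add: L2_norm_def)

lemma L2_norm_AE_cong:
  fixes u v :: "real \<Rightarrow> 'v::{complex_normed,euclidean_space}"
  assumes "u \<in> L2 l" "AE x in interval_measure l. v x = u x"
  shows "L2_norm l v = L2_norm l u"
proof -
  have "(LINT x|interval_measure l. (norm (v x))\<^sup>2) = (LINT x|interval_measure l. (norm (u x))\<^sup>2)"
    using assms L2_integrable_sq [OF L2_AE_cong [OF assms]] L2_integrable_sq [OF assms(1)]
    by (intro integral_cong_AE) (auto elim: eventually_mono)
  then show ?thesis by (simp add: L2_norm_def)
qed

lemma L2_norm_eq_0:
  fixes u :: "real \<Rightarrow> 'v::complex_normed"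
  assumes "u \<in> L2 l"
  shows "L2_norm l u = 0 \<longleftrightarrow> (AE x in interval_measure l. u x = 0)"
  using integral_nonneg_eq_0_iff_AE [OF L2_integrable_sq [OF assms]]
  by (simp add: L2_norm_def)

lemma ip_self_eq_0:
  "u \<in> L2 l \<Longrightarrow> ip l u u = 0 \<Longrightarrow> AE x in interval_measure l. u x = 0"
  using L2_norm_eq_0 [of u l] by (simp add: ip_self)

lemma ip_Cauchy_Schwarz:
  assumes "u \<in> L2 l" "v \<in> L2 l"
  shows "cmod (ip l u v) \<le> L2_norm l u * L2_norm l v"
proof -
  have int: "integrable (interval_measure l) (\<lambda>x. norm (u x) * norm (v x))"
    using integrable_norm [OF L2_mult_integrable [OF assms]] unfolding norm_mult .
  have "cmod (ip l u v) \<le> (LINT x|interval_measure l. norm (u x) * norm (v x))"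
    unfolding ip_def by (rule order_trans [OF integral_norm_bound]) (simp add: norm_mult)
  moreover have "(LINT x|interval_measure l. norm (u x) * norm (v x)) \<le> L2_norm l u * L2_norm l v"
  proof (cases "L2_norm l u = 0 \<or> L2_norm l v = 0")
    case True
    then have "AE x in interval_measure l. norm (u x) * norm (v x) = 0"
    proof
      assume "L2_norm l u = 0"
      then have "AE x in interval_measure l. u x = 0" by (simp add: L2_norm_eq_0 assms)
      then show ?thesis by eventually_elim simp
    next
      assume "L2_norm l v = 0"
      then have "AE x in interval_measure l. v x = 0" by (simp add: L2_norm_eq_0 assms)
      then show ?thesis by eventually_elim simp
    qed
    then show ?thesis by (simp add: integral_eq_zero_AE)
  next
    case False
    define A B where "A = L2_norm l u" and "B = L2_norm l v"
    have pos: "A > 0" "B > 0" using False by (auto simp: A_def B_def less_le)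
    have "norm (u x) * norm (v x) \<le> (B / A * (norm (u x))\<^sup>2 + A / B * (norm (v x))\<^sup>2) / 2" for x
      using sum_squares_ge_zero [of "B * norm (u x) - A * norm (v x)" 0] pos
      by (simp add: field_simps power2_eq_square)
    then have "(LINT x|interval_measure l. norm (u x) * norm (v x))
        \<le> (LINT x|interval_measure l. (B / A * (norm (u x))\<^sup>2 + A / B * (norm (v x))\<^sup>2) / 2)"
      using assms[THEN L2_integrable_sq] by (intro integral_mono int) auto
    also have "\<dots> = (B / A * A\<^sup>2 + A / B * B\<^sup>2) / 2"
      using assms[THEN L2_integrable_sq] by (simp add: A_def B_def L2_norm_sq)
    also have "\<dots> = A * B" using pos by (simp add: power2_eq_square)
    finally show ?thesis by (simp add: A_def B_def)
  qed
  ultimately show ?thesis by linarith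
qed

section \<open>Primitives of integrable functions\<close>

text \<open>
  Dividing the bound by \<open>t - s\<close> and using the continuity of \<open>G\<close> shows that \<open>\<Phi>\<close> has derivative zero
  everywhere.
\<close>

lemma constant_of_superlinear_increments:
  fixes \<Phi> :: "real \<Rightarrow> 'a::real_normed_vector" and G :: "real \<Rightarrow> real"
  assumes G: "continuous_on {0..l} G"
    and bd: "\<And>s t. 0 \<le> s \<Longrightarrow> s \<le> t \<Longrightarrow> t \<le> l \<Longrightarrow> norm (\<Phi> t - \<Phi> s) \<le> K * ((t - s) * (G t - G s))"
    and "0 \<le> K" "s \<in> {0..l}"
  shows "\<Phi> s = \<Phi> 0"
proof -
  have "(\<Phi> has_derivative (\<lambda>h. 0)) (at t within {0..l})" if t: "t \<in> {0..l}" for t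
  proof -
    have "((\<lambda>y. (1 / norm (y - t)) *\<^sub>R (\<Phi> y - (\<Phi> t + 0))) \<longlongrightarrow> 0) (at t within {0..l})"
    proof (rule tendsto_norm_zero_cancel, rule Lim_null_comparison)
      have "norm (norm ((1 / norm (y - t)) *\<^sub>R (\<Phi> y - (\<Phi> t + 0)))) \<le> K * \<bar>G y - G t\<bar>"
        if y: "y \<in> {0..l}" "y \<noteq> t" for y
      proof -
        have "norm (\<Phi> y - \<Phi> t) \<le> K * (\<bar>y - t\<bar> * \<bar>G y - G t\<bar>)"
        proof (cases "y < t")
          case True
          then have "norm (\<Phi> y - \<Phi> t) \<le> K * ((t - y) * (G t - G y))"
            using bd [of y t] y t by (simp add: norm_minus_commute)
          also have "\<dots> \<le> K * (\<bar>y - t\<bar> * \<bar>G y - G t\<bar>)"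
            using True \<open>0 \<le> K\<close> by (simp add: mult_left_mono)
          finally show ?thesis .
        next
          case False
          then have "norm (\<Phi> y - \<Phi> t) \<le> K * ((y - t) * (G y - G t))"
            using bd [of t y] y t by simp
          also have "\<dots> \<le> K * (\<bar>y - t\<bar> * \<bar>G y - G t\<bar>)"
            using False \<open>0 \<le> K\<close> by (simp add: mult_left_mono)
          finally show ?thesis .
        qed
        then show ?thesis using y by (simp add: divide_le_eq mult.commute mult.left_commute)
      qed
      then show "\<forall>\<^sub>F y in at t within {0..l}.
          norm (norm ((1 / norm (y - t)) *\<^sub>R (\<Phi> y - (\<Phi> t + 0)))) \<le> K * \<bar>G y - G t\<bar>"
        by (auto simp: eventually_at_filter)
      have "((\<lambda>y. G y) \<longlongrightarrow> G t) (at t within {0..l})"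
        using G t by (auto simp: continuous_on_def)
      then have "((\<lambda>y. K * \<bar>G y - G t\<bar>) \<longlongrightarrow> K * \<bar>G t - G t\<bar>) (at t within {0..l})"
        by (intro tendsto_intros)
      then show "((\<lambda>y. K * \<bar>G y - G t\<bar>) \<longlongrightarrow> 0) (at t within {0..l})" by simp
    qed
    then show ?thesis by (simp add: has_derivative_within)
  qed
  then obtain c where "\<forall>x\<in>{0..l}. \<Phi> x = c"
    using has_derivative_zero_constant [of "{0..l}" \<Phi>] by auto
  then show ?thesis using \<open>s \<in> {0..l}\<close> by auto
qed

lemma absolutely_integrable_subinterval:
  fixes p :: "real \<Rightarrow> 'a::euclidean_space"
  assumes "p absolutely_integrable_on {0..l}" "0 \<le> s" "t \<le> l"
  shows "p absolutely_integrable_on {s..t}"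
  using assms by (intro set_integrable_subset [OF assms(1)]) auto

lemma integral_times_continuous_integrable:
  fixes p c :: "real \<Rightarrow> complex"
  assumes "p absolutely_integrable_on {a..b}" "continuous_on {a..b} c"
  shows "(\<lambda>x. p x * c x) absolutely_integrable_on {a..b}"
proof -
  have "(\<lambda>x. c x * p x) absolutely_integrable_on {a..b}"
  proof (rule absolutely_integrable_bounded_measurable_product [OF bilinear_times])
    show "c \<in> borel_measurable (lebesgue_on {a..b})"
      by (rule continuous_imp_measurable_on_sets_lebesgue [OF assms(2)]) simp
    show "bounded (c ` {a..b})"
      by (intro compact_imp_bounded compact_continuous_image assms) simp
  qed (use assms in auto)
  then show ?thesis by (simp add: mult.commute)
qed

lemma primitive_continuous:
  fixes p :: "real \<Rightarrow> 'a::euclidean_space"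
  assumes "p absolutely_integrable_on {0..l}"
  shows "continuous_on {0..l} (\<lambda>x. integral {0..x} p)"
  using assms by (intro indefinite_integral_continuous_1) (simp add: set_lebesgue_integral_eq_integral)

text \<open>
  A primitive of an integrable function is differentiable only almost everywhere, so the classical
  product rule does not apply. Instead, the difference of the two sides, as a function \<open>\<Phi>\<close> of the
  upper limit, has increments bounded by a multiple of \<open>t - s\<close> times \<open>\<integral>\<bar>p\<bar>\<close> over \<open>{s..t}\<close>;
  this forces it to be constant.
\<close>

lemma primitive_by_parts:
  fixes p \<eta> \<eta>' :: "real \<Rightarrow> complex"
  assumes p: "p absolutely_integrable_on {0..l}"
    and \<eta>: "\<And>x. x \<in> {0..l} \<Longrightarrow> (\<eta> has_vector_derivative \<eta>' x) (at x within {0..l})"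
    and \<eta>': "continuous_on {0..l} \<eta>'"
    and s: "s \<in> {0..l}"
  shows "integral {0..s} (\<lambda>x. (\<alpha> + integral {0..x} p) * \<eta>' x)
    = (\<alpha> + integral {0..s} p) * \<eta> s - \<alpha> * \<eta> 0 - integral {0..s} (\<lambda>x. p x * \<eta> x)"
proof -
  define P where "P = (\<lambda>x. \<alpha> + integral {0..x} p)"
  define G where "G = (\<lambda>x. integral {0..x} (\<lambda>t. norm (p t)))"
  have np: "(\<lambda>t. norm (p t)) absolutely_integrable_on {0..l}"
    using p by (rule absolutely_integrable_norm [unfolded o_def])
  have contP: "continuous_on {0..l} P"
    unfolding P_def by (intro continuous_intros primitive_continuous p)
  have contG: "continuous_on {0..l} G"
    unfolding G_def by (rule primitive_continuous [OF np])
  have cont\<eta>: "continuous_on {0..l} \<eta>"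
    unfolding continuous_on_eq_continuous_within
    using has_vector_derivative_continuous [OF \<eta>] by blast
  obtain C where C: "\<And>x. x \<in> {0..l} \<Longrightarrow> norm (\<eta>' x) \<le> C"
    using compact_imp_bounded [OF compact_continuous_image [OF \<eta>']]
    unfolding bounded_iff by (metis compact_Icc imageI)
  have C0: "0 \<le> C" using C [OF s] norm_ge_zero order_trans by blast
  define \<Phi> where "\<Phi> = (\<lambda>t. integral {0..t} (\<lambda>x. P x * \<eta>' x) - P t * \<eta> t + integral {0..t} (\<lambda>x. p x * \<eta> x))"
  have "\<Phi> s = \<Phi> 0"
  proof (rule constant_of_superlinear_increments [OF contG _ _ s])
    fix s t :: real assume st: "0 \<le> s" "s \<le> t" "t \<le> l"
    have sub: "{s..t} \<subseteq> {0..l}" using st by auto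
    have pint: "p integrable_on {s..t}" "(\<lambda>t. norm (p t)) integrable_on {s..t}"
      using absolutely_integrable_subinterval [OF p, of s t] absolutely_integrable_subinterval [OF np, of s t] st
      by (auto simp: set_lebesgue_integral_eq_integral)
    have diffI: "integral {0..y} f - integral {0..x} f = integral {x..y} f"
      if "f absolutely_integrable_on {0..l}" "0 \<le> x" "x \<le> y" "y \<le> l" for x y and f :: "real \<Rightarrow> 'b::euclidean_space"
      using Henstock_Kurzweil_Integration.integral_combine [of 0 x y f]
        absolutely_integrable_subinterval [OF that(1), of 0 y] that
      by (simp add: set_lebesgue_integral_eq_integral algebra_simps)
    have P\<eta>': "(\<lambda>x. P x * \<eta>' x) absolutely_integrable_on {0..l}"
      by (intro absolutely_integrable_continuous_real continuous_intros contP \<eta>')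
    have p\<eta>: "(\<lambda>x. p x * \<eta> x) absolutely_integrable_on {0..l}"
      by (rule integral_times_continuous_integrable [OF p cont\<eta>])
    have \<eta>ts: "(\<eta>' has_integral (\<eta> t - \<eta> x)) {x..t}" if "x \<in> {s..t}" for x
      using that st by (intro fundamental_theorem_of_calculus has_vector_derivative_within_subset [OF \<eta>]) auto
    have i1: "(\<lambda>x. (P x - P s) * \<eta>' x) integrable_on {s..t}"
      by (intro integrable_continuous_real continuous_intros
          continuous_on_subset [OF contP sub] continuous_on_subset [OF \<eta>' sub])
    have i2: "(\<lambda>x. p x * (\<eta> x - \<eta> t)) integrable_on {s..t}"
      by (intro set_lebesgue_integral_eq_integral(1) integral_times_continuous_integrable continuous_intros
          continuous_on_subset [OF cont\<eta> sub] absolutely_integrable_subinterval [OF p] st)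
    have i3: "(\<lambda>x. p x * \<eta> x) integrable_on {s..t}"
      using absolutely_integrable_subinterval [OF p\<eta>] st by (simp add: set_lebesgue_integral_eq_integral)
    have i4: "(\<lambda>x. P x * \<eta>' x) integrable_on {s..t}"
      using absolutely_integrable_subinterval [OF P\<eta>'] st by (simp add: set_lebesgue_integral_eq_integral)
    have "\<Phi> t - \<Phi> s = integral {s..t} (\<lambda>x. P x * \<eta>' x) - P t * \<eta> t + P s * \<eta> s
        + integral {s..t} (\<lambda>x. p x * \<eta> x)"
      using diffI [OF P\<eta>', of s t] diffI [OF p\<eta>, of s t] st unfolding \<Phi>_def by (simp add: algebra_simps)
    also have "\<dots> = integral {s..t} (\<lambda>x. (P x - P s) * \<eta>' x) + integral {s..t} (\<lambda>x. p x * (\<eta> x - \<eta> t))"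
    proof -
      have e1: "integral {s..t} (\<lambda>x. (P x - P s) * \<eta>' x)
          = integral {s..t} (\<lambda>x. P x * \<eta>' x) - P s * (\<eta> t - \<eta> s)"
      proof -
        have "((\<lambda>x. P x * \<eta>' x - P s * \<eta>' x) has_integral
            (integral {s..t} (\<lambda>x. P x * \<eta>' x) - P s * (\<eta> t - \<eta> s))) {s..t}"
          using \<eta>ts [of s] st i4 by (intro has_integral_diff has_integral_mult_right) auto
        then show ?thesis by (simp add: left_diff_distrib integral_unique)
      qed
      have e2: "integral {s..t} (\<lambda>x. p x * (\<eta> x - \<eta> t))
          = integral {s..t} (\<lambda>x. p x * \<eta> x) - (P t - P s) * \<eta> t"
      proof -
        have "((\<lambda>x. p x * \<eta> x - p x * \<eta> t) has_integral
            (integral {s..t} (\<lambda>x. p x * \<eta> x) - integral {s..t} p * \<eta> t)) {s..t}"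
          using pint i3 by (intro has_integral_diff has_integral_mult_left) auto
        then show ?thesis
          using diffI [OF p, of s t] st by (simp add: right_diff_distrib integral_unique P_def)
      qed
      show ?thesis unfolding e1 e2 by (simp add: algebra_simps)
    qed
    finally have eq: "\<Phi> t - \<Phi> s = \<dots>" .
    have b1: "norm (integral {s..t} (\<lambda>x. (P x - P s) * \<eta>' x)) \<le> integral {s..t} (\<lambda>x. (G t - G s) * C)"
    proof (rule integral_norm_bound_integral [OF i1])
      fix x assume x: "x \<in> {s..t}"
      have "norm (P x - P s) = norm (integral {s..x} p)"
        using diffI [OF p, of s x] x st by (simp add: P_def)
      also have "\<dots> \<le> integral {s..x} (\<lambda>t. norm (p t))"
        using x st absolutely_integrable_subinterval [OF p, of s x] absolutely_integrable_subinterval [OF np, of s x]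
        by (intro integral_norm_bound_integral) (auto simp: set_lebesgue_integral_eq_integral)
      also have "\<dots> \<le> integral {s..t} (\<lambda>t. norm (p t))"
        using x st absolutely_integrable_subinterval [OF np, of s x] pint
        by (intro integral_subset_le) (auto simp: set_lebesgue_integral_eq_integral)
      also have "\<dots> = G t - G s"
        using diffI [OF np, of s t] st by (simp add: G_def)
      finally show "norm ((P x - P s) * \<eta>' x) \<le> (G t - G s) * C"
        unfolding norm_mult using C [of x] x sub order_trans [OF norm_ge_zero, of "P x - P s" "G t - G s"]
        by (intro mult_mono) auto
    qed auto
    have b2: "norm (integral {s..t} (\<lambda>x. p x * (\<eta> x - \<eta> t))) \<le> integral {s..t} (\<lambda>x. norm (p x) * (C * (t - s)))"
    proof (rule integral_norm_bound_integral [OF i2])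
      fix x assume x: "x \<in> {s..t}"
      have "norm (\<eta> t - \<eta> x) \<le> C * (t - x)"
        using has_integral_bound [OF C0, of \<eta>' "\<eta> t - \<eta> x" x t] \<eta>ts [OF x] x st C by simp
      also have "\<dots> \<le> C * (t - s)" using x C0 by (intro mult_left_mono) auto
      finally show "norm (p x * (\<eta> x - \<eta> t)) \<le> norm (p x) * (C * (t - s))"
        by (simp add: norm_mult norm_minus_commute mult_left_mono)
    qed (use pint in \<open>auto intro: integrable_on_mult_left\<close>)
    have "norm (\<Phi> t - \<Phi> s) \<le> (t - s) * ((G t - G s) * C) + (G t - G s) * (C * (t - s))"
      unfolding eq using norm_triangle_le [OF add_mono [OF b1 b2]] st diffI [OF np, of s t]
      by (simp add: G_def)
    then show "norm (\<Phi> t - \<Phi> s) \<le> (2 * C) * ((t - s) * (G t - G s))"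
      by (simp add: algebra_simps)
  qed (use C0 in simp)
  then show ?thesis by (simp add: \<Phi>_def P_def algebra_simps)
qed

text \<open>
  Cauchy's formula for repeated integration: integration by parts against the identity function.
\<close>

lemma double_primitive:
  fixes p :: "real \<Rightarrow> complex"
  assumes "p absolutely_integrable_on {0..l}" "s \<in> {0..l}"
  shows "integral {0..s} (\<lambda>x. \<alpha> + integral {0..x} p)
    = \<alpha> * of_real s + integral {0..s} (\<lambda>t. of_real (s - t) * p t)"
proof -
  have d: "(of_real has_vector_derivative (1::complex)) (at x within {0..l})" for x
    using bounded_linear_imp_has_derivative [OF bounded_linear_of_real, of "at x within {0..l}"]
    by (simp add: has_vector_derivative_def scaleR_conv_of_real)
  have "integral {0..s} (\<lambda>x. \<alpha> + integral {0..x} p)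
      = (\<alpha> + integral {0..s} p) * of_real s - integral {0..s} (\<lambda>t. p t * of_real t)"
    using primitive_by_parts [OF assms(1) d _ assms(2), where \<alpha> = \<alpha>] by simp
  moreover have "integral {0..s} (\<lambda>t. of_real (s - t) * p t)
      = integral {0..s} p * of_real s - integral {0..s} (\<lambda>t. p t * of_real t)"
  proof -
    have i: "p integrable_on {0..s}" "(\<lambda>t. p t * of_real t) integrable_on {0..s}"
      using absolutely_integrable_subinterval [OF assms(1), of 0 s] assms(2)
        integral_times_continuous_integrable [where p = p and a = 0 and b = s and c = of_real]
      by (auto simp: set_lebesgue_integral_eq_integral continuous_on_of_real continuous_on_id)
    then have "integral {0..s} (\<lambda>t. p t * of_real s - p t * of_real t)
      = integral {0..s} p * of_real s - integral {0..s} (\<lambda>t. p t * of_real t)"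
      by (simp add: Henstock_Kurzweil_Integration.integral_diff integrable_on_cmult_right)
    then show ?thesis by (simp add: algebra_simps)
  qed
  ultimately show ?thesis by (simp only: distrib_right add_diff_eq)
qed

section \<open>Weak derivatives and test functions\<close>

lemma L2_norm_le_bound:
  fixes f :: "real \<Rightarrow> complex"
  assumes "0 < l" "f \<in> L2 l" "0 \<le> B" "\<And>x. x \<in> {0<..<l} \<Longrightarrow> norm (f x) \<le> B"
  shows "L2_norm l f \<le> sqrt l * B"
proof -
  have "(LINT x|interval_measure l. (norm (f x))\<^sup>2) \<le> (LINT x|interval_measure l. B\<^sup>2)"
    using assms by (intro integral_mono L2_integrable_sq continuous_integrable_interval)
      (auto intro!: power_mono)
  also have "\<dots> = l * B\<^sup>2"
    using assms(1) by (subst LINT_interval_eq_integral)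
      (auto intro: continuous_integrable_interval)
  finally show ?thesis
    using assms by (simp add: L2_norm_def real_sqrt_mult real_le_lsqrt power_mult_distrib)
qed

lemma test_functionD:
  assumes "test_function l \<eta>"
  shows "(\<eta> has_vector_derivative vector_derivative \<eta> (at x)) (at x within S)"
    and "continuous_on S (\<lambda>x. vector_derivative \<eta> (at x))"
    and "continuous_on S \<eta>"
    and "\<eta> 0 = 0" "\<eta> l = 0"
proof -
  have C1: "\<eta> C1_differentiable_on UNIV" using assms by (simp add: test_function_def)
  then have c: "continuous_on UNIV (\<lambda>x. vector_derivative \<eta> (at x))"
    by (simp add: C1_differentiable_on_eq)
  have hv: "(\<eta> has_vector_derivative vector_derivative \<eta> (at x)) (at x within S)" for x
  proof -
    have "\<eta> differentiable at x" using C1 by (simp add: C1_differentiable_on_eq)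
    then show ?thesis
      using has_vector_derivative_at_within vector_derivative_works by blast
  qed
  then show "(\<eta> has_vector_derivative vector_derivative \<eta> (at x)) (at x within S)" .
  show "continuous_on S (\<lambda>x. vector_derivative \<eta> (at x))"
    using c continuous_on_subset by blast
  show "continuous_on S \<eta>"
    unfolding continuous_on_eq_continuous_within using has_vector_derivative_continuous [OF hv] by blast
  show "\<eta> 0 = 0" "\<eta> l = 0"
    using assms by (auto simp: test_function_def subset_iff)
qed

lemma test_function_L2:
  assumes "test_function l \<eta>"
  shows "\<eta> \<in> L2 l" "(\<lambda>x. vector_derivative \<eta> (at x)) \<in> L2 l"
  by (intro L2_continuous test_functionD(2,3) [OF assms])+

text \<open>
  The source of all concrete weak derivatives. The boundary terms vanish with the test function.
\<close>

lemma test_function_by_parts: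
  assumes "0 < l" and p: "p \<in> L2 l" and \<eta>: "test_function l \<eta>"
    and P: "\<And>x. x \<in> {0<..<l} \<Longrightarrow> P x = \<alpha> + integral {0..x} p"
  shows "(LINT x|interval_measure l. P x * vector_derivative \<eta> (at x))
    = - (LINT x|interval_measure l. p x * \<eta> x)"
proof -
  let ?P = "\<lambda>x. \<alpha> + integral {0..x} p"
  note pa = integrable_interval_absolutely [OF L2_integrable [OF p]]
  have cP: "continuous_on {0..l} ?P"
    by (intro continuous_intros primitive_continuous pa)
  have "(LINT x|interval_measure l. P x * vector_derivative \<eta> (at x))
      = (LINT x|interval_measure l. ?P x * vector_derivative \<eta> (at x))"
    by (rule Bochner_Integration.integral_cong) (auto simp: P)
  also have "\<dots> = integral {0..l} (\<lambda>x. ?P x * vector_derivative \<eta> (at x))"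
    by (intro LINT_interval_eq_integral continuous_integrable_interval continuous_on_mult cP test_functionD [OF \<eta>])
  also have "\<dots> = - integral {0..l} (\<lambda>x. p x * \<eta> x)"
    using primitive_by_parts [OF pa test_functionD(1,2) [OF \<eta>], of l \<alpha>] \<open>0 < l\<close> test_functionD(4,5) [OF \<eta>]
    by simp
  also have "integral {0..l} (\<lambda>x. p x * \<eta> x) = (LINT x|interval_measure l. p x * \<eta> x)"
    by (intro LINT_interval_eq_integral [symmetric] L2_mult_integrable p test_function_L2 [OF \<eta>])
  finally show ?thesis .
qed

text \<open>
  A trapezoidal cutoff, supported at distance at least \<open>1 / n\<close> from the end points and equal to
  \<open>1\<close> at distance at least \<open>2 / n\<close>.
\<close>

definition cutoff :: "real \<Rightarrow> real \<Rightarrow> real \<Rightarrow> real" where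
  "cutoff l n x = max 0 (min 1 (n * min x (l - x) - 1))"

lemma cutoff_bounds: "0 \<le> cutoff l n x" "cutoff l n x \<le> 1"
  by (simp_all add: cutoff_def)

lemma cutoff_continuous: "continuous_on S (cutoff l n)"
  unfolding cutoff_def by (intro continuous_intros)

lemma cutoff_eq_0: "0 < n \<Longrightarrow> x \<le> 1 / n \<or> l - x \<le> 1 / n \<Longrightarrow> cutoff l n x = 0"
proof -
  assume n: "0 < n" and "x \<le> 1 / n \<or> l - x \<le> 1 / n"
  then have "min x (l - x) \<le> 1 / n" by auto
  then have "n * min x (l - x) \<le> 1" using n by (simp add: field_simps)
  then show ?thesis by (simp add: cutoff_def)
qed

lemma cutoff_tendsto:
  assumes "x \<in> {0<..<l}"
  shows "(\<lambda>n. cutoff l (real n) x) \<longlonglongrightarrow> 1"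
proof (rule tendsto_eventually)
  have "min x (l - x) > 0" using assms by auto
  then have "\<forall>\<^sub>F n in sequentially. 2 / min x (l - x) \<le> real n"
    using filterlim_real_sequentially unfolding filterlim_at_top by blast
  then show "\<forall>\<^sub>F n in sequentially. cutoff l (real n) x = 1"
  proof eventually_elim
    case (elim n)
    then have "2 \<le> real n * min x (l - x)"
      using \<open>min x (l - x) > 0\<close> by (simp only: pos_divide_le_eq)
    then show ?case by (simp add: cutoff_def)
  qed
qed

lemma test_function_primitive:
  fixes \<psi> :: "real \<Rightarrow> complex"
  assumes l: "0 < l" and \<psi>: "continuous_on UNIV \<psi>" and \<delta>: "0 < \<delta>"
    and z: "\<And>x. x \<le> \<delta> \<or> l - x \<le> \<delta> \<Longrightarrow> \<psi> x = 0"
    and mean: "integral {0..l} \<psi> = 0"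
  defines "\<eta> \<equiv> \<lambda>x. integral {0..x} \<psi>"
  shows "test_function l \<eta>" "vector_derivative \<eta> (at x) = \<psi> x"
proof -
  have int: "\<psi> integrable_on {a..b}" for a b
    by (intro integrable_continuous_real continuous_on_subset [OF \<psi>]) auto
  have left: "\<eta> x = 0" if "x \<le> \<delta>" for x
  proof -
    have "integral {0..x} \<psi> = integral {0..x} (\<lambda>x. 0)"
      using that by (intro Henstock_Kurzweil_Integration.integral_cong z) auto
    then show ?thesis by (simp add: \<eta>_def)
  qed
  have right: "\<eta> x = 0" if "l - x \<le> \<delta>" for x
  proof (cases "x \<le> l")
    case True
    show ?thesis
    proof (cases "0 \<le> x")
      case x: True
      have "integral {x..l} \<psi> = integral {x..l} (\<lambda>x. 0)"
        using that by (intro Henstock_Kurzweil_Integration.integral_cong z) auto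
      moreover have "integral {0..x} \<psi> + integral {x..l} \<psi> = 0"
        using Henstock_Kurzweil_Integration.integral_combine [OF x True int] mean by simp
      ultimately show ?thesis by (simp add: \<eta>_def)
    qed (use left \<delta> in simp)
  next
    case False
    have "integral {l..x} \<psi> = integral {l..x} (\<lambda>x. 0)"
      using \<delta> by (intro Henstock_Kurzweil_Integration.integral_cong z) auto
    moreover have "integral {0..l} \<psi> + integral {l..x} \<psi> = integral {0..x} \<psi>"
      using Henstock_Kurzweil_Integration.integral_combine [OF _ _ int, of 0 l x] l False by simp
    ultimately show ?thesis using mean by (simp add: \<eta>_def)
  qed
  have der: "(\<eta> has_vector_derivative \<psi> x) (at x)" for x
  proof (cases "x < \<delta>")
    case True
    have "((\<lambda>x. 0) has_vector_derivative \<psi> x) (at x)"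
      using z [of x] True by simp
    then show ?thesis
      using left True by (rule_tac has_vector_derivative_transform_within_open [of _ _ _ "{..<\<delta>}"]) auto
  next
    case False
    then have x: "x \<in> {0<..<x+1}" using \<delta> by auto
    have "(\<eta> has_vector_derivative \<psi> x) (at x within {0..x+1})"
      unfolding \<eta>_def using x by (intro integral_has_vector_derivative continuous_on_subset [OF \<psi>]) auto
    then have "(\<eta> has_vector_derivative \<psi> x) (at x within {0<..<x+1})"
      by (rule has_vector_derivative_within_subset) auto
    then show ?thesis using x by (simp add: has_vector_derivative_within_open [OF x])
  qed
  then show vd: "vector_derivative \<eta> (at x) = \<psi> x" for x
    by (rule vector_derivative_at)
  have "\<eta> C1_differentiable_on UNIV"
    unfolding C1_differentiable_on_def using der \<psi> by blast
  moreover have "{\<delta>..l - \<delta>} \<subseteq> {0<..<l}" using \<delta> by auto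
  moreover have "\<forall>x. x \<notin> {\<delta>..l - \<delta>} \<longrightarrow> \<eta> x = 0"
    using left right by force
  ultimately show "test_function l \<eta>"
    unfolding test_function_def using compact_Icc by blast
qed

text \<open>
  The primitive of a function \<open>\<psi>\<close> of zero mean vanishes at both end points; it is approximated in
  \<open>H\<^sup>1\<close> by test functions. The approximations are built on the level of derivatives: multiply \<open>\<psi>\<close>
  by a cutoff and restore the zero mean by subtracting a small multiple of a fixed bump. The
  primitive of the result is a test function because its derivative has compact support and mean
  zero.
\<close>

lemma zero_mean_approximation:
  fixes \<psi> :: "real \<Rightarrow> complex"
  assumes l: "0 < l" and \<psi>: "continuous_on {0..l} \<psi>" and mean: "integral {0..l} \<psi> = 0" and "0 < \<epsilon>"
  obtains \<eta> where "test_function l \<eta>"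
    "L2_norm l (\<lambda>x. \<psi> x - vector_derivative \<eta> (at x)) < \<epsilon>"
    "L2_norm l (\<lambda>x. integral {0..x} \<psi> - \<eta> x) < \<epsilon>"
proof -
  let ?M = "interval_measure l"
  define \<psi>0 where "\<psi>0 = (\<lambda>x. \<psi> (max 0 (min l x)))"
  have \<psi>0: "continuous_on UNIV \<psi>0"
    unfolding \<psi>0_def using l
    by (intro continuous_on_compose2 [OF \<psi>] continuous_intros) auto
  have \<psi>0_eq: "\<psi>0 x = \<psi> x" if "x \<in> {0..l}" for x using that by (simp add: \<psi>0_def)
  have mean0: "(LINT x|?M. \<psi>0 x) = 0"
  proof -
    have "(LINT x|?M. \<psi>0 x) = integral {0..l} \<psi>0"
      by (intro LINT_interval_eq_integral continuous_integrable_interval continuous_on_subset [OF \<psi>0]) auto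
    also have "\<dots> = integral {0..l} \<psi>"
      by (intro Henstock_Kurzweil_Integration.integral_cong \<psi>0_eq)
    finally show ?thesis using mean by simp
  qed
  have "bounded (\<psi> ` {0..l})" by (intro compact_imp_bounded compact_continuous_image \<psi>) simp
  then obtain B where B: "\<And>x. x \<in> {0..l} \<Longrightarrow> norm (\<psi> x) \<le> B" unfolding bounded_iff by blast
  have B0: "norm (\<psi>0 x) \<le> B" for x unfolding \<psi>0_def using l by (intro B) auto
  have "0 \<le> B" using B0 norm_ge_zero order_trans by blast
  define b where "b = cutoff l (4 / l)"
  define J where "J = (LINT x|?M. b x)"
  have contb: "continuous_on S b" for S unfolding b_def by (rule cutoff_continuous)
  have b01: "0 \<le> b x" "b x \<le> 1" for x by (simp_all add: b_def cutoff_bounds)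
  have J: "J > 0"
  proof -
    have "b (l / 2) = 1" using l by (simp add: b_def cutoff_def min_def)
    moreover have "J = integral {0..l} b"
      unfolding J_def by (intro LINT_interval_eq_integral continuous_integrable_interval contb)
    moreover have "integral {0..l} b \<noteq> 0"
    proof
      assume "integral {0..l} b = 0"
      then have "(b has_integral 0) {0..l}"
        using integrable_integral [OF integrable_continuous_real [OF contb]] by metis
      then have "b (l / 2) = 0"
        using has_integral_0_cbox_imp_0 [of 0 l b "l / 2"] contb b01 l by auto
      with \<open>b (l / 2) = 1\<close> show False by simp
    qed
    moreover have "0 \<le> J" unfolding J_def using b01 by simp
    ultimately show ?thesis by simp
  qed
  define c where "c = (\<lambda>n. (LINT x|?M. cutoff l (real n) x *\<^sub>R \<psi>0 x) / of_real J)"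
  \<comment> \<open>cut off near the end points, then restore the zero mean with the bump \<open>b\<close>\<close>
  define \<psi>n where "\<psi>n = (\<lambda>n x. cutoff l (real n) x *\<^sub>R \<psi>0 x - c n * of_real (b x))"
  define \<eta> where "\<eta> = (\<lambda>n x. integral {0..x} (\<psi>n n))"
  have cont\<psi>n: "continuous_on S (\<psi>n n)" for S n
    unfolding \<psi>n_def by (intro continuous_intros cutoff_continuous contb continuous_on_subset [OF \<psi>0]) auto
  have c: "c \<longlonglongrightarrow> 0"
  proof -
    have "(\<lambda>n. LINT x|?M. cutoff l (real n) x *\<^sub>R \<psi>0 x) \<longlonglongrightarrow> (LINT x|?M. \<psi>0 x)"
    proof (rule integral_dominated_convergence)
      show "AE x in ?M. (\<lambda>n. cutoff l (real n) x *\<^sub>R \<psi>0 x) \<longlonglongrightarrow> \<psi>0 x"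
        by (intro AE_I2) (auto intro!: tendsto_eq_intros cutoff_tendsto)
      show "AE x in ?M. norm (cutoff l (real n) x *\<^sub>R \<psi>0 x) \<le> B" for n
        using B0 cutoff_bounds [of l "real n"] mult_mono [of _ 1 _ B] by (auto simp: abs_of_nonneg intro!: AE_I2)
      show "integrable ?M (\<lambda>x. B)" by (intro continuous_integrable_interval continuous_intros)
      show "\<psi>0 \<in> borel_measurable ?M"
        by (intro L2_measurable L2_continuous continuous_on_subset [OF \<psi>0]) auto
      show "(\<lambda>x. cutoff l (real n) x *\<^sub>R \<psi>0 x) \<in> borel_measurable ?M" for n
        by (intro L2_measurable L2_continuous continuous_intros cutoff_continuous continuous_on_subset [OF \<psi>0]) auto
    qed
    from tendsto_divide [OF this tendsto_const, of "of_real J"] show ?thesis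
      using J by (simp add: mean0 c_def)
  qed
  then obtain C where C: "\<And>n. norm (c n) \<le> C"
    using convergent_imp_Bseq [of c] by (auto simp: convergent_def Bseq_def)
  have "0 \<le> C" using C norm_ge_zero order_trans by blast
  let ?d = "\<lambda>n x. \<psi> x - \<psi>n n x"
  have d_le: "norm (?d n x) \<le> 2 * B + C" if "x \<in> {0<..<l}" for n x
  proof -
    have "norm (?d n x) \<le> norm (\<psi> x) + norm (\<psi>n n x)" by (rule norm_triangle_ineq4)
    also have "norm (\<psi>n n x) \<le> norm (cutoff l (real n) x *\<^sub>R \<psi>0 x) + norm (c n * of_real (b x))"
      unfolding \<psi>n_def by (rule norm_triangle_ineq4)
    also have "norm (cutoff l (real n) x *\<^sub>R \<psi>0 x) \<le> 1 * B"
      unfolding norm_scaleR using cutoff_bounds [of l "real n" x] B0 by (intro mult_mono) auto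
    also have "norm (c n * of_real (b x)) \<le> C * 1"
      unfolding norm_mult using b01 [of x] C \<open>0 \<le> C\<close> by (intro mult_mono) auto
    finally show ?thesis using B [of x] that by simp
  qed
  have d_lim: "(\<lambda>n. ?d n x) \<longlonglongrightarrow> 0" if "x \<in> {0<..<l}" for x
    unfolding \<psi>n_def using that
    by (auto intro!: tendsto_eq_intros cutoff_tendsto c simp: \<psi>0_eq)
  have d_cont: "continuous_on {0..l} (?d n)" for n by (intro continuous_intros \<psi> cont\<psi>n)
  have lim1: "(\<lambda>n. LINT x|?M. (norm (?d n x))\<^sup>2) \<longlonglongrightarrow> (LINT x|?M. 0)"
  proof (rule integral_dominated_convergence)
    show "AE x in ?M. (\<lambda>n. (norm (?d n x))\<^sup>2) \<longlonglongrightarrow> 0"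
    proof (rule AE_I2)
      fix x assume "x \<in> space ?M"
      then have "(\<lambda>n. norm (?d n x)) \<longlonglongrightarrow> 0" by (intro tendsto_norm_zero d_lim) simp
      from tendsto_power [OF this, of 2] show "(\<lambda>n. (norm (?d n x))\<^sup>2) \<longlonglongrightarrow> 0" by simp
    qed
    show "AE x in ?M. norm ((norm (?d n x))\<^sup>2) \<le> (2 * B + C)\<^sup>2" for n
      using d_le by (intro AE_I2) (auto intro!: power_mono)
    show "integrable ?M (\<lambda>x. (2 * B + C)\<^sup>2)" by (intro continuous_integrable_interval continuous_intros)
    show "(\<lambda>x. (norm (?d n x))\<^sup>2) \<in> borel_measurable ?M" for n
      by (intro borel_measurable_integrable L2_integrable_sq L2_continuous d_cont)
  qed simp
  have lim2: "(\<lambda>n. LINT x|?M. norm (?d n x)) \<longlonglongrightarrow> (LINT x|?M. 0)"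
  proof (rule integral_dominated_convergence)
    show "AE x in ?M. (\<lambda>n. norm (?d n x)) \<longlonglongrightarrow> 0"
      by (intro AE_I2 tendsto_norm_zero d_lim) simp
    show "AE x in ?M. norm (norm (?d n x)) \<le> 2 * B + C" for n
      using d_le by (intro AE_I2) auto
    show "integrable ?M (\<lambda>x. 2 * B + C)" by (intro continuous_integrable_interval continuous_intros)
    show "(\<lambda>x. norm (?d n x)) \<in> borel_measurable ?M" for n
      by (intro borel_measurable_integrable continuous_integrable_interval continuous_on_norm d_cont)
  qed simp
  have "\<forall>\<^sub>F n in sequentially. (LINT x|?M. (norm (?d n x))\<^sup>2) < \<epsilon>\<^sup>2"
    using order_tendstoD(2) [OF lim1, of "\<epsilon>\<^sup>2"] \<open>0 < \<epsilon>\<close> by simp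
  moreover have "\<forall>\<^sub>F n in sequentially. (LINT x|?M. norm (?d n x)) < \<epsilon> / sqrt l"
    using order_tendstoD(2) [OF lim2, of "\<epsilon> / sqrt l"] \<open>0 < \<epsilon>\<close> l by simp
  ultimately have "\<forall>\<^sub>F n in sequentially. (LINT x|?M. (norm (?d n x))\<^sup>2) < \<epsilon>\<^sup>2
      \<and> (LINT x|?M. norm (?d n x)) < \<epsilon> / sqrt l \<and> n > 0"
    using eventually_gt_at_top [of 0] by eventually_elim auto
  then obtain n where n: "(LINT x|?M. (norm (?d n x))\<^sup>2) < \<epsilon>\<^sup>2"
      "(LINT x|?M. norm (?d n x)) < \<epsilon> / sqrt l" "n > 0"
    using eventually_happens'[OF sequentially_bot] by blast
  have mean_n: "integral {0..l} (\<psi>n n) = 0"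
  proof -
    have "integral {0..l} (\<psi>n n) = (LINT x|?M. \<psi>n n x)"
      by (intro LINT_interval_eq_integral [symmetric] continuous_integrable_interval cont\<psi>n)
    also have "\<dots> = (LINT x|?M. cutoff l (real n) x *\<^sub>R \<psi>0 x) - (LINT x|?M. c n * of_real (b x))"
      unfolding \<psi>n_def
      by (intro Bochner_Integration.integral_diff continuous_integrable_interval continuous_intros
          cutoff_continuous contb continuous_on_subset [OF \<psi>0]) auto
    also have "(LINT x|?M. c n * of_real (b x)) = c n * of_real J"
      by (simp add: J_def)
    finally show ?thesis using J by (simp add: c_def)
  qed
  define \<delta> where "\<delta> = min (1 / n) (l / 4)"
  have \<delta>: "0 < \<delta>" using n l by (simp add: \<delta>_def)
  have "\<psi>n n x = 0" if "x \<le> \<delta> \<or> l - x \<le> \<delta>" for x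
    using that cutoff_eq_0 [of "real n" x l] cutoff_eq_0 [of "4 / l" x l] n l
    by (auto simp: \<psi>n_def b_def \<delta>_def)
  note T = test_function_primitive [OF l cont\<psi>n \<delta> this mean_n]
  have a: "L2_norm l (?d n) < \<epsilon>"
    using n(1) \<open>0 < \<epsilon>\<close> by (simp add: L2_norm_def real_less_lsqrt)
  have "norm (integral {0..x} \<psi> - \<eta> n x) \<le> (LINT x|?M. norm (?d n x))" if "x \<in> {0<..<l}" for x
  proof -
    have sub: "{0..x} \<subseteq> {0..l}" using that by auto
    have "integral {0..x} \<psi> - \<eta> n x = integral {0..x} (?d n)"
      unfolding \<eta>_def
      by (intro Henstock_Kurzweil_Integration.integral_diff [symmetric] integrable_continuous_real
          cont\<psi>n continuous_on_subset [OF \<psi> sub])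
    also have "norm \<dots> \<le> integral {0..x} (\<lambda>x. norm (?d n x))"
      by (intro continuous_on_imp_absolutely_integrable_on continuous_on_subset [OF d_cont sub])
    also have "\<dots> \<le> integral {0..l} (\<lambda>x. norm (?d n x))"
      by (intro integral_subset_le sub integrable_continuous_real continuous_on_norm
          continuous_on_subset [OF d_cont sub] d_cont) auto
    also have "\<dots> = (LINT x|?M. norm (?d n x))"
      by (intro LINT_interval_eq_integral [symmetric] continuous_integrable_interval continuous_on_norm d_cont)
    finally show ?thesis .
  qed
  then have "L2_norm l (\<lambda>x. integral {0..x} \<psi> - \<eta> n x) \<le> sqrt l * (LINT x|?M. norm (?d n x))"
    by (intro L2_norm_le_bound l L2_continuous continuous_intros primitive_continuous
        absolutely_integrable_continuous_real \<psi>)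
      (auto simp: \<eta>_def intro!: primitive_continuous absolutely_integrable_continuous_real cont\<psi>n)
  also have "\<dots> < sqrt l * (\<epsilon> / sqrt l)" using n(2) l by (intro mult_strict_left_mono) auto
  finally have b: "L2_norm l (\<lambda>x. integral {0..x} \<psi> - \<eta> n x) < \<epsilon>" using l by simp
  show thesis
  proof
    show "test_function l (\<eta> n)" unfolding \<eta>_def by (rule T)
    show "L2_norm l (\<lambda>x. \<psi> x - vector_derivative (\<eta> n) (at x)) < \<epsilon>"
      using a T(2) by (simp add: \<eta>_def)
  qed (rule b)
qed

text \<open>
  The sets on which the integral vanishes form a Dynkin system that contains the half-lines, hence
  all Borel sets.
\<close>

lemma zero_primitive_imp_AE_zero:
  fixes p :: "real \<Rightarrow> complex"
  assumes p: "integrable (interval_measure l) p" and z: "\<And>x. x \<in> {0..l} \<Longrightarrow> integral {0..x} p = 0"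
  shows "AE x in interval_measure l. p x = 0"
proof -
  define f where "f = (\<lambda>x. indicator {0<..<l} x *\<^sub>R p x)"
  have f: "integrable lebesgue f"
    using p by (simp add: integrable_restrict_space f_def)
  have pa: "p absolutely_integrable_on {0..l}"
    by (rule integrable_interval_absolutely [OF p])
  define F where "F = (\<lambda>A. LINT x|lebesgue. indicator A x *\<^sub>R f x)"
  have ind: "integrable lebesgue (\<lambda>x. indicator A x *\<^sub>R f x)" if "A \<in> sets lebesgue" for A
    using integrable_mult_indicator [OF that f] .
  have half: "F {..a} = 0" for a
  proof -
    have "F {..a} = (LINT x|lebesgue. indicator ({0<..<l} \<inter> {..a}) x *\<^sub>R p x)"
      unfolding F_def f_def by (intro Bochner_Integration.integral_cong) (auto simp: indicator_def)
    also have "\<dots> = (LINT x|lebesgue_on ({0<..<l} \<inter> {..a}). p x)"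
      by (simp add: integral_restrict_space)
    also have "\<dots> = integral ({0<..<l} \<inter> {..a}) p"
    proof (rule lebesgue_integral_eq_integral)
      have "set_integrable lebesgue ({0<..<l} \<inter> {..a}) p"
        by (rule set_integrable_subset [OF pa]) auto
      then show "integrable (lebesgue_on ({0<..<l} \<inter> {..a})) p"
        by (simp add: integrable_restrict_space set_integrable_def)
    qed auto
    also have "\<dots> = integral {0..min a l} p"
      by (rule integral_spike_set) (rule negligible_subset [of "{0, l}"], auto)+
    also have "\<dots> = 0"
    proof (cases "min a l < 0")
      case False
      then have "min a l \<in> {0..l}" by auto
      then show ?thesis by (rule z)
    qed auto
    finally show ?thesis .
  qed
  have total: "F UNIV = 0"
  proof -
    have "F UNIV = F {..l}"
      unfolding F_def f_def by (intro Bochner_Integration.integral_cong) (auto simp: indicator_def)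
    then show ?thesis using half by simp
  qed
  have borel: "F A = 0" if "A \<in> sets borel" for A
  proof -
    have A: "A \<in> sigma_sets UNIV (range (\<lambda>a::real. {..a}))"
      using that by (subst (asm) borel_eq_atMost) simp
    have G: "Int_stable (range (\<lambda>a::real. {..a}))"
      by (auto simp: Int_stable_def)
    show ?thesis
    proof (rule sigma_sets_induct_disjoint [OF G _ A], goal_cases Pow basic empty compl union)
      case (compl A)
      then have A: "A \<in> sets lebesgue"
      proof -
        have "A \<in> sets borel" using compl(1)
          by (subst borel_eq_atMost) simp
        then show ?thesis by simp
      qed
      have "F (UNIV - A) = (LINT x|lebesgue. indicator UNIV x *\<^sub>R f x - indicator A x *\<^sub>R f x)"
        unfolding F_def by (intro Bochner_Integration.integral_cong) (auto simp: indicator_def)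
      also have "\<dots> = F UNIV - F A"
        unfolding F_def by (intro Bochner_Integration.integral_diff ind A) auto
      finally show ?case using compl total by simp
    next
      case (union A)
      have A: "A i \<in> sets lebesgue" for i
      proof -
        have "A i \<in> sets borel" using union(2)
          by (subst borel_eq_atMost) (simp add: image_subset_iff)
        then show ?thesis by simp
      qed
      have "set_lebesgue_integral lebesgue (\<Union>i. A i) f = (\<Sum>i. set_lebesgue_integral lebesgue (A i) f)"
        using union(1) A by (intro lebesgue_integral_countable_add)
          (auto simp: disjoint_family_on_def set_integrable_def intro!: ind)
      then show ?case using union(3) by (simp add: F_def set_lebesgue_integral_def)
    qed (use half in \<open>auto simp: F_def\<close>)
  qed
  show ?thesis
  proof (rule sigma_finite_measure.density_zero [OF _ p])
    show "sigma_finite_measure (interval_measure l)"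
      by (rule finite_measure.axioms(1) [OF finite_measure_interval])
  next
    fix A :: "real set" assume "A \<in> sets (interval_measure l)"
    then have A: "A \<in> sets lebesgue" by (auto simp: sets_restrict_space)
    from A obtain S N N' where SN: "A = S \<union> N" "N \<subseteq> N'" "N' \<in> null_sets lborel" "S \<in> sets lborel"
      unfolding sets_completion by (rule completionE)
    have "AE x in lebesgue. x \<notin> N'"
      using SN(3) by (intro AE_not_in null_sets_completionI)
    then have "F A = F S"
      unfolding F_def
    proof (intro integral_cong_AE borel_measurable_integrable ind A)
      show "S \<in> sets lebesgue" using SN(4) by simp
      assume "AE x in lebesgue. x \<notin> N'"
      then show "AE x in lebesgue. indicator A x *\<^sub>R f x = indicator S x *\<^sub>R f x"
        by eventually_elim (use SN in \<open>auto simp: indicator_def\<close>)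
    qed
    moreover have "set_lebesgue_integral (interval_measure l) A p = F A"
      unfolding set_lebesgue_integral_def F_def f_def
      by (subst integral_restrict_space) (auto intro!: Bochner_Integration.integral_cong simp: indicator_def)
    ultimately show "set_lebesgue_integral (interval_measure l) A p = 0"
      using borel [of S] SN by simp
  qed
qed

text \<open>
  Integrating by parts, the primitive \<open>F\<close> of \<open>f\<close> is orthogonal to the derivatives of all test
  functions, hence, by approximation, to every continuous function of zero mean; one of these is
  the conjugate of \<open>F\<close> minus its mean. So \<open>F\<close> is constant.
\<close>

lemma test_functions_separate:
  fixes f :: "real \<Rightarrow> complex"
  assumes l: "0 < l" and f: "f \<in> L2 l"
    and z: "\<And>\<eta>. test_function l \<eta> \<Longrightarrow> (LINT x|interval_measure l. f x * \<eta> x) = 0"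
  shows "AE x in interval_measure l. f x = 0"
proof -
  note fa = integrable_interval_absolutely [OF L2_integrable [OF f]]
  define F where "F = (\<lambda>x. integral {0..x} f)"
  define m where "m = integral {0..l} F / of_real l"
  define P where "P = (\<lambda>x. F x - m)"
  have cF: "continuous_on {0..l} F" unfolding F_def by (rule primitive_continuous [OF fa])
  then have cP: "continuous_on {0..l} P" unfolding P_def by (intro continuous_intros)
  have meanP: "integral {0..l} P = 0"
    unfolding P_def using cF l by (subst Henstock_Kurzweil_Integration.integral_diff)
      (auto simp: m_def integrable_continuous_real scaleR_conv_of_real)
  define \<psi> where "\<psi> = (\<lambda>x. cnj (P x))"
  have c\<psi>: "continuous_on {0..l} \<psi>" unfolding \<psi>_def by (intro continuous_intros cP)
  have PL: "P \<in> L2 l" "\<psi> \<in> L2 l" by (intro L2_continuous cP c\<psi>)+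
  have mean\<psi>: "integral {0..l} \<psi> = 0"
    using meanP unfolding \<psi>_def by (simp add: integral_cnj [symmetric])
  have small: "cmod (ip l P P) < L2_norm l \<psi> * \<epsilon> + \<epsilon>" if e: "0 < \<epsilon>" for \<epsilon>
  proof -
    obtain \<eta> where \<eta>: "test_function l \<eta>"
      "L2_norm l (\<lambda>x. \<psi> x - vector_derivative \<eta> (at x)) < \<epsilon>"
      using zero_mean_approximation [OF l c\<psi> mean\<psi> e] by metis
    have "(LINT x|interval_measure l. P x * vector_derivative \<eta> (at x)) = 0"
      using test_function_by_parts [OF l f \<eta>(1), of P "- m"] z [OF \<eta>(1)]
      by (simp add: P_def F_def)
    then have "ip l (\<lambda>x. vector_derivative \<eta> (at x)) \<psi> = 0"
      by (simp add: ip_def \<psi>_def mult.commute)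
    moreover have "ip l \<psi> \<psi> = ip l P P"
      by (simp add: ip_def \<psi>_def mult.commute)
    ultimately have "ip l P P = ip l (\<lambda>x. \<psi> x - vector_derivative \<eta> (at x)) \<psi>"
      using PL test_function_L2 [OF \<eta>(1)] by (simp add: ip_diff_left)
    also have "cmod \<dots> \<le> L2_norm l (\<lambda>x. \<psi> x - vector_derivative \<eta> (at x)) * L2_norm l \<psi>"
      by (intro ip_Cauchy_Schwarz L2_diff PL test_function_L2 \<eta>)
    also have "\<dots> \<le> \<epsilon> * L2_norm l \<psi>" using \<eta>(2) by (intro mult_right_mono) auto
    finally show ?thesis using e by (simp add: mult.commute)
  qed
  have "cmod (ip l P P) \<le> 0"
  proof (rule field_le_epsilon)
    fix e :: real assume "0 < e"
    have "cmod (ip l P P) < L2_norm l \<psi> * (e / (L2_norm l \<psi> + 1)) + e / (L2_norm l \<psi> + 1)"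
      using \<open>0 < e\<close> by (intro small) (simp add: add_nonneg_pos)
    also have "\<dots> = e"
    proof -
      have K: "L2_norm l \<psi> + 1 > 0" by (simp add: add_nonneg_pos)
      have "L2_norm l \<psi> * (e / (L2_norm l \<psi> + 1)) + e / (L2_norm l \<psi> + 1)
          = (L2_norm l \<psi> + 1) * (e / (L2_norm l \<psi> + 1))" by (simp only: distrib_right mult_1_left)
      then show ?thesis using K by simp
    qed
    finally show "cmod (ip l P P) \<le> 0 + e" by simp
  qed
  then have "AE x in interval_measure l. P x = 0" using ip_self_eq_0 [OF PL(1)] by simp
  then have P0: "P x = 0" if "x \<in> {0..l}" for x
    using continuous_AE_zero_imp_zero [OF l cP _ that] by simp
  have "m = 0" using P0 [of 0] l by (simp add: P_def F_def)
  then show ?thesis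
    using P0 by (intro zero_primitive_imp_AE_zero L2_integrable f) (simp add: P_def F_def)
qed

lemma weak_deriv_L2: "weak_deriv l u w \<Longrightarrow> u \<in> L2 l" "weak_deriv l u w \<Longrightarrow> w \<in> L2 l"
  by (simp_all add: weak_deriv_def)

lemma weak_deriv_unique:
  assumes l: "0 < l" and "weak_deriv l u w" "weak_deriv l u' w'" "AE x in interval_measure l. u x = u' x"
  shows "AE x in interval_measure l. w x = w' x"
proof -
  have L: "u \<in> L2 l" "u' \<in> L2 l" "w \<in> L2 l" "w' \<in> L2 l" using assms weak_deriv_L2 by auto
  have "AE x in interval_measure l. w x - w' x = 0"
  proof (rule test_functions_separate [OF l L2_diff])
    fix \<eta> assume \<eta>: "test_function l \<eta>"
    have "(LINT x|interval_measure l. u x * vector_derivative \<eta> (at x))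
        = (LINT x|interval_measure l. u' x * vector_derivative \<eta> (at x))"
      using assms(4) by (intro integral_cong_AE borel_measurable_integrable L2_mult_integrable L
          test_function_L2 [OF \<eta>]) (auto elim: eventually_mono)
    then have "(LINT x|interval_measure l. w x * \<eta> x) = (LINT x|interval_measure l. w' x * \<eta> x)"
      using assms(2,3) \<eta> by (simp add: weak_deriv_def)
    then show "(LINT x|interval_measure l. (w x - w' x) * \<eta> x) = 0"
      using L test_function_L2 [OF \<eta>] by (simp add: left_diff_distrib L2_mult_integrable)
  qed (use L in auto)
  then show ?thesis by eventually_elim simp
qed

lemma weak_deriv_lincomb:
  assumes "weak_deriv l u w" "weak_deriv l u' w'"
  shows "weak_deriv l (\<lambda>x. c * u x + d * u' x) (\<lambda>x. c * w x + d * w' x)"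
  unfolding weak_deriv_def
proof (intro conjI allI impI)
  have L: "u \<in> L2 l" "u' \<in> L2 l" "w \<in> L2 l" "w' \<in> L2 l" using assms weak_deriv_L2 by auto
  then show "(\<lambda>x. c * u x + d * u' x) \<in> L2 l" "(\<lambda>x. c * w x + d * w' x) \<in> L2 l"
    by (auto intro!: L2_add L2_cmult)
  fix \<eta> assume \<eta>: "test_function l \<eta>"
  have lin: "(LINT x|interval_measure l. (c * f x + d * g x) * \<theta> x)
      = c * (LINT x|interval_measure l. f x * \<theta> x) + d * (LINT x|interval_measure l. g x * \<theta> x)"
    if "f \<in> L2 l" "g \<in> L2 l" "\<theta> \<in> L2 l" for f g \<theta>
    using L2_mult_integrable [OF that(1,3)] L2_mult_integrable [OF that(2,3)]
    by (simp add: distrib_right mult.assoc)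
  show "(LINT x|interval_measure l. (c * u x + d * u' x) * vector_derivative \<eta> (at x))
      = - (LINT x|interval_measure l. (c * w x + d * w' x) * \<eta> x)"
    using assms \<eta> unfolding weak_deriv_def
    by (simp only: lin L test_function_L2 [OF \<eta>] simp_thms) simp
qed

lemma weak_deriv_AE_cong:
  assumes "weak_deriv l u w" "AE x in interval_measure l. u' x = u x"
  shows "weak_deriv l u' w"
  unfolding weak_deriv_def
proof (intro conjI allI impI)
  have L: "u \<in> L2 l" using assms weak_deriv_L2 by auto
  then show L': "u' \<in> L2 l" using assms(2) by (rule L2_AE_cong)
  show "w \<in> L2 l" using assms weak_deriv_L2 by auto
  fix \<eta> assume \<eta>: "test_function l \<eta>"
  have "(LINT x|interval_measure l. u' x * vector_derivative \<eta> (at x))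
        = (LINT x|interval_measure l. u x * vector_derivative \<eta> (at x))"
    using assms(2) by (intro integral_cong_AE borel_measurable_integrable L2_mult_integrable L L'
          test_function_L2 [OF \<eta>]) (auto elim: eventually_mono)
  then show "(LINT x|interval_measure l. u' x * vector_derivative \<eta> (at x))
      = - (LINT x|interval_measure l. w x * \<eta> x)"
    using assms(1) \<eta> by (simp add: weak_deriv_def)
qed

text \<open>
  Membership in \<open>H\<^sup>1\<^sub>0\<close> together with the weak derivative that the approximating sequence converges
  to; by uniqueness of weak derivatives it is the weak derivative.
\<close>

definition H1_0_deriv :: "real \<Rightarrow> (real \<Rightarrow> complex) \<Rightarrow> (real \<Rightarrow> complex) \<Rightarrow> bool" where
  "H1_0_deriv l u w \<longleftrightarrow> weak_deriv l u w \<and>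
     (\<forall>\<epsilon>>0. \<exists>\<eta>. test_function l \<eta> \<and> L2_norm l (\<lambda>x. u x - \<eta> x) < \<epsilon> \<and>
        L2_norm l (\<lambda>x. w x - vector_derivative \<eta> (at x)) < \<epsilon>)"

lemma H1_0_deriv_AE_cong:
  assumes "H1_0_deriv l u w" "AE x in interval_measure l. u' x = u x" "weak_deriv l u' w'"
     "AE x in interval_measure l. w' x = w x"
  shows "H1_0_deriv l u' w'"
  unfolding H1_0_deriv_def
proof (intro conjI allI impI)
  fix \<epsilon> :: real assume "0 < \<epsilon>"
  then obtain \<eta> where \<eta>: "test_function l \<eta>" "L2_norm l (\<lambda>x. u x - \<eta> x) < \<epsilon>"
        "L2_norm l (\<lambda>x. w x - vector_derivative \<eta> (at x)) < \<epsilon>"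
    using assms(1) unfolding H1_0_deriv_def by blast
  have L: "u \<in> L2 l" "w \<in> L2 l" using assms(1) weak_deriv_L2 unfolding H1_0_deriv_def by auto
  have "L2_norm l (\<lambda>x. u' x - \<eta> x) = L2_norm l (\<lambda>x. u x - \<eta> x)"
    using assms(2) by (intro L2_norm_AE_cong L2_diff L test_function_L2 \<eta>) (auto elim: eventually_mono)
  moreover have "L2_norm l (\<lambda>x. w' x - vector_derivative \<eta> (at x)) = L2_norm l (\<lambda>x. w x - vector_derivative \<eta> (at x))"
    using assms(4) by (intro L2_norm_AE_cong L2_diff L test_function_L2 \<eta>) (auto elim: eventually_mono)
  ultimately show "\<exists>\<eta>. test_function l \<eta> \<and> L2_norm l (\<lambda>x. u' x - \<eta> x) < \<epsilon> \<and>
        L2_norm l (\<lambda>x. w' x - vector_derivative \<eta> (at x)) < \<epsilon>"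
    using \<eta> by auto
qed (rule assms)

lemma test_function_lincomb:
  assumes "test_function l \<eta>" "test_function l \<eta>'"
  shows "test_function l (\<lambda>x. c * \<eta> x + d * \<eta>' x)"
    "vector_derivative (\<lambda>x. c * \<eta> x + d * \<eta>' x) (at x)
      = c * vector_derivative \<eta> (at x) + d * vector_derivative \<eta>' (at x)"
proof -
  have D: "((\<lambda>x. c * \<eta> x + d * \<eta>' x) has_vector_derivative
      (c * vector_derivative \<eta> (at x) + d * vector_derivative \<eta>' (at x))) (at x)" for x
    by (intro has_vector_derivative_add has_vector_derivative_mult_right
        test_functionD(1) [OF assms(1)] test_functionD(1) [OF assms(2)])
  then show "vector_derivative (\<lambda>x. c * \<eta> x + d * \<eta>' x) (at x)
      = c * vector_derivative \<eta> (at x) + d * vector_derivative \<eta>' (at x)"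
    by (rule vector_derivative_at)
  have "(\<lambda>x. c * \<eta> x + d * \<eta>' x) C1_differentiable_on UNIV"
    unfolding C1_differentiable_on_def using D
    by (intro exI [of _ "\<lambda>x. c * vector_derivative \<eta> (at x) + d * vector_derivative \<eta>' (at x)"])
      (auto intro!: continuous_intros test_functionD(2) [OF assms(1)] test_functionD(2) [OF assms(2)])
  moreover obtain K K' where "compact K" "K \<subseteq> {0<..<l}" "\<forall>x. x \<notin> K \<longrightarrow> \<eta> x = 0"
    "compact K'" "K' \<subseteq> {0<..<l}" "\<forall>x. x \<notin> K' \<longrightarrow> \<eta>' x = 0"
    using assms unfolding test_function_def by blast
  then have "compact (K \<union> K') \<and> K \<union> K' \<subseteq> {0<..<l} \<and> (\<forall>x. x \<notin> K \<union> K' \<longrightarrow> c * \<eta> x + d * \<eta>' x = 0)"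
    by auto
  ultimately show "test_function l (\<lambda>x. c * \<eta> x + d * \<eta>' x)"
    unfolding test_function_def by blast
qed

lemma test_function_cnj:
  assumes "test_function l \<eta>"
  shows "test_function l (\<lambda>x. cnj (\<eta> x))"
    "vector_derivative (\<lambda>x. cnj (\<eta> x)) (at x) = cnj (vector_derivative \<eta> (at x))"
proof -
  have D: "((\<lambda>x. cnj (\<eta> x)) has_vector_derivative cnj (vector_derivative \<eta> (at x))) (at x)" for x
    by (intro has_vector_derivative_cnj test_functionD(1) [OF assms])
  then show "vector_derivative (\<lambda>x. cnj (\<eta> x)) (at x) = cnj (vector_derivative \<eta> (at x))"
    by (rule vector_derivative_at)
  have "(\<lambda>x. cnj (\<eta> x)) C1_differentiable_on UNIV"
    unfolding C1_differentiable_on_def using D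
    by (intro exI [of _ "\<lambda>x. cnj (vector_derivative \<eta> (at x))"])
      (auto intro!: continuous_intros test_functionD(2) [OF assms])
  then show "test_function l (\<lambda>x. cnj (\<eta> x))"
    using assms unfolding test_function_def by auto
qed

lemma L2_norm_triangle:
  fixes u v :: "real \<Rightarrow> complex"
  assumes "u \<in> L2 l" "v \<in> L2 l"
  shows "L2_norm l (\<lambda>x. u x + v x) \<le> L2_norm l u + L2_norm l v"
proof (rule power2_le_imp_le)
  have "complex_of_real ((L2_norm l (\<lambda>x. u x + v x))\<^sup>2) = ip l u u + ip l v v + (ip l u v + cnj (ip l u v))"
    using assms by (simp only: ip_self [symmetric] ip_add_left ip_add_right L2_add ip_cnj add_ac)
  also have "\<dots> = complex_of_real ((L2_norm l u)\<^sup>2 + (L2_norm l v)\<^sup>2 + 2 * Re (ip l u v))"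
    by (simp add: ip_self complex_add_cnj)
  finally have "(L2_norm l (\<lambda>x. u x + v x))\<^sup>2 = (L2_norm l u)\<^sup>2 + (L2_norm l v)\<^sup>2 + 2 * Re (ip l u v)"
    by (simp only: of_real_eq_iff)
  also have "Re (ip l u v) \<le> L2_norm l u * L2_norm l v"
    using complex_Re_le_cmod ip_Cauchy_Schwarz [OF assms] order_trans by blast
  finally show "(L2_norm l (\<lambda>x. u x + v x))\<^sup>2 \<le> (L2_norm l u + L2_norm l v)\<^sup>2"
    by (simp add: power2_sum)
qed simp

lemma L2_norm_cmult: "L2_norm l (\<lambda>x. c * u x :: complex) = cmod c * L2_norm l u"
  by (simp add: L2_norm_def norm_mult power_mult_distrib real_sqrt_mult)

lemma H1_0_deriv_lincomb:
  assumes "H1_0_deriv l u w" "H1_0_deriv l u' w'"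
  shows "H1_0_deriv l (\<lambda>x. c * u x + d * u' x) (\<lambda>x. c * w x + d * w' x)"
  unfolding H1_0_deriv_def
proof (intro conjI allI impI)
  show "weak_deriv l (\<lambda>x. c * u x + d * u' x) (\<lambda>x. c * w x + d * w' x)"
    using assms by (intro weak_deriv_lincomb) (auto simp: H1_0_deriv_def)
  have L: "u \<in> L2 l" "u' \<in> L2 l" "w \<in> L2 l" "w' \<in> L2 l"
    using assms weak_deriv_L2 unfolding H1_0_deriv_def by auto
  fix \<epsilon> :: real assume "0 < \<epsilon>"
  define \<delta> where "\<delta> = \<epsilon> / (cmod c + cmod d + 1)"
  have K: "cmod c + cmod d + 1 > 0" by (simp add: add_nonneg_pos)
  have "0 < \<delta>" using \<open>0 < \<epsilon>\<close> K by (simp add: \<delta>_def)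
  then obtain \<eta> \<eta>' where \<eta>: "test_function l \<eta>" "L2_norm l (\<lambda>x. u x - \<eta> x) < \<delta>"
        "L2_norm l (\<lambda>x. w x - vector_derivative \<eta> (at x)) < \<delta>"
    and \<eta>': "test_function l \<eta>'" "L2_norm l (\<lambda>x. u' x - \<eta>' x) < \<delta>"
        "L2_norm l (\<lambda>x. w' x - vector_derivative \<eta>' (at x)) < \<delta>"
    using assms unfolding H1_0_deriv_def by meson
  have comb: "L2_norm l (\<lambda>x. (c * f x + d * f' x) - (c * g x + d * g' x)) < \<epsilon>"
    if "L2_norm l (\<lambda>x. f x - g x) < \<delta>" "L2_norm l (\<lambda>x. f' x - g' x) < \<delta>"
      "f \<in> L2 l" "g \<in> L2 l" "f' \<in> L2 l" "g' \<in> L2 l" for f f' g g'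
  proof -
    have "L2_norm l (\<lambda>x. (c * f x + d * f' x) - (c * g x + d * g' x))
        = L2_norm l (\<lambda>x. c * (f x - g x) + d * (f' x - g' x))"
      by (simp add: algebra_simps)
    also have "\<dots> \<le> L2_norm l (\<lambda>x. c * (f x - g x)) + L2_norm l (\<lambda>x. d * (f' x - g' x))"
      by (intro L2_norm_triangle L2_cmult L2_diff that)
    also have "\<dots> \<le> cmod c * \<delta> + cmod d * \<delta>"
      unfolding L2_norm_cmult using that by (intro add_mono mult_left_mono) auto
    also have "\<dots> < (cmod c + cmod d + 1) * \<delta>" using \<open>0 < \<delta>\<close> by (simp add: algebra_simps)
    also have "\<dots> = \<epsilon>" using K by (simp add: \<delta>_def)
    finally show ?thesis .
  qed
  show "\<exists>\<eta>. test_function l \<eta> \<and> L2_norm l (\<lambda>x. c * u x + d * u' x - \<eta> x) < \<epsilon> \<and>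
        L2_norm l (\<lambda>x. c * w x + d * w' x - vector_derivative \<eta> (at x)) < \<epsilon>"
    using test_function_lincomb [OF \<eta>(1) \<eta>'(1), of c d]
      comb [OF \<eta>(2) \<eta>'(2)] comb [OF \<eta>(3) \<eta>'(3)] L test_function_L2 [OF \<eta>(1)] test_function_L2 [OF \<eta>'(1)]
    by (intro exI [of _ "\<lambda>x. c * \<eta> x + d * \<eta>' x"]) auto
qed

text \<open>
  The definition of the weak derivative extends from test functions to their \<open>H\<^sup>1\<close>-limits.
\<close>

lemma weak_deriv_H1_0_by_parts:
  assumes u: "weak_deriv l u w" and v: "H1_0_deriv l v z"
  shows "ip l w v = - ip l u z"
proof -
  have L: "u \<in> L2 l" "w \<in> L2 l" "v \<in> L2 l" "z \<in> L2 l"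
    using assms weak_deriv_L2 unfolding H1_0_deriv_def by auto
  have "cmod (ip l w v + ip l u z) \<le> 0"
  proof (rule field_le_epsilon)
    fix e :: real assume "0 < e"
    define K where "K = L2_norm l w + L2_norm l u + 1"
    have "0 < K" by (simp add: K_def add_nonneg_pos)
    then obtain \<eta> where \<eta>: "test_function l \<eta>" "L2_norm l (\<lambda>x. v x - \<eta> x) < e / K"
        "L2_norm l (\<lambda>x. z x - vector_derivative \<eta> (at x)) < e / K"
      using v \<open>0 < e\<close> unfolding H1_0_deriv_def by (meson divide_pos_pos)
    have "ip l u (\<lambda>x. vector_derivative \<eta> (at x)) = - ip l w \<eta>"
      using u test_function_cnj(1) [OF \<eta>(1)]
      unfolding weak_deriv_def ip_def test_function_cnj(2) [OF \<eta>(1), symmetric] by blast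
    then have "ip l w v + ip l u z = ip l w (\<lambda>x. v x - \<eta> x) + ip l u (\<lambda>x. z x - vector_derivative \<eta> (at x))"
      using L test_function_L2 [OF \<eta>(1)] by (simp add: ip_diff_right)
    also have "cmod \<dots> \<le> cmod (ip l w (\<lambda>x. v x - \<eta> x)) + cmod (ip l u (\<lambda>x. z x - vector_derivative \<eta> (at x)))"
      by (rule norm_triangle_ineq)
    also have "\<dots> \<le> L2_norm l w * L2_norm l (\<lambda>x. v x - \<eta> x) + L2_norm l u * L2_norm l (\<lambda>x. z x - vector_derivative \<eta> (at x))"
      by (intro add_mono ip_Cauchy_Schwarz L2_diff L test_function_L2 \<eta>)
    also have "\<dots> \<le> L2_norm l w * (e / K) + L2_norm l u * (e / K)"
      using \<eta> by (intro add_mono mult_left_mono) auto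
    also have "\<dots> = (L2_norm l w + L2_norm l u) / K * e"
      by (simp add: distrib_right add_divide_distrib)
    also have "\<dots> \<le> 1 * e" using \<open>0 < e\<close> \<open>0 < K\<close> by (intro mult_right_mono) (auto simp: K_def)
    finally show "cmod (ip l w v + ip l u z) \<le> 0 + e" by simp
  qed
  then show ?thesis by (simp add: add_eq_0_iff2)
qed

section \<open>The Dirichlet realisation of a Schroedinger operator\<close>

lemma schroedinger_op_iff:
  assumes l: "0 < l"
  shows "(u, w) \<in> schroedinger_op l q \<longleftrightarrow> w \<in> L2 l \<and>
    (\<exists>u1 u2. H1_0_deriv l u u1 \<and> weak_deriv l u1 u2 \<and>
      (AE x in interval_measure l. w x = - u2 x - complex_of_real (q x) * u x))"
proof safe
  assume a: "(u, w) \<in> schroedinger_op l q"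
  then show "w \<in> L2 l" by (simp add: schroedinger_op_def)
  from a obtain u1 u2 where u: "u \<in> H1_0 l" "weak_deriv l u u1" "weak_deriv l u1 u2"
    "AE x in interval_measure l. w x = - u2 x - complex_of_real (q x) * u x"
    unfolding schroedinger_op_def by blast
  then obtain w' where w': "H1_0_deriv l u w'"
    by (auto simp: H1_0_def H1_0_deriv_def)
  have "AE x in interval_measure l. u1 x = w' x"
    using w' by (intro weak_deriv_unique [OF l u(2), of u w']) (auto simp: H1_0_deriv_def)
  then have "H1_0_deriv l u u1"
    using H1_0_deriv_AE_cong [OF w' _ u(2)] by simp
  then show "\<exists>u1 u2. H1_0_deriv l u u1 \<and> weak_deriv l u1 u2 \<and>
      (AE x in interval_measure l. w x = - u2 x - complex_of_real (q x) * u x)"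
    using u by blast
next
  fix u1 u2 assume "w \<in> L2 l" and u: "H1_0_deriv l u u1" "weak_deriv l u1 u2"
    "AE x in interval_measure l. w x = - u2 x - complex_of_real (q x) * u x"
  then have "weak_deriv l u u1" by (simp add: H1_0_deriv_def)
  moreover have "u1 \<in> H1 l" using u(2) by (auto simp: H1_def)
  ultimately have "u \<in> H2 l" by (auto simp: H2_def)
  moreover have "u \<in> H1_0 l"
    unfolding H1_0_def mem_Collect_eq using u(1) [unfolded H1_0_deriv_def] by (rule exI [of _ u1])
  ultimately show "(u, w) \<in> schroedinger_op l q"
    using \<open>w \<in> L2 l\<close> \<open>weak_deriv l u u1\<close> u(2,3) by (auto simp: schroedinger_op_def)
qed

lemma schroedinger_L2:
  assumes "(u, w) \<in> schroedinger_op l q"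
  shows "u \<in> L2 l" "w \<in> L2 l"
  using assms unfolding schroedinger_op_def weak_deriv_def by auto

lemma schroedinger_lincomb:
  assumes l: "0 < l" and "(u, a) \<in> schroedinger_op l q" "(v, b) \<in> schroedinger_op l q"
  shows "(\<lambda>x. c * u x + d * v x, \<lambda>x. c * a x + d * b x) \<in> schroedinger_op l q"
proof -
  obtain u1 u2 v1 v2 where u: "H1_0_deriv l u u1" "weak_deriv l u1 u2"
      "AE x in interval_measure l. a x = - u2 x - complex_of_real (q x) * u x"
    and v: "H1_0_deriv l v v1" "weak_deriv l v1 v2"
      "AE x in interval_measure l. b x = - v2 x - complex_of_real (q x) * v x"
    using assms(2,3) unfolding schroedinger_op_iff [OF l] by blast
  have "AE x in interval_measure l. c * a x + d * b x
      = - (c * u2 x + d * v2 x) - complex_of_real (q x) * (c * u x + d * v x)"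
    using u(3) v(3)
  proof eventually_elim
    case (elim x)
    show ?case unfolding elim by (simp add: algebra_simps)
  qed
  then show ?thesis
    unfolding schroedinger_op_iff [OF l]
    using H1_0_deriv_lincomb [OF u(1) v(1)] weak_deriv_lincomb [OF u(2) v(2)]
      schroedinger_L2 [OF assms(2)] schroedinger_L2 [OF assms(3)]
    by (intro conjI exI) (auto intro!: L2_add L2_cmult)
qed

lemma schroedinger_cmult:
  "0 < l \<Longrightarrow> (u, a) \<in> schroedinger_op l q \<Longrightarrow> (\<lambda>x. c * u x, \<lambda>x. c * a x) \<in> schroedinger_op l q"
  using schroedinger_lincomb [of l u a q u a c 0] by simp

lemma schroedinger_diff:
  assumes "0 < l" "(u, a) \<in> schroedinger_op l q" "(v, b) \<in> schroedinger_op l q"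
  shows "(\<lambda>x. u x - v x, \<lambda>x. a x - b x) \<in> schroedinger_op l q"
  using schroedinger_lincomb [OF assms, of 1 "-1"] by simp

lemma schroedinger_AE_cong:
  assumes l: "0 < l" and "(u, a) \<in> schroedinger_op l q"
    and "AE x in interval_measure l. u' x = u x" "AE x in interval_measure l. a' x = a x"
  shows "(u', a') \<in> schroedinger_op l q"
proof -
  obtain u1 u2 where u: "H1_0_deriv l u u1" "weak_deriv l u1 u2"
      "AE x in interval_measure l. a x = - u2 x - complex_of_real (q x) * u x"
    using assms(2) unfolding schroedinger_op_iff [OF l] by blast
  have "weak_deriv l u' u1"
    using u(1) assms(3) by (auto simp: H1_0_deriv_def intro: weak_deriv_AE_cong)
  then have "H1_0_deriv l u' u1"
    using H1_0_deriv_AE_cong [OF u(1) assms(3)] by simp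
  moreover have "AE x in interval_measure l. a' x = - u2 x - complex_of_real (q x) * u' x"
    using u(3) assms(3,4) by eventually_elim simp
  ultimately show ?thesis
    unfolding schroedinger_op_iff [OF l]
    using u(2) L2_AE_cong [OF schroedinger_L2(2) [OF assms(2)] assms(4)] by blast
qed

lemma schroedinger_unique:
  assumes l: "0 < l" and "(u, a) \<in> schroedinger_op l q" "(u', a') \<in> schroedinger_op l q"
    and ae: "AE x in interval_measure l. u x = u' x"
  shows "AE x in interval_measure l. a x = a' x"
proof -
  obtain u1 u2 v1 v2 where u: "H1_0_deriv l u u1" "weak_deriv l u1 u2"
      "AE x in interval_measure l. a x = - u2 x - complex_of_real (q x) * u x"
    and v: "H1_0_deriv l u' v1" "weak_deriv l v1 v2"
      "AE x in interval_measure l. a' x = - v2 x - complex_of_real (q x) * u' x"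
    using assms(2,3) unfolding schroedinger_op_iff [OF l] by blast
  have "AE x in interval_measure l. u1 x = v1 x"
    using u(1) v(1) by (intro weak_deriv_unique [OF l _ _ ae]) (auto simp: H1_0_deriv_def)
  then have "AE x in interval_measure l. u2 x = v2 x"
    by (rule weak_deriv_unique [OF l u(2) v(2)])
  then show ?thesis using u(3) v(3) ae by eventually_elim simp
qed

lemma schroedinger_image_of_zero:
  assumes l: "0 < l" and "(u, a) \<in> schroedinger_op l q" "AE x in interval_measure l. u x = 0"
  shows "AE x in interval_measure l. a x = 0"
  using schroedinger_unique [OF l assms(2) schroedinger_cmult [OF l assms(2), of 0]] assms(3) by simp

lemma schroedinger_change_potential:
  assumes l: "0 < l" and "(u, a) \<in> schroedinger_op l q"
    and "continuous_on {0..l} q" "continuous_on {0..l} q'"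
  shows "(u, \<lambda>x. a x + complex_of_real (q x - q' x) * u x) \<in> schroedinger_op l q'"
proof -
  obtain u1 u2 where u: "H1_0_deriv l u u1" "weak_deriv l u1 u2"
      "AE x in interval_measure l. a x = - u2 x - complex_of_real (q x) * u x"
    using assms(2) unfolding schroedinger_op_iff [OF l] by blast
  have "AE x in interval_measure l. a x + complex_of_real (q x - q' x) * u x
       = - u2 x - complex_of_real (q' x) * u x"
    using u(3) by eventually_elim (simp add: algebra_simps)
  moreover have "(\<lambda>x. a x + complex_of_real (q x - q' x) * u x) \<in> L2 l"
    using assms schroedinger_L2 [OF assms(2)]
    by (intro L2_add L2_mult_continuous continuous_intros) auto
  ultimately show ?thesis
    unfolding schroedinger_op_iff [OF l] using u by blast
qed

lemma schroedinger_form: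
  assumes q: "continuous_on {0..l} q"
    and u: "H1_0_deriv l u u1" "weak_deriv l u1 u2"
      "AE x in interval_measure l. a x = - u2 x - complex_of_real (q x) * u x"
    and v: "H1_0_deriv l v v1" and a: "a \<in> L2 l"
  shows "ip l a v = ip l u1 v1 - ip l (\<lambda>x. complex_of_real (q x) * u x) v"
proof -
  have L: "u \<in> L2 l" "u1 \<in> L2 l" "u2 \<in> L2 l" "v \<in> L2 l"
    using u v weak_deriv_L2 unfolding H1_0_deriv_def by auto
  have qu: "(\<lambda>x. complex_of_real (q x) * u x) \<in> L2 l"
    using q by (intro L2_mult_continuous L continuous_intros)
  have "ip l a v = ip l (\<lambda>x. - u2 x - complex_of_real (q x) * u x) v"
    using u(3) by (intro ip_AE_cong L2_diff L2_uminus L qu) auto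
  also have "\<dots> = - ip l u2 v - ip l (\<lambda>x. complex_of_real (q x) * u x) v"
    using L qu by (simp add: ip_diff_left L2_uminus ip_uminus_left)
  also have "ip l u2 v = - ip l u1 v1"
    by (rule weak_deriv_H1_0_by_parts [OF u(2) v])
  finally show ?thesis by simp
qed

text \<open>
  Both sides equal the Dirichlet form \<open>\<integral> u' cnj v' - q u cnj v\<close>.
\<close>

lemma schroedinger_symmetric:
  assumes l: "0 < l" and q: "continuous_on {0..l} q"
    and S: "(u, a) \<in> schroedinger_op l q" "(v, b) \<in> schroedinger_op l q"
  shows "ip l a v = ip l u b"
proof -
  obtain u1 u2 v1 v2 where u: "H1_0_deriv l u u1" "weak_deriv l u1 u2"
      "AE x in interval_measure l. a x = - u2 x - complex_of_real (q x) * u x"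
    and v: "H1_0_deriv l v v1" "weak_deriv l v1 v2"
      "AE x in interval_measure l. b x = - v2 x - complex_of_real (q x) * v x"
    using S unfolding schroedinger_op_iff [OF l] by blast
  have "ip l a v = ip l u1 v1 - ip l (\<lambda>x. complex_of_real (q x) * u x) v"
    by (rule schroedinger_form [OF q u v(1) schroedinger_L2(2) [OF S(1)]])
  moreover have "ip l b u = ip l v1 u1 - ip l (\<lambda>x. complex_of_real (q x) * v x) u"
    by (rule schroedinger_form [OF q v u(1) schroedinger_L2(2) [OF S(2)]])
  then have "ip l u b = ip l u1 v1 - ip l u (\<lambda>x. complex_of_real (q x) * v x)"
    using ip_cnj [of l b u] by (simp add: ip_cnj)
  moreover have "ip l u (\<lambda>x. complex_of_real (q x) * v x) = ip l (\<lambda>x. complex_of_real (q x) * u x) v"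
    by (simp add: ip_def mult.left_commute mult.assoc)
  ultimately show ?thesis by simp
qed

lemma schroedinger_form_real:
  assumes "0 < l" "continuous_on {0..l} q" "(u, a) \<in> schroedinger_op l q"
  shows "ip l a u = complex_of_real (Re (ip l a u))"
proof -
  have "cnj (ip l a u) = ip l a u"
    using schroedinger_symmetric [OF assms(1,2,3,3)] by (simp add: ip_cnj)
  then show ?thesis by (simp add: complex_eq_iff)
qed

lemma ip_multiplier_bound:
  assumes "continuous_on {0..l} q" "\<And>x. x \<in> {0..l} \<Longrightarrow> \<bar>q x\<bar> \<le> K" "u \<in> L2 l"
  shows "Re (ip l (\<lambda>x. complex_of_real (q x) * u x) u) \<le> K * (L2_norm l u)\<^sup>2"
proof -
  have qu: "(\<lambda>x. complex_of_real (q x) * u x) \<in> L2 l"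
    using assms by (intro L2_mult_continuous continuous_intros)
  have "Re (ip l (\<lambda>x. complex_of_real (q x) * u x) u)
      = (LINT x|interval_measure l. Re (complex_of_real (q x) * u x * cnj (u x)))"
    unfolding ip_def by (intro integral_Re [symmetric] ip_integrable qu assms)
  also have "\<dots> \<le> (LINT x|interval_measure l. K * (norm (u x))\<^sup>2)"
  proof (intro integral_mono integrable_Re ip_integrable qu assms)
    show "integrable (interval_measure l) (\<lambda>x. K * (norm (u x))\<^sup>2)"
      by (intro integrable_mult_right L2_integrable_sq assms)
    fix x assume "x \<in> space (interval_measure l)"
    then have "q x \<le> K" using assms(2) [of x] by simp
    then have "q x * (norm (u x))\<^sup>2 \<le> K * (norm (u x))\<^sup>2" by (intro mult_right_mono) auto
    moreover have "complex_of_real (q x) * u x * cnj (u x) = complex_of_real (q x * (norm (u x))\<^sup>2)"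
      by (simp only: mult.assoc complex_norm_square [symmetric] of_real_mult)
    ultimately show "Re (complex_of_real (q x) * u x * cnj (u x)) \<le> K * (norm (u x))\<^sup>2"
      by (simp only: Re_complex_of_real)
  qed
  also have "\<dots> = K * (L2_norm l u)\<^sup>2"
    by (simp add: L2_norm_sq)
  finally show ?thesis .
qed

lemma schroedinger_bounded_below:
  assumes l: "0 < l" and q: "continuous_on {0..l} q"
    and S: "(u, a) \<in> schroedinger_op l q" and K: "\<And>x. x \<in> {0..l} \<Longrightarrow> \<bar>q x\<bar> \<le> K"
  shows "- K * (L2_norm l u)\<^sup>2 \<le> Re (ip l a u)"
proof -
  obtain u1 u2 where u: "H1_0_deriv l u u1" "weak_deriv l u1 u2"
      "AE x in interval_measure l. a x = - u2 x - complex_of_real (q x) * u x"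
    using S unfolding schroedinger_op_iff [OF l] by blast
  have "ip l a u = ip l u1 u1 - ip l (\<lambda>x. complex_of_real (q x) * u x) u"
    by (rule schroedinger_form [OF q u u(1) schroedinger_L2(2) [OF S]])
  moreover have "0 \<le> Re (ip l u1 u1)" by (simp add: ip_self del: of_real_power)
  ultimately show ?thesis
    using ip_multiplier_bound [OF q K schroedinger_L2(1) [OF S]] by simp
qed

text \<open>
  The bridge from differential equations to the operator. The derivative of \<open>u\<close> has mean zero because
  \<open>u\<close> vanishes at both end points, so \<open>u\<close> is an \<open>H\<^sup>1\<close>-limit of test functions.
\<close>

lemma classical_dirichlet_solution:
  fixes u p w :: "real \<Rightarrow> complex"
  assumes l: "0 < l" and p: "p \<in> L2 l" and w: "w \<in> L2 l"
    and u: "\<And>x. x \<in> {0..l} \<Longrightarrow> u x = \<alpha> * of_real x + integral {0..x} (\<lambda>t. of_real (x - t) * p t)"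
    and ul: "u l = 0"
    and ae: "AE x in interval_measure l. w x = - p x - complex_of_real (q x) * u x"
  shows "(u, w) \<in> schroedinger_op l q"
proof -
  note pa = integrable_interval_absolutely [OF L2_integrable [OF p]]
  define u1 where "u1 = (\<lambda>x. \<alpha> + integral {0..x} p)"
  have c1: "continuous_on {0..l} u1"
    unfolding u1_def by (intro continuous_intros primitive_continuous pa)
  have uu: "u x = integral {0..x} u1" if "x \<in> {0..l}" for x
    using double_primitive [OF pa that, of \<alpha>] u [OF that] by (simp add: u1_def)
  have mean: "integral {0..l} u1 = 0" using uu [of l] ul l by simp
  have u1L: "u1 \<in> L2 l" by (rule L2_continuous [OF c1])
  have cu: "continuous_on {0..l} u"
    by (rule continuous_on_eq [OF primitive_continuous [OF absolutely_integrable_continuous_real [OF c1]]])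
      (simp add: uu)
  have uL: "u \<in> L2 l" by (rule L2_continuous [OF cu])
  have wd1: "weak_deriv l u1 p"
    unfolding weak_deriv_def using u1L p test_function_by_parts [OF l p, of _ u1 \<alpha>]
    by (auto simp: u1_def)
  have wd: "weak_deriv l u u1"
    unfolding weak_deriv_def using u1L uL test_function_by_parts [OF l u1L, of _ u 0] uu
    by auto
  have "H1_0_deriv l u u1"
    unfolding H1_0_deriv_def
  proof (intro conjI wd allI impI)
    fix \<epsilon> :: real assume "0 < \<epsilon>"
    then obtain \<eta> where \<eta>: "test_function l \<eta>"
      "L2_norm l (\<lambda>x. u1 x - vector_derivative \<eta> (at x)) < \<epsilon>"
      "L2_norm l (\<lambda>x. integral {0..x} u1 - \<eta> x) < \<epsilon>"
      using zero_mean_approximation [OF l c1 mean] by metis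
    have "L2_norm l (\<lambda>x. u x - \<eta> x) = L2_norm l (\<lambda>x. integral {0..x} u1 - \<eta> x)"
    proof -
      have "(LINT x|interval_measure l. (norm (u x - \<eta> x))\<^sup>2)
          = (LINT x|interval_measure l. (norm (integral {0..x} u1 - \<eta> x))\<^sup>2)"
        by (intro Bochner_Integration.integral_cong) (auto simp: uu)
      then show ?thesis by (simp add: L2_norm_def)
    qed
    then show "\<exists>\<eta>. test_function l \<eta> \<and> L2_norm l (\<lambda>x. u x - \<eta> x) < \<epsilon> \<and>
        L2_norm l (\<lambda>x. u1 x - vector_derivative \<eta> (at x)) < \<epsilon>"
      using \<eta> by auto
  qed
  then show ?thesis
    unfolding schroedinger_op_iff [OF l] using w wd1 ae by blast
qed

section \<open>Second-order linear differential equations\<close>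

lemma L1_le_L2_norm:
  fixes s :: "real \<Rightarrow> 'v::{complex_normed,euclidean_space}"
  assumes l: "0 < l" and s: "s \<in> L2 l"
  shows "integrable (interval_measure l) s"
    "(LINT x|interval_measure l. norm (s x)) \<le> sqrt l * L2_norm l s"
proof -
  define u where "u = (\<lambda>x. complex_of_real (norm (s x)))"
  have u: "u \<in> L2 l"
    using s unfolding L2_def u_def by auto
  have one: "(\<lambda>x. 1::complex) \<in> L2 l" by (intro L2_continuous continuous_intros)
  have "ip l u (\<lambda>x. 1) = complex_of_real (LINT x|interval_measure l. norm (s x))"
    by (simp add: ip_def u_def)
  then have "(LINT x|interval_measure l. norm (s x)) \<le> cmod (ip l u (\<lambda>x. 1))" by simp
  also have "\<dots> \<le> L2_norm l u * L2_norm l (\<lambda>x. 1::complex)" by (rule ip_Cauchy_Schwarz [OF u one])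
  also have "L2_norm l u = L2_norm l s" by (simp add: L2_norm_def u_def)
  also have "L2_norm l s * L2_norm l (\<lambda>x. 1::complex) \<le> L2_norm l s * sqrt l"
    using L2_norm_le_bound [OF l one, of 1] by (intro mult_left_mono) auto
  finally show "(LINT x|interval_measure l. norm (s x)) \<le> sqrt l * L2_norm l s"
    by (simp only: mult.commute)
  have "integrable (interval_measure l) (\<lambda>x. norm (s x))"
    using integrable_norm [OF L2_integrable [OF u]] by (simp add: u_def)
  then show "integrable (interval_measure l) s"
    using L2_measurable [OF s] by (simp add: integrable_norm_iff)
qed

lemma kernel_integrable:
  fixes k :: "real \<Rightarrow> 'a::euclidean_space"
  assumes "k absolutely_integrable_on {0..l}" "x \<in> {0..l}"
  shows "(\<lambda>t. t *\<^sub>R k t) absolutely_integrable_on {0..l}"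
    "(\<lambda>t. t *\<^sub>R k t) absolutely_integrable_on {0..x}"
    "(\<lambda>t. (x - t) *\<^sub>R k t) absolutely_integrable_on {0..x}"
    "k absolutely_integrable_on {0..x}"
    "integral {0..x} (\<lambda>t. (x - t) *\<^sub>R k t) = x *\<^sub>R integral {0..x} k - integral {0..x} (\<lambda>t. t *\<^sub>R k t)"
proof -
  show 1: "(\<lambda>t. t *\<^sub>R k t) absolutely_integrable_on {0..l}"
  proof -
    have bl: "bilinear ((*\<^sub>R) :: real \<Rightarrow> 'a \<Rightarrow> 'a)"
      by (simp add: bilinear_conv_bounded_bilinear bounded_bilinear_scaleR)
    show ?thesis
    proof (rule absolutely_integrable_bounded_measurable_product [OF bl])
    show "(\<lambda>t. t) \<in> borel_measurable (lebesgue_on {0..l})"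
      by (rule continuous_imp_measurable_on_sets_lebesgue) auto
    show "bounded ((\<lambda>t. t) ` {0..l})" by simp
    qed (use assms in auto)
  qed
  show 2: "(\<lambda>t. t *\<^sub>R k t) absolutely_integrable_on {0..x}"
    and 3: "k absolutely_integrable_on {0..x}"
    using absolutely_integrable_subinterval [OF 1, of 0 x] absolutely_integrable_subinterval [OF assms(1), of 0 x] assms by auto
  have eq: "(\<lambda>t. (x - t) *\<^sub>R k t) = (\<lambda>t. x *\<^sub>R k t - t *\<^sub>R k t)"
    by (simp add: scaleR_left_diff_distrib)
  have xk: "(\<lambda>t. x *\<^sub>R k t) absolutely_integrable_on {0..x}"
    using 3 by (rule absolutely_integrable_scaleR_left)
  show "(\<lambda>t. (x - t) *\<^sub>R k t) absolutely_integrable_on {0..x}"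
    unfolding eq using xk 2 by (rule set_integral_diff(1))
  have "integral {0..x} (\<lambda>t. x *\<^sub>R k t - t *\<^sub>R k t)
      = integral {0..x} (\<lambda>t. x *\<^sub>R k t) - integral {0..x} (\<lambda>t. t *\<^sub>R k t)"
    using xk 2 by (intro Henstock_Kurzweil_Integration.integral_diff)
      (auto simp: set_lebesgue_integral_eq_integral)
  then show "integral {0..x} (\<lambda>t. (x - t) *\<^sub>R k t) = x *\<^sub>R integral {0..x} k - integral {0..x} (\<lambda>t. t *\<^sub>R k t)"
    unfolding eq by simp
qed

lemma kernel_primitive_continuous:
  fixes k :: "real \<Rightarrow> 'a::euclidean_space"
  assumes "k absolutely_integrable_on {0..l}"
  shows "continuous_on {0..l} (\<lambda>x. integral {0..x} (\<lambda>t. (x - t) *\<^sub>R k t))"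
proof (cases "0 \<le> l")
  case True
  have "continuous_on {0..l} (\<lambda>x. x *\<^sub>R integral {0..x} k - integral {0..x} (\<lambda>t. t *\<^sub>R k t))"
    using kernel_integrable(1) [OF assms, of l] True
    by (intro continuous_intros primitive_continuous assms) auto
  then show ?thesis
    by (rule continuous_on_eq) (simp add: kernel_integrable(5) [OF assms])
qed auto

lemma kernel_primitive_bound:
  fixes k :: "real \<Rightarrow> 'a::euclidean_space"
  assumes k: "integrable (interval_measure l) k" and x: "x \<in> {0..l}"
  shows "norm (integral {0..x} (\<lambda>t. (x - t) *\<^sub>R k t)) \<le> l * (LINT x|interval_measure l. norm (k x))"
proof -
  note ka = integrable_interval_absolutely [OF k]
  have nk: "(\<lambda>t. norm (k t)) integrable_on {0..x}" "(\<lambda>t. norm (k t)) integrable_on {0..l}"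
    using absolutely_integrable_norm [OF kernel_integrable(4) [OF ka x]] absolutely_integrable_norm [OF ka]
    by (auto simp: o_def set_lebesgue_integral_eq_integral)
  have "norm (integral {0..x} (\<lambda>t. (x - t) *\<^sub>R k t)) \<le> integral {0..x} (\<lambda>t. l * norm (k t))"
    using kernel_integrable(3) [OF ka x] nk x
    by (intro integral_norm_bound_integral) (auto simp: set_lebesgue_integral_eq_integral intro!: mult_right_mono integrable_on_mult_right)
  also have "\<dots> = l * integral {0..x} (\<lambda>t. norm (k t))" by simp
  also have "\<dots> \<le> l * integral {0..l} (\<lambda>t. norm (k t))"
    using nk x by (intro mult_left_mono integral_subset_le) auto
  also have "integral {0..l} (\<lambda>t. norm (k t)) = (LINT x|interval_measure l. norm (k x))"
    by (intro LINT_interval_eq_integral [symmetric] integrable_norm k)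
  finally show ?thesis .
qed

text \<open>
  The equation \<open>Y'' = B Y\<close> with values in a finite-dimensional space, in the integrated form
  \<open>Y x = F x + \<integral>\<^sub>0\<^sup>x (x - t) B\<^sub>t (Y t) dt\<close>. Rough inhomogeneous terms enter only through their second
  primitive, which is part of the continuous function \<open>F\<close>.
\<close>

locale linear_ode =
  fixes l K :: real and B :: "real \<Rightarrow> 'a::euclidean_space \<Rightarrow> 'a"
  assumes l: "0 < l" and K: "0 \<le> K"
    and linear_B: "\<And>t. linear (B t)"
    and bound_B: "\<And>t y. t \<in> {0..l} \<Longrightarrow> norm (B t y) \<le> K * norm y"
    and continuous_B: "\<And>Y. continuous_on {0..l} Y \<Longrightarrow> continuous_on {0..l} (\<lambda>t. B t (Y t))"
begin

definition solution :: "(real \<Rightarrow> 'a) \<Rightarrow> (real \<Rightarrow> 'a) \<Rightarrow> bool" where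
  "solution F Y \<longleftrightarrow> continuous_on {0..l} Y \<and>
    (\<forall>x\<in>{0..l}. Y x = F x + integral {0..x} (\<lambda>t. (x - t) *\<^sub>R B t (Y t)))"

text \<open>
  The kernel of the Volterra operator is bounded by \<open>l * K\<close>, and the integral of \<open>exp (rate * t)\<close> over
  \<open>{0..x}\<close> by \<open>exp (rate * x) / rate\<close>; the choice makes \<open>l * K / rate\<close> at most \<open>1 / 2\<close>.
\<close>

definition rate :: real where "rate = 2 * l * K + 1"

lemma rate_pos: "0 < rate"
  using l K by (simp add: rate_def add_nonneg_pos)

text \<open>
  In the norm with weight \<open>exp (- rate * x)\<close> the Volterra operator has norm at most \<open>1 / 2\<close>. This
  gives existence by the contraction principle, and the a priori bound.
\<close>

lemma volterra_estimate:
  assumes h: "continuous_on {0..l} h" and x: "x \<in> {0..l}"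
    and m: "\<And>t. t \<in> {0..x} \<Longrightarrow> norm (h t) \<le> m * exp (rate * t)" and "0 \<le> m"
  shows "norm (integral {0..x} (\<lambda>t. (x - t) *\<^sub>R B t (h t))) \<le> exp (rate * x) * (m / 2)"
proof -
  have sub: "{0..x} \<subseteq> {0..l}" using x by auto
  have e: "((\<lambda>t. exp (rate * t)) has_integral (exp (rate * x) / rate - exp (rate * 0) / rate)) {0..x}"
    using x rate_pos by (intro fundamental_theorem_of_calculus)
      (auto intro!: derivative_eq_intros simp: has_real_derivative_iff_has_vector_derivative [symmetric])
  have "norm (integral {0..x} (\<lambda>t. (x - t) *\<^sub>R B t (h t))) \<le> integral {0..x} (\<lambda>t. l * K * m * exp (rate * t))"
  proof (rule integral_norm_bound_integral)
    show "(\<lambda>t. (x - t) *\<^sub>R B t (h t)) integrable_on {0..x}"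
      by (intro integrable_continuous_real continuous_intros continuous_on_subset [OF continuous_B [OF h] sub])
    show "(\<lambda>t. l * K * m * exp (rate * t)) integrable_on {0..x}"
      by (intro integrable_continuous_real continuous_intros)
    fix t assume t: "t \<in> {0..x}"
    have "norm ((x - t) *\<^sub>R B t (h t)) = (x - t) * norm (B t (h t))" using t by simp
    also have "\<dots> \<le> l * (K * norm (h t))"
      using t x l bound_B [of t "h t"] by (intro mult_mono) auto
    also have "\<dots> \<le> l * (K * (m * exp (rate * t)))"
      using l K m [OF t] by (intro mult_left_mono) auto
    finally show "norm ((x - t) *\<^sub>R B t (h t)) \<le> l * K * m * exp (rate * t)" by (simp add: mult.assoc)
  qed
  also have "\<dots> = l * K * m * (exp (rate * x) / rate - 1 / rate)"
    using has_integral_mult_right [OF e, of "l * K * m"] by (intro integral_unique) simp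
  also have "\<dots> \<le> l * K * m * (exp (rate * x) / rate)"
    using l K \<open>0 \<le> m\<close> rate_pos by (intro mult_left_mono) auto
  also have "\<dots> = exp (rate * x) * (m * (l * K / rate))" by simp
  also have "\<dots> \<le> exp (rate * x) * (m * (1 / 2))"
  proof (intro mult_left_mono \<open>0 \<le> m\<close>)
    show "l * K / rate \<le> 1 / 2"
      using rate_pos by (simp only: pos_divide_le_eq) (simp add: rate_def)
  qed simp
  finally show ?thesis by simp
qed

lemma solution_bound:
  assumes Y: "solution F Y" and M: "\<And>x. x \<in> {0..l} \<Longrightarrow> norm (F x) \<le> M" and x: "x \<in> {0..l}"
  shows "norm (Y x) \<le> 2 * exp (rate * l) * M"
proof -
  have cY: "continuous_on {0..l} Y"
    and eq: "\<And>x. x \<in> {0..l} \<Longrightarrow> Y x = F x + integral {0..x} (\<lambda>t. (x - t) *\<^sub>R B t (Y t))"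
    using Y by (auto simp: solution_def)
  have cont: "continuous_on {0..l} (\<lambda>x. exp (- rate * x) * norm (Y x))"
    by (intro continuous_intros cY)
  have "\<exists>x0\<in>{0..l}. \<forall>t\<in>{0..l}. exp (- rate * t) * norm (Y t) \<le> exp (- rate * x0) * norm (Y x0)"
    by (rule continuous_attains_sup [OF compact_Icc _ cont]) (use l in simp)
  then obtain x0 where x0: "x0 \<in> {0..l}"
    and max: "\<And>t. t \<in> {0..l} \<Longrightarrow> exp (- rate * t) * norm (Y t) \<le> exp (- rate * x0) * norm (Y x0)"
    by blast
  define m where "m = exp (- rate * x0) * norm (Y x0)"
  have le: "norm (Y t) \<le> m * exp (rate * t)" if "t \<in> {0..l}" for t
    using max [OF that] by (simp add: m_def exp_minus field_simps)
  have "norm (Y x0) \<le> norm (F x0) + norm (integral {0..x0} (\<lambda>t. (x0 - t) *\<^sub>R B t (Y t)))"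
    by (subst eq [OF x0]) (rule norm_triangle_ineq)
  also have "\<dots> \<le> M + exp (rate * x0) * (m / 2)"
    using x0 by (intro add_mono M volterra_estimate cY le) (auto simp: m_def)
  finally have "m \<le> exp (- rate * x0) * (M + exp (rate * x0) * (m / 2))"
    unfolding m_def by (intro mult_left_mono) auto
  also have "\<dots> = exp (- rate * x0) * M + m / 2" by (simp add: distrib_left exp_minus)
  also have "exp (- rate * x0) * M \<le> 1 * M"
  proof (intro mult_right_mono)
    show "0 \<le> M" by (rule order_trans [OF norm_ge_zero M [OF x0]])
  qed (use x0 rate_pos in simp)
  finally have mM: "m \<le> 2 * M" by simp
  have "norm (Y x) \<le> m * exp (rate * x)" by (rule le [OF x])
  also have "\<dots> \<le> m * exp (rate * l)"
    using x rate_pos by (intro mult_left_mono) (auto simp: m_def)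
  also have "\<dots> \<le> 2 * M * exp (rate * l)" using mM by (intro mult_right_mono) auto
  finally show ?thesis by (simp add: mult_ac)
qed

lemma solution_exists:
  assumes F: "continuous_on {0..l} F"
  shows "\<exists>Y. solution F Y"
proof -
  \<comment> \<open>the fixed point is sought among the bounded continuous functions on the line that are constant outside \<open>{0..l}\<close>\<close>
  define cl where "cl = (\<lambda>x. max 0 (min l x))"
  have cl: "cl x \<in> {0..l}" for x using l by (auto simp: cl_def)
  have cl_id: "cl x = x" if "x \<in> {0..l}" for x using that by (auto simp: cl_def)
  have cont_cl: "continuous_on UNIV cl" unfolding cl_def by (intro continuous_intros)
  define T where "T = (\<lambda>f :: real \<Rightarrow> 'a. \<lambda>x. exp (- rate * x) *\<^sub>R
      (F x + integral {0..x} (\<lambda>t. (x - t) *\<^sub>R B t (exp (rate * t) *\<^sub>R f t))))"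
  have cw: "continuous_on {0..l} (\<lambda>t. exp (rate * t) *\<^sub>R f t)" if "continuous_on {0..l} f" for f :: "real \<Rightarrow> 'a"
    by (intro continuous_intros that)
  have cT: "continuous_on {0..l} (T f)" if "continuous_on {0..l} f" for f
    unfolding T_def
    by (intro continuous_intros F kernel_primitive_continuous absolutely_integrable_continuous_real continuous_B cw that)
  define \<Phi> where "\<Phi> = (\<lambda>f :: real \<Rightarrow>\<^sub>C 'a. Bcontfun (\<lambda>x. T (apply_bcontfun f) (cl x)))"
  have cf: "continuous_on {0..l} (apply_bcontfun f)" for f :: "real \<Rightarrow>\<^sub>C 'a"
    using apply_bcontfun [of f] by (auto simp: bcontfun_def intro: continuous_on_subset)
  have \<Phi>: "apply_bcontfun (\<Phi> f) x = T (apply_bcontfun f) (cl x)" for f x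
  proof -
    have "continuous_on UNIV (\<lambda>x. T (apply_bcontfun f) (cl x))"
      using cl by (intro continuous_on_compose2 [OF cT [OF cf] cont_cl]) auto
    moreover have "bounded (T (apply_bcontfun f) ` {0..l})"
      by (intro compact_imp_bounded compact_continuous_image cT cf) auto
    then have "bounded (range (\<lambda>x. T (apply_bcontfun f) (cl x)))"
      by (rule bounded_subset) (use cl in auto)
    ultimately show ?thesis
      unfolding \<Phi>_def by (subst Bcontfun_inverse) (auto simp: bcontfun_def)
  qed
  have "\<exists>!f. \<Phi> f = f"
  proof (rule banach_fix_type [of "1/2"])
    show "\<forall>f g. dist (\<Phi> f) (\<Phi> g) \<le> 1 / 2 * dist f g"
    proof (intro allI dist_bound)
      fix f g :: "real \<Rightarrow>\<^sub>C 'a" and x :: real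
      define y where "y = cl x"
      have y: "y \<in> {0..l}" using cl by (simp add: y_def)
      have sub: "{0..y} \<subseteq> {0..l}" using y by auto
      let ?h = "\<lambda>f t. exp (rate * t) *\<^sub>R apply_bcontfun f t"
      have int: "(\<lambda>t. (y - t) *\<^sub>R B t (?h f t)) integrable_on {0..y}" for f
        by (intro integrable_continuous_real continuous_intros continuous_on_subset [OF continuous_B [OF cw [OF cf]] sub])
      have "T (apply_bcontfun f) y - T (apply_bcontfun g) y
        = exp (- rate * y) *\<^sub>R (integral {0..y} (\<lambda>t. (y - t) *\<^sub>R B t (?h f t))
            - integral {0..y} (\<lambda>t. (y - t) *\<^sub>R B t (?h g t)))"
        by (simp add: T_def scaleR_diff_right [symmetric])
      also have "integral {0..y} (\<lambda>t. (y - t) *\<^sub>R B t (?h f t)) - integral {0..y} (\<lambda>t. (y - t) *\<^sub>R B t (?h g t))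
          = integral {0..y} (\<lambda>t. (y - t) *\<^sub>R B t (?h f t) - (y - t) *\<^sub>R B t (?h g t))"
        by (rule Henstock_Kurzweil_Integration.integral_diff [symmetric]) (rule int)+
      also have "\<dots> = integral {0..y} (\<lambda>t. (y - t) *\<^sub>R B t (?h f t - ?h g t))"
        by (simp add: linear_diff [OF linear_B] scaleR_diff_right)
      finally have "dist (T (apply_bcontfun f) y) (T (apply_bcontfun g) y)
          = exp (- rate * y) * norm (integral {0..y} (\<lambda>t. (y - t) *\<^sub>R B t (?h f t - ?h g t)))"
        by (simp add: dist_norm)
      also have "\<dots> \<le> exp (- rate * y) * (exp (rate * y) * (dist f g / 2))"
      proof (intro mult_left_mono volterra_estimate y continuous_intros cf)
        fix t
        have "norm (?h f t - ?h g t) = exp (rate * t) * dist (apply_bcontfun f t) (apply_bcontfun g t)"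
          by (simp add: scaleR_diff_right [symmetric] dist_norm)
        also have "\<dots> \<le> exp (rate * t) * dist f g" by (intro mult_left_mono dist_bounded) auto
        finally show "norm (?h f t - ?h g t) \<le> dist f g * exp (rate * t)" by (simp add: mult.commute)
      qed auto
      also have "\<dots> = 1 / 2 * dist f g" by (simp add: exp_minus)
      finally show "dist (apply_bcontfun (\<Phi> f) x) (apply_bcontfun (\<Phi> g) x) \<le> 1 / 2 * dist f g"
        by (simp add: \<Phi> y_def)
    qed
  qed auto
  then obtain f where f: "\<Phi> f = f" by blast
  define Y where "Y = (\<lambda>x. exp (rate * x) *\<^sub>R apply_bcontfun f x)"
  have "solution F Y"
    unfolding solution_def
  proof (intro conjI ballI)
    show "continuous_on {0..l} Y" unfolding Y_def by (intro continuous_intros cf)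
    fix x assume x: "x \<in> {0..l}"
    have "apply_bcontfun f x = T (apply_bcontfun f) x"
      using \<Phi> [of f x] cl_id [OF x] f by simp
    then have "Y x = exp (rate * x) *\<^sub>R exp (- rate * x) *\<^sub>R (F x + integral {0..x} (\<lambda>t. (x - t) *\<^sub>R B t (Y t)))"
      unfolding Y_def T_def by simp
    then show "Y x = F x + integral {0..x} (\<lambda>t. (x - t) *\<^sub>R B t (Y t))"
      by (simp add: exp_minus)
  qed
  then show ?thesis by (rule exI [of _ Y])
qed

lemma solution_lincomb:
  assumes "solution F Y" "solution G Z"
  shows "solution (\<lambda>x. c *\<^sub>R F x + d *\<^sub>R G x) (\<lambda>x. c *\<^sub>R Y x + d *\<^sub>R Z x)"
  unfolding solution_def
proof (intro conjI ballI)
  have cY: "continuous_on {0..l} Y" "continuous_on {0..l} Z" using assms by (auto simp: solution_def)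
  then show "continuous_on {0..l} (\<lambda>x. c *\<^sub>R Y x + d *\<^sub>R Z x)" by (intro continuous_intros)
  fix x assume x: "x \<in> {0..l}"
  then have sub: "{0..x} \<subseteq> {0..l}" by auto
  have int: "(\<lambda>t. (x - t) *\<^sub>R B t (Y t)) integrable_on {0..x}" if "continuous_on {0..l} Y" for Y
    by (intro integrable_continuous_real continuous_intros continuous_on_subset [OF continuous_B [OF that] sub])
  have eq: "(x - t) *\<^sub>R B t (c *\<^sub>R Y t + d *\<^sub>R Z t) = c *\<^sub>R ((x - t) *\<^sub>R B t (Y t)) + d *\<^sub>R ((x - t) *\<^sub>R B t (Z t))" for t
    by (simp add: linear_add [OF linear_B] linear_scale [OF linear_B] scaleR_add_right mult.commute)
  have "integral {0..x} (\<lambda>t. (x - t) *\<^sub>R B t (c *\<^sub>R Y t + d *\<^sub>R Z t))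
      = c *\<^sub>R integral {0..x} (\<lambda>t. (x - t) *\<^sub>R B t (Y t)) + d *\<^sub>R integral {0..x} (\<lambda>t. (x - t) *\<^sub>R B t (Z t))"
    unfolding eq
    by (subst Henstock_Kurzweil_Integration.integral_add)
      (intro integrable_cmul int cY, intro integrable_cmul int cY, simp only: integral_cmul)
  then show "c *\<^sub>R Y x + d *\<^sub>R Z x = c *\<^sub>R F x + d *\<^sub>R G x + integral {0..x} (\<lambda>t. (x - t) *\<^sub>R B t (c *\<^sub>R Y t + d *\<^sub>R Z t))"
    using assms x by (simp add: solution_def scaleR_add_right)
qed

lemma solution_unique:
  assumes "solution F Y" "solution F Z" "x \<in> {0..l}"
  shows "Y x = Z x"
  using solution_bound [OF solution_lincomb [OF assms(1,2), of 1 "-1"], of 0 x] assms(3) by simp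

end

context linear_ode
begin

definition bvp_solution :: "(real \<Rightarrow> 'a) \<Rightarrow> 'a \<Rightarrow> (real \<Rightarrow> 'a) \<Rightarrow> bool" where
  "bvp_solution s \<alpha> Y \<longleftrightarrow>
    solution (\<lambda>x. x *\<^sub>R \<alpha> + integral {0..x} (\<lambda>t. (x - t) *\<^sub>R s t)) Y \<and> Y l = 0"

lemma cauchy_problem:
  assumes "integrable (interval_measure l) s"
  shows "\<exists>Y. solution (\<lambda>x. x *\<^sub>R \<alpha> + integral {0..x} (\<lambda>t. (x - t) *\<^sub>R s t)) Y"
  by (intro solution_exists continuous_intros kernel_primitive_continuous integrable_interval_absolutely assms)

lemma cauchy_bound:
  assumes s: "integrable (interval_measure l) s"
    and Y: "solution (\<lambda>x. x *\<^sub>R \<alpha> + integral {0..x} (\<lambda>t. (x - t) *\<^sub>R s t)) Y"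
    and x: "x \<in> {0..l}"
  shows "norm (Y x) \<le> 2 * exp (rate * l) * (l * (norm \<alpha> + (LINT x|interval_measure l. norm (s x))))"
proof (rule solution_bound [OF Y _ x])
  fix x assume x: "x \<in> {0..l}"
  have "norm (x *\<^sub>R \<alpha> + integral {0..x} (\<lambda>t. (x - t) *\<^sub>R s t))
      \<le> norm (x *\<^sub>R \<alpha>) + norm (integral {0..x} (\<lambda>t. (x - t) *\<^sub>R s t))" by (rule norm_triangle_ineq)
  also have "\<dots> \<le> l * norm \<alpha> + l * (LINT x|interval_measure l. norm (s x))"
    using x by (intro add_mono kernel_primitive_bound s) (auto intro: mult_right_mono)
  finally show "norm (x *\<^sub>R \<alpha> + integral {0..x} (\<lambda>t. (x - t) *\<^sub>R s t))
      \<le> l * (norm \<alpha> + (LINT x|interval_measure l. norm (s x)))" by (simp add: distrib_left)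
qed

text \<open>
  Shooting: the solutions that vanish at \<open>0\<close> are parametrised linearly by their initial slope, and
  their values at \<open>l\<close> define an endomorphism \<open>M\<close> of a finite-dimensional space. If \<open>M\<close> is injective
  then it is invertible, and the slope can be adjusted to satisfy the boundary condition at \<open>l\<close>;
  otherwise there is a nonzero homogeneous solution.
\<close>

lemma fredholm_alternative:
  obtains (homogeneous) \<alpha> Y where "bvp_solution (\<lambda>t. 0) \<alpha> Y" "\<not> (AE x in interval_measure l. Y x = 0)"
  | (solvable) C where "0 \<le> C" "\<And>s. integrable (interval_measure l) s \<Longrightarrow>
      \<exists>\<alpha> Y. bvp_solution s \<alpha> Y \<and> (\<forall>x\<in>{0..l}. norm (Y x) \<le> C * (LINT x|interval_measure l. norm (s x)))"
proof -
  define H where "H = (\<lambda>\<alpha>. SOME Y. solution (\<lambda>x. x *\<^sub>R \<alpha>) Y)"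
  have H: "solution (\<lambda>x. x *\<^sub>R \<alpha>) (H \<alpha>)" for \<alpha>
  proof -
    have "\<exists>Y. solution (\<lambda>x. x *\<^sub>R \<alpha>) Y" by (intro solution_exists continuous_intros)
    then show ?thesis unfolding H_def by (rule someI_ex)
  qed
  define M where "M = (\<lambda>\<alpha>. H \<alpha> l)"
  have ll: "l \<in> {0..l}" using l by simp
  have comb: "M (c *\<^sub>R \<alpha> + d *\<^sub>R \<beta>) = c *\<^sub>R M \<alpha> + d *\<^sub>R M \<beta>" for c d \<alpha> \<beta>
  proof -
    have "solution (\<lambda>x. x *\<^sub>R (c *\<^sub>R \<alpha> + d *\<^sub>R \<beta>)) (\<lambda>x. c *\<^sub>R H \<alpha> x + d *\<^sub>R H \<beta> x)"
      using solution_lincomb [OF H [of \<alpha>] H [of \<beta>], of c d] by (simp add: scaleR_add_right mult.commute)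
    from solution_unique [OF H this ll] show ?thesis by (simp add: M_def)
  qed
  have lin: "linear M"
    using comb [of 1 _ 1] comb [of _ _ 0] by (intro linearI) auto
  show thesis
  proof (cases "inj M")
    case False
    then obtain \<alpha> where \<alpha>: "\<alpha> \<noteq> 0" "M \<alpha> = 0"
      using linear_injective_0 [OF lin] by blast
    have "bvp_solution (\<lambda>t. 0) \<alpha> (H \<alpha>)"
      using H [of \<alpha>] \<alpha> by (simp add: bvp_solution_def M_def)
    moreover have "\<not> (AE x in interval_measure l. H \<alpha> x = 0)"
    proof
      assume "AE x in interval_measure l. H \<alpha> x = 0"
      then have z: "H \<alpha> x = 0" if "x \<in> {0..l}" for x
        using H [of \<alpha>] that l by (intro continuous_AE_zero_imp_zero) (auto simp: solution_def)
      have "integral {0..l} (\<lambda>t. (l - t) *\<^sub>R B t (H \<alpha> t)) = integral {0..l} (\<lambda>t. 0)"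
        by (intro Henstock_Kurzweil_Integration.integral_cong) (simp add: z linear_0 [OF linear_B])
      then have "l *\<^sub>R \<alpha> = 0"
        using H [of \<alpha>] z [OF ll] l unfolding solution_def by fastforce
      then show False using l \<alpha> by simp
    qed
    ultimately show thesis by (rule homogeneous)
  next
    case True
    obtain b where b: "b > 0" "\<And>\<alpha>. b * norm \<alpha> \<le> norm (M \<alpha>)"
      using linear_inj_bounded_below_pos [OF lin True] by blast
    have surj: "surj M" by (rule linear_injective_imp_surjective [OF lin True refl])
    define C0 where "C0 = 2 * exp (rate * l) * l"
    have C0: "0 \<le> C0" using l by (simp add: C0_def)
    show thesis
    proof (rule solvable)
      show "0 \<le> C0 + C0 * (C0 / b)" using C0 b by simp
      fix s :: "real \<Rightarrow> 'a" assume s: "integrable (interval_measure l) s"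
      define I where "I = (LINT x|interval_measure l. norm (s x))"
      obtain Y where Y: "solution (\<lambda>x. x *\<^sub>R 0 + integral {0..x} (\<lambda>t. (x - t) *\<^sub>R s t)) Y"
        using cauchy_problem [OF s] by blast
      have bY: "norm (Y x) \<le> C0 * I" if "x \<in> {0..l}" for x
        using cauchy_bound [OF s Y that] by (simp add: C0_def I_def mult.assoc)
      obtain \<alpha> where \<alpha>: "M \<alpha> = - Y l" using surj by (metis surjD)
      have "b * norm \<alpha> \<le> C0 * I" using b(2) [of \<alpha>] bY [OF ll] \<alpha> by simp
      then have n\<alpha>: "norm \<alpha> \<le> C0 / b * I" using b(1) by (simp add: field_simps)
      have bH: "norm (H \<alpha> x) \<le> C0 * norm \<alpha>" if "x \<in> {0..l}" for x
        using cauchy_bound [of "\<lambda>t. 0" \<alpha> "H \<alpha>" x] H [of \<alpha>] that by (simp add: C0_def mult.assoc)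
      have "solution (\<lambda>x. x *\<^sub>R \<alpha> + integral {0..x} (\<lambda>t. (x - t) *\<^sub>R s t)) (\<lambda>x. Y x + H \<alpha> x)"
        using solution_lincomb [OF Y H [of \<alpha>], of 1 1] by (simp add: add.commute)
      then have "bvp_solution s \<alpha> (\<lambda>x. Y x + H \<alpha> x)"
        using \<alpha> by (simp add: bvp_solution_def M_def)
      moreover have "norm (Y x + H \<alpha> x) \<le> (C0 + C0 * (C0 / b)) * I" if "x \<in> {0..l}" for x
      proof -
        have "norm (Y x + H \<alpha> x) \<le> C0 * I + C0 * norm \<alpha>"
          using norm_triangle_ineq bY [OF that] bH [OF that] add_mono order_trans by blast
        also have "\<dots> \<le> C0 * I + C0 * (C0 / b * I)"
          using n\<alpha> C0 by (intro add_mono mult_left_mono) auto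
        finally show ?thesis by (simp add: algebra_simps)
      qed
      ultimately show "\<exists>\<alpha> Y. bvp_solution s \<alpha> Y \<and> (\<forall>x\<in>{0..l}. norm (Y x)
          \<le> (C0 + C0 * (C0 / b)) * (LINT x|interval_measure l. norm (s x)))"
        unfolding I_def by blast
    qed
  qed
qed

lemma bvp_solution_continuous: "bvp_solution s \<alpha> Y \<Longrightarrow> continuous_on {0..l} Y"
  by (simp add: bvp_solution_def solution_def)

lemma solution_integral_form:
  assumes "integrable (interval_measure l) s"
    and "solution (\<lambda>x. x *\<^sub>R \<alpha> + integral {0..x} (\<lambda>t. (x - t) *\<^sub>R s t)) Y" and x: "x \<in> {0..l}"
  shows "Y x = x *\<^sub>R \<alpha> + integral {0..x} (\<lambda>t. (x - t) *\<^sub>R (B t (Y t) + s t))"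
    "(\<lambda>t. (x - t) *\<^sub>R (B t (Y t) + s t)) integrable_on {0..x}"
proof -
  have sub: "{0..x} \<subseteq> {0..l}" using x by auto
  have cY: "continuous_on {0..l} Y" using assms(2) by (simp add: solution_def)
  have i1: "(\<lambda>t. (x - t) *\<^sub>R B t (Y t)) integrable_on {0..x}"
    by (intro integrable_continuous_real continuous_intros continuous_on_subset [OF continuous_B [OF cY] sub])
  have i2: "(\<lambda>t. (x - t) *\<^sub>R s t) integrable_on {0..x}"
    using kernel_integrable(3) [OF integrable_interval_absolutely [OF assms(1)] x]
    by (simp add: set_lebesgue_integral_eq_integral)
  show "(\<lambda>t. (x - t) *\<^sub>R (B t (Y t) + s t)) integrable_on {0..x}"
    unfolding scaleR_add_right by (rule Henstock_Kurzweil_Integration.integrable_add [OF i1 i2])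
  show "Y x = x *\<^sub>R \<alpha> + integral {0..x} (\<lambda>t. (x - t) *\<^sub>R (B t (Y t) + s t))"
    using assms(2) x unfolding scaleR_add_right solution_def
    by (simp add: Henstock_Kurzweil_Integration.integral_add [OF i1 i2])
qed

end

section \<open>Solvability of the Dirichlet problems\<close>

lemma L2_norm_le_sup:
  fixes u :: "real \<Rightarrow> complex"
  assumes l: "0 < l" and u: "u \<in> L2 l" and s: "s \<in> L2 l" and "0 \<le> C"
    and bd: "\<And>x. x \<in> {0..l} \<Longrightarrow> norm (u x) \<le> C * (LINT x|interval_measure l. norm (s x))"
  shows "L2_norm l u \<le> C * l * L2_norm l (s :: real \<Rightarrow> 'v::{complex_normed,euclidean_space})"
proof -
  have "L2_norm l u \<le> sqrt l * (C * (LINT x|interval_measure l. norm (s x)))"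
    using \<open>0 \<le> C\<close> bd by (intro L2_norm_le_bound l u) auto
  also have "\<dots> \<le> sqrt l * (C * (sqrt l * L2_norm l s))"
    using \<open>0 \<le> C\<close> l by (intro mult_left_mono L1_le_L2_norm s) auto
  also have "\<dots> = C * (sqrt l * sqrt l) * L2_norm l s" by (simp only: mult_ac)
  also have "\<dots> = C * l * L2_norm l s" using l by simp
  finally show ?thesis .
qed

lemma continuous_real_bound:
  fixes q :: "real \<Rightarrow> real"
  assumes "continuous_on {0..l} q"
  obtains K where "0 \<le> K" "\<And>x. x \<in> {0..l} \<Longrightarrow> \<bar>q x\<bar> \<le> K"
proof -
  have "bounded (q ` {0..l})"
    using compact_imp_bounded [OF compact_continuous_image [OF assms]] by simp
  then obtain K where "\<And>x. x \<in> {0..l} \<Longrightarrow> norm (q x) \<le> K"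
    unfolding bounded_iff by blast
  then have "\<And>x. x \<in> {0..l} \<Longrightarrow> \<bar>q x\<bar> \<le> max 0 K" by (simp add: le_max_iff_disj)
  then show thesis using that [of "max 0 K"] by simp
qed

text \<open>
  Sharpens the Fredholm alternative when there is a homogeneous solution \<open>e\<close>. Let \<open>Y\<close> and \<open>E\<close> be the solutions of the initial
  value problem, with slope zero, for the right-hand sides \<open>f\<close> and \<open>e\<close>. By symmetry the range is
  orthogonal to \<open>e\<close>, so \<open>E\<close> cannot vanish at \<open>l\<close>. A combination \<open>Y - c E\<close> vanishes at \<open>l\<close> and
  solves the problem for \<open>f - c e\<close>; orthogonality to \<open>e\<close> then forces \<open>c = 0\<close>.
\<close>

lemma schroedinger_alternative:
  assumes l: "0 < l" and q: "continuous_on {0..l} q"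
  obtains (eigenfunction) e C where "(e, \<lambda>x. 0) \<in> schroedinger_op l q"
      "\<not> (AE x in interval_measure l. e x = 0)" "0 \<le> C"
      "\<And>f. f \<in> L2 l \<Longrightarrow> ip l f e = 0 \<Longrightarrow> \<exists>w. (w, f) \<in> schroedinger_op l q \<and> L2_norm l w \<le> C * L2_norm l f"
  | (solvable) C where "0 \<le> C"
      "\<And>f. f \<in> L2 l \<Longrightarrow> \<exists>w. (w, f) \<in> schroedinger_op l q \<and> L2_norm l w \<le> C * L2_norm l f"
proof -
  obtain K where K: "0 \<le> K" "\<And>x. x \<in> {0..l} \<Longrightarrow> \<bar>q x\<bar> \<le> K"
    using continuous_real_bound [OF q] by blast
  interpret linear_ode l K "\<lambda>t y. - (complex_of_real (q t) * y)"
  proof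
    show "norm (- (complex_of_real (q t) * y)) \<le> K * norm y" if "t \<in> {0..l}" for t y
      using K(2) [OF that] by (simp add: norm_mult mult_right_mono)
    show "continuous_on {0..l} (\<lambda>t. - (complex_of_real (q t) * Y t))" if "continuous_on {0..l} Y" for Y
      using q that by (intro continuous_intros)
  qed (use l K in \<open>auto intro!: linearI simp: algebra_simps\<close>)
  have dom: "(Y, f) \<in> schroedinger_op l q" if f: "f \<in> L2 l"
    and Y: "solution (\<lambda>x. x *\<^sub>R \<alpha> + integral {0..x} (\<lambda>t. (x - t) *\<^sub>R - f t)) Y" and "Y l = 0" for f \<alpha> Y
  proof -
    have cY: "continuous_on {0..l} Y" using Y by (simp add: solution_def)
    have L: "(\<lambda>t. - (complex_of_real (q t) * Y t) + - f t) \<in> L2 l"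
      using f q by (intro L2_add L2_uminus L2_mult_continuous L2_continuous [OF cY] continuous_intros)
    show ?thesis
    proof (rule classical_dirichlet_solution [where u = Y and \<alpha> = \<alpha>, OF l L f _ \<open>Y l = 0\<close>])
      fix x assume "x \<in> {0..l}"
      from solution_integral_form(1) [OF _ Y this] L2_integrable [OF L2_uminus [OF f]]
      show "Y x = \<alpha> * of_real x + integral {0..x} (\<lambda>t. of_real (x - t) * (- (complex_of_real (q t) * Y t) + - f t))"
        by (simp add: scaleR_conv_of_real mult.commute)
    qed simp
  qed
  show thesis
  proof (cases rule: fredholm_alternative)
    case (solvable C)
    show thesis
    proof (rule that(2))
      show "0 \<le> C * l" using solvable l by simp
      fix f :: "real \<Rightarrow> complex" assume f: "f \<in> L2 l"
      then obtain \<alpha> Y where Y: "bvp_solution (\<lambda>t. - f t) \<alpha> Y"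
        "\<forall>x\<in>{0..l}. norm (Y x) \<le> C * (LINT x|interval_measure l. norm (- f x))"
        using solvable(2) [OF L2_integrable [OF L2_uminus [OF f]]] by blast
      have "(Y, f) \<in> schroedinger_op l q"
        using Y(1) by (intro dom f) (auto simp: bvp_solution_def)
      moreover have "L2_norm l Y \<le> C * l * L2_norm l f"
        using Y solvable by (intro L2_norm_le_sup l f L2_continuous bvp_solution_continuous [OF Y(1)]) auto
      ultimately show "\<exists>w. (w, f) \<in> schroedinger_op l q \<and> L2_norm l w \<le> C * l * L2_norm l f" by blast
    qed
  next
    case (homogeneous \<alpha> e)
    have e: "(e, \<lambda>x. 0) \<in> schroedinger_op l q"
      using homogeneous(1) by (intro dom [of _ \<alpha>]) (auto simp: bvp_solution_def)
    note eL = schroedinger_L2(1) [OF e]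
    define C0 where "C0 = 2 * exp (rate * l) * l"
    have C0: "0 \<le> C0" using l by (simp add: C0_def)
    have shoot: "\<exists>Y. solution (\<lambda>x. x *\<^sub>R 0 + integral {0..x} (\<lambda>t. (x - t) *\<^sub>R - f t)) Y \<and>
        (\<forall>x\<in>{0..l}. norm (Y x) \<le> C0 * (LINT x|interval_measure l. norm (f x)))" if f: "f \<in> L2 l" for f
    proof -
      note i = L2_integrable [OF L2_uminus [OF f]]
      obtain Y where Y: "solution (\<lambda>x. x *\<^sub>R 0 + integral {0..x} (\<lambda>t. (x - t) *\<^sub>R - f t)) Y"
        using cauchy_problem [OF i, of 0] by blast
      show ?thesis
        using Y cauchy_bound [OF i Y] by (intro exI [of _ Y]) (auto simp: C0_def mult.assoc)
    qed
    have orth: "ip l f e = 0" if "(w, f) \<in> schroedinger_op l q" for w f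
      using schroedinger_symmetric [OF l q that e] by simp
    obtain E where E: "solution (\<lambda>x. x *\<^sub>R 0 + integral {0..x} (\<lambda>t. (x - t) *\<^sub>R - e t)) E"
      using shoot [OF eL] by blast
    have "ip l e e \<noteq> 0" using ip_self_eq_0 [OF eL] homogeneous(2) by blast
    then have El: "E l \<noteq> 0" using orth [of E e] dom [OF eL E] by blast
    show thesis
    proof (rule that(1) [OF e homogeneous(2)])
      show "0 \<le> C0 * l" using C0 l by simp
      fix f :: "real \<Rightarrow> complex" assume f: "f \<in> L2 l" and perp: "ip l f e = 0"
      obtain Y where Y: "solution (\<lambda>x. x *\<^sub>R 0 + integral {0..x} (\<lambda>t. (x - t) *\<^sub>R - f t)) Y"
        "\<And>x. x\<in>{0..l} \<Longrightarrow> norm (Y x) \<le> C0 * (LINT x|interval_measure l. norm (f x))"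
        using shoot [OF f] by blast
      define c where "c = Y l / E l"
      have cont: "continuous_on {0..l} Y" "continuous_on {0..l} E" using Y E by (auto simp: solution_def)
      have fe: "(\<lambda>x. f x - c * e x) \<in> L2 l" by (intro L2_diff L2_cmult f eL)
      have "solution (\<lambda>x. x *\<^sub>R 0 + integral {0..x} (\<lambda>t. (x - t) *\<^sub>R - (f t - c * e t))) (\<lambda>x. Y x - c * E x)"
        unfolding solution_def
      proof (intro conjI ballI continuous_intros cont)
        fix x assume x: "x \<in> {0..l}"
        have Yx: "((\<lambda>t. (x - t) *\<^sub>R (- (complex_of_real (q t) * Y t) + - f t)) has_integral Y x) {0..x}"
          using solution_integral_form [OF L2_integrable [OF L2_uminus [OF f]] Y(1) x]
          by (simp add: has_integral_integral)
        have Ex: "((\<lambda>t. (x - t) *\<^sub>R (- (complex_of_real (q t) * E t) + - e t)) has_integral E x) {0..x}"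
          using solution_integral_form [OF L2_integrable [OF L2_uminus [OF eL]] E x]
          by (simp add: has_integral_integral)
        have "((\<lambda>t. (x - t) *\<^sub>R (- (complex_of_real (q t) * (Y t - c * E t)) + - (f t - c * e t))) has_integral (Y x - c * E x)) {0..x}"
          using has_integral_diff [OF Yx has_integral_mult_right [OF Ex, of c]]
          by (rule has_integral_eq [rotated]) (simp add: scaleR_conv_of_real algebra_simps)
        moreover have "((\<lambda>t. (x - t) *\<^sub>R - (f t - c * e t)) has_integral integral {0..x} (\<lambda>t. (x - t) *\<^sub>R - (f t - c * e t))) {0..x}"
          using kernel_integrable(3) [OF integrable_interval_absolutely [OF L2_integrable [OF L2_uminus [OF fe]]] x]
          by (simp only: set_lebesgue_integral_eq_integral integrable_integral)
        ultimately have "((\<lambda>t. (x - t) *\<^sub>R - (complex_of_real (q t) * (Y t - c * E t))) has_integral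
            ((Y x - c * E x) - integral {0..x} (\<lambda>t. (x - t) *\<^sub>R - (f t - c * e t)))) {0..x}"
          by (rule has_integral_eq [rotated, OF has_integral_diff]) (simp add: scaleR_diff_right)
        then have I: "integral {0..x} (\<lambda>t. (x - t) *\<^sub>R - (complex_of_real (q t) * (Y t - c * E t)))
            = (Y x - c * E x) - integral {0..x} (\<lambda>t. (x - t) *\<^sub>R - (f t - c * e t))"
          by (rule integral_unique)
        show "Y x - c * E x = x *\<^sub>R 0 + integral {0..x} (\<lambda>t. (x - t) *\<^sub>R - (f t - c * e t))
            + integral {0..x} (\<lambda>t. (x - t) *\<^sub>R - (complex_of_real (q t) * (Y t - c * E t)))"
          unfolding I by simp
      qed
      then have "(\<lambda>x. Y x - c * E x, \<lambda>x. f x - c * e x) \<in> schroedinger_op l q"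
        by (rule dom [OF fe]) (use El in \<open>simp add: c_def\<close>)
      from orth [OF this] have "c * ip l e e = 0"
        using perp f eL by (simp add: ip_diff_left L2_cmult ip_cmult_left)
      then have "Y l = 0" using \<open>ip l e e \<noteq> 0\<close> El by (simp add: c_def)
      then have "(Y, f) \<in> schroedinger_op l q" by (rule dom [OF f Y(1)])
      moreover have "L2_norm l Y \<le> C0 * l * L2_norm l f"
        using Y C0 by (intro L2_norm_le_sup l f L2_continuous cont) auto
      ultimately show "\<exists>w. (w, f) \<in> schroedinger_op l q \<and> L2_norm l w \<le> C0 * l * L2_norm l f" by blast
    qed
  qed
qed

text \<open>
  The coupled problem \<open>L\<^sub>g u - \<gamma> v = f\<close>, \<open>L\<^sub>h v - \<delta> u = k\<close>. Two choices of the coupling constants are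
  used: \<open>\<gamma> = \<mu>\<close>, \<open>\<delta> = - \<mu>\<close> gives \<open>N - \<mu>\<close>, and \<open>\<gamma> = - \<kappa>\<close>, \<open>\<delta> = 1\<close> gives \<open>L\<^sub>g + \<kappa> L\<^sub>h\<^sup>-\<^sup>1\<close> on the
  complement of the kernel of \<open>L\<^sub>h\<close>.
\<close>

lemma system_alternative:
  assumes l: "0 < l" and g: "continuous_on {0..l} g" and h: "continuous_on {0..l} h"
  obtains (homogeneous) u v where "(u, \<lambda>x. \<gamma> * v x) \<in> schroedinger_op l g"
      "(v, \<lambda>x. \<delta> * u x) \<in> schroedinger_op l h" "\<not> (AE x in interval_measure l. u x = 0 \<and> v x = 0)"
  | (solvable) C where "0 \<le> C"
      "\<And>f k. f \<in> L2 l \<Longrightarrow> k \<in> L2 l \<Longrightarrow> \<exists>u v. (u, \<lambda>x. f x + \<gamma> * v x) \<in> schroedinger_op l g \<and>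
        (v, \<lambda>x. k x + \<delta> * u x) \<in> schroedinger_op l h \<and>
        L2_norm l u \<le> C * L2_norm l (\<lambda>x. (f x, k x)) \<and> L2_norm l v \<le> C * L2_norm l (\<lambda>x. (f x, k x))"
proof -
  obtain Kg where Kg: "0 \<le> Kg" "\<And>x. x \<in> {0..l} \<Longrightarrow> \<bar>g x\<bar> \<le> Kg"
    using continuous_real_bound [OF g] by blast
  obtain Kh where Kh: "0 \<le> Kh" "\<And>x. x \<in> {0..l} \<Longrightarrow> \<bar>h x\<bar> \<le> Kh"
    using continuous_real_bound [OF h] by blast
  have pr: "norm (fst y) \<le> norm y" "norm (snd y) \<le> norm y" for y :: "complex \<times> complex"
    by (simp_all add: norm_prod_def)
  \<comment> \<open>the second derivative of a solution \<open>(u, v)\<close> is \<open>B (u, v) - (f, k)\<close>\<close>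
  define B where "B = (\<lambda>t (y :: complex \<times> complex).
      (- (complex_of_real (g t) * fst y) - \<gamma> * snd y, - (complex_of_real (h t) * snd y) - \<delta> * fst y))"
  interpret linear_ode l "Kg + norm \<gamma> + Kh + norm \<delta>" B
  proof (rule linear_ode.intro)
    show "linear (B t)" for t
      by (rule linearI) (auto simp: B_def algebra_simps scaleR_conv_of_real)
    show "norm (B t y) \<le> (Kg + norm \<gamma> + Kh + norm \<delta>) * norm y" if t: "t \<in> {0..l}" for t y
    proof -
      have "norm (B t y) \<le> norm (fst (B t y)) + norm (snd (B t y))"
        using norm_Pair_le [of "fst (B t y)" "snd (B t y)"] by simp
      also have "\<dots> \<le> (norm (complex_of_real (g t) * fst y) + norm (\<gamma> * snd y))
          + (norm (complex_of_real (h t) * snd y) + norm (\<delta> * fst y))"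
        unfolding B_def by (simp only: fst_conv snd_conv)
          (intro add_mono order_trans [OF norm_triangle_ineq4], simp_all)
      also have "\<dots> \<le> (Kg * norm y + norm \<gamma> * norm y) + (Kh * norm y + norm \<delta> * norm y)"
        unfolding norm_mult using Kg(2) [OF t] Kh(2) [OF t] Kg(1) Kh(1)
        by (intro add_mono mult_mono pr) auto
      finally show ?thesis by (simp add: distrib_right)
    qed
    show "continuous_on {0..l} (\<lambda>t. B t (Y t))" if "continuous_on {0..l} Y" for Y
      unfolding B_def using g h that by (intro continuous_intros)
  qed (use l Kg Kh in auto)
  have dom: "(\<lambda>x. fst (Y x), \<lambda>x. f x + \<gamma> * snd (Y x)) \<in> schroedinger_op l g \<and>
      (\<lambda>x. snd (Y x), \<lambda>x. k x + \<delta> * fst (Y x)) \<in> schroedinger_op l h"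
    if f: "f \<in> L2 l" and k: "k \<in> L2 l" and Y: "bvp_solution (\<lambda>t. (- f t, - k t)) \<alpha> Y" for f k \<alpha> Y
  proof -
    have cY: "continuous_on {0..l} Y" by (rule bvp_solution_continuous [OF Y])
    have fk: "(\<lambda>t. (- f t, - k t)) \<in> L2 l" using f k by (simp add: L2_pair L2_uminus)
    have YL: "(\<lambda>x. fst (Y x)) \<in> L2 l" "(\<lambda>x. snd (Y x)) \<in> L2 l"
      by (intro L2_continuous continuous_intros cY)+
    have L: "(\<lambda>t. fst (B t (Y t)) + - f t) \<in> L2 l" "(\<lambda>t. snd (B t (Y t)) + - k t) \<in> L2 l"
      by (intro L2_add L2_uminus f k L2_continuous continuous_intros continuous_B cY)+
    have L': "(\<lambda>x. f x + \<gamma> * snd (Y x)) \<in> L2 l" "(\<lambda>x. k x + \<delta> * fst (Y x)) \<in> L2 l"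
      by (intro L2_add L2_cmult f k YL)+
    have Yl: "fst (Y l) = 0" "snd (Y l) = 0" using Y by (auto simp: bvp_solution_def)
    have form: "fst (Y x) = fst \<alpha> * of_real x + integral {0..x} (\<lambda>t. of_real (x - t) * (fst (B t (Y t)) + - f t))"
       "snd (Y x) = snd \<alpha> * of_real x + integral {0..x} (\<lambda>t. of_real (x - t) * (snd (B t (Y t)) + - k t))"
      if x: "x \<in> {0..l}" for x
    proof -
      have S: "solution (\<lambda>x. x *\<^sub>R \<alpha> + integral {0..x} (\<lambda>t. (x - t) *\<^sub>R (- f t, - k t))) Y"
        using Y by (simp add: bvp_solution_def)
      note sif = solution_integral_form [OF L1_le_L2_norm(1) [OF l fk] S x]
      have "fst (integral {0..x} (\<lambda>t. (x - t) *\<^sub>R (B t (Y t) + (- f t, - k t))))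
          = integral {0..x} (\<lambda>t. of_real (x - t) * (fst (B t (Y t)) + - f t))"
        using integral_linear [OF sif(2) bounded_linear_fst] by (simp add: o_def scaleR_conv_of_real)
      moreover have "snd (integral {0..x} (\<lambda>t. (x - t) *\<^sub>R (B t (Y t) + (- f t, - k t))))
          = integral {0..x} (\<lambda>t. of_real (x - t) * (snd (B t (Y t)) + - k t))"
        using integral_linear [OF sif(2) bounded_linear_snd] by (simp add: o_def scaleR_conv_of_real)
      ultimately show "fst (Y x) = fst \<alpha> * of_real x + integral {0..x} (\<lambda>t. of_real (x - t) * (fst (B t (Y t)) + - f t))"
       "snd (Y x) = snd \<alpha> * of_real x + integral {0..x} (\<lambda>t. of_real (x - t) * (snd (B t (Y t)) + - k t))"
        using sif(1) by (simp_all add: scaleR_conv_of_real mult.commute)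
    qed
    show ?thesis
    proof (intro conjI)
      show "(\<lambda>x. fst (Y x), \<lambda>x. f x + \<gamma> * snd (Y x)) \<in> schroedinger_op l g"
        by (rule classical_dirichlet_solution [where u = "\<lambda>x. fst (Y x)" and \<alpha> = "fst \<alpha>", OF l L(1) L'(1) form(1) Yl(1)]) (auto simp: B_def)
      show "(\<lambda>x. snd (Y x), \<lambda>x. k x + \<delta> * fst (Y x)) \<in> schroedinger_op l h"
        by (rule classical_dirichlet_solution [where u = "\<lambda>x. snd (Y x)" and \<alpha> = "snd \<alpha>", OF l L(2) L'(2) form(2) Yl(2)]) (auto simp: B_def)
    qed
  qed
  show thesis
  proof (cases rule: fredholm_alternative)
    case (homogeneous \<alpha> Y)
    have "bvp_solution (\<lambda>t. (- 0, - 0)) \<alpha> Y" using homogeneous(1) by (simp add: zero_prod_def)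
    from dom [OF L2_zero L2_zero this] show thesis
      using homogeneous(2) by (intro that(1)) (auto simp: prod_eq_iff)
  next
    case (solvable C)
    show thesis
    proof (rule that(2))
      show "0 \<le> C * l" using solvable l by simp
      fix f k :: "real \<Rightarrow> complex" assume f: "f \<in> L2 l" and k: "k \<in> L2 l"
      have fk: "(\<lambda>t. (- f t, - k t)) \<in> L2 l" "(\<lambda>t. (f t, k t)) \<in> L2 l" using f k by (simp_all add: L2_pair L2_uminus)
      obtain \<alpha> Y where Y: "bvp_solution (\<lambda>t. (- f t, - k t)) \<alpha> Y"
        "\<And>x. x\<in>{0..l} \<Longrightarrow> norm (Y x) \<le> C * (LINT x|interval_measure l. norm (- f x, - k x))"
        using solvable(2) [OF L1_le_L2_norm(1) [OF l fk(1)]] by blast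
      have nn: "norm (- f x, - k x) = norm (f x, k x)" for x by (simp add: norm_prod_def)
      have cY: "continuous_on {0..l} Y" by (rule bvp_solution_continuous [OF Y(1)])
      have bds: "norm (fst (Y x)) \<le> C * (LINT x|interval_measure l. norm (f x, k x))"
        "norm (snd (Y x)) \<le> C * (LINT x|interval_measure l. norm (f x, k x))" if "x \<in> {0..l}" for x
        using Y(2) [OF that] pr [of "Y x"] unfolding nn by linarith+
      have "L2_norm l (\<lambda>x. fst (Y x)) \<le> C * l * L2_norm l (\<lambda>x. (f x, k x))"
        "L2_norm l (\<lambda>x. snd (Y x)) \<le> C * l * L2_norm l (\<lambda>x. (f x, k x))"
        using bds solvable by (intro L2_norm_le_sup l fk L2_continuous continuous_intros cY; simp)+
      with dom [OF f k Y(1)] show "\<exists>u v. (u, \<lambda>x. f x + \<gamma> * v x) \<in> schroedinger_op l g \<and>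
        (v, \<lambda>x. k x + \<delta> * u x) \<in> schroedinger_op l h \<and>
        L2_norm l u \<le> C * l * L2_norm l (\<lambda>x. (f x, k x)) \<and> L2_norm l v \<le> C * l * L2_norm l (\<lambda>x. (f x, k x))"
        by (intro exI [of _ "\<lambda>x. fst (Y x)"] exI [of _ "\<lambda>x. snd (Y x)"]) auto
    qed
  qed
qed

section \<open>Nonnegative quadratic forms\<close>

text \<open>
  If nonnegativity of \<open>A + \<kappa> B\<close> is an open condition in \<open>\<kappa> > 0\<close> then, being also closed, it
  descends from large \<open>\<kappa>\<close> to \<open>\<kappa> = 0\<close>. Applied to quadratic forms of operators, this is the fact
  that the infimum of the numerical range of a self-adjoint operator lies in its spectrum.
\<close>

lemma form_descent:
  fixes A B :: "'p \<Rightarrow> real"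
  assumes B: "\<And>p. p \<in> X \<Longrightarrow> 0 \<le> B p" and "0 \<le> \<mu>" and start: "\<And>p. p \<in> X \<Longrightarrow> 0 \<le> A p + \<mu> * B p"
    and step: "\<And>\<kappa>. 0 < \<kappa> \<Longrightarrow> (\<And>p. p \<in> X \<Longrightarrow> 0 \<le> A p + \<kappa> * B p) \<Longrightarrow>
      \<exists>\<epsilon>>0. \<forall>p\<in>X. 0 \<le> A p + (\<kappa> - \<epsilon>) * B p"
    and p: "p \<in> X"
  shows "0 \<le> A p"
proof -
  define S where "S = {\<kappa>. 0 \<le> \<kappa> \<and> (\<forall>p\<in>X. 0 \<le> A p + \<kappa> * B p)}"
  have S: "\<mu> \<in> S" "bdd_below S" using start \<open>0 \<le> \<mu>\<close> by (auto simp: S_def)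
  define m where "m = Inf S"
  have m0: "0 \<le> m" unfolding m_def using S by (intro cInf_greatest) (auto simp: S_def)
  have lower: "m \<le> \<kappa>" if "\<kappa> \<in> S" for \<kappa> unfolding m_def using S that by (intro cInf_lower)
  have m: "0 \<le> A p + m * B p" if p: "p \<in> X" for p
  proof (cases "B p = 0")
    case True
    then show ?thesis using start [OF p] by simp
  next
    case False
    then have pos: "0 < B p" using B [OF p] by simp
    have "- A p / B p \<le> m"
      unfolding m_def
    proof (rule cInf_greatest)
      show "S \<noteq> {}" using S by blast
      fix \<kappa> assume "\<kappa> \<in> S"
      then have "0 \<le> A p + \<kappa> * B p" using p by (simp add: S_def)
      then show "- A p / B p \<le> \<kappa>" using pos by (simp add: field_simps)
    qed
    then show ?thesis using pos by (simp add: field_simps)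
  qed
  have "m = 0"
  proof (rule ccontr)
    assume "m \<noteq> 0"
    then have "0 < m" using m0 by simp
    then obtain \<epsilon> where \<epsilon>: "0 < \<epsilon>" "\<And>p. p \<in> X \<Longrightarrow> 0 \<le> A p + (m - \<epsilon>) * B p"
      using step [of m] m by blast
    have "max 0 (m - \<epsilon>) \<in> S"
      unfolding S_def
    proof (intro CollectI conjI ballI)
      fix p assume p: "p \<in> X"
      have "(m - \<epsilon>) * B p \<le> max 0 (m - \<epsilon>) * B p" using B [OF p] by (intro mult_right_mono) auto
      then show "0 \<le> A p + max 0 (m - \<epsilon>) * B p" using \<epsilon>(2) [OF p] by linarith
    qed simp
    then show False using lower \<epsilon>(1) \<open>0 < m\<close> by fastforce
  qed
  then show ?thesis using m [OF p] by simp
qed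

text \<open>
  The quadratic polynomial \<open>Q - 2 t n + t\<^sup>2 r\<close> at \<open>t = 1 / (C + 1)\<close>. In the applications it is the form of an
  operator at \<open>u - t w\<close>, where \<open>w\<close> is the preimage of \<open>u\<close> and \<open>C\<close> bounds the inverse.
\<close>

lemma quadratic_gain:
  fixes Q n r C :: real
  assumes "0 \<le> C" "r \<le> C * n" "0 \<le> n" "0 \<le> Q - 2 * (1 / (C + 1)) * n + (1 / (C + 1))\<^sup>2 * r"
  shows "n / (C + 1) \<le> Q"
proof -
  have C: "0 < C + 1" using assms(1) by simp
  have "(1 / (C + 1))\<^sup>2 * r \<le> (1 / (C + 1))\<^sup>2 * ((C + 1) * n)"
    using assms by (intro mult_left_mono) (auto simp: distrib_right)
  also have "\<dots> = n / (C + 1)" using C by (simp add: power2_eq_square)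
  finally show ?thesis using assms(4) by simp
qed

text \<open>
  Let \<open>w\<close> be the preimage of \<open>u\<close>. In the form at \<open>u - t w\<close> the linear term is \<open>- 2 t \<parallel>u\<parallel>\<^sup>2\<close> by symmetry, and
  the quadratic term is at most \<open>t\<^sup>2 C \<parallel>u\<parallel>\<^sup>2\<close>; the form remains nonnegative for \<open>t = 1 / (C + 1)\<close>.
\<close>

lemma form_coercive:
  assumes l: "0 < l" and q: "continuous_on {0..l} q"
    and nonneg: "\<And>u b. (u, b) \<in> schroedinger_op l q \<Longrightarrow> ip l u e = 0 \<Longrightarrow> 0 \<le> Re (ip l b u)"
    and solv: "\<And>f. f \<in> L2 l \<Longrightarrow> ip l f e = 0 \<Longrightarrow>
      \<exists>w. (w, f) \<in> schroedinger_op l q \<and> ip l w e = 0 \<and> L2_norm l w \<le> C * L2_norm l f"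
    and "0 \<le> C" and e: "e \<in> L2 l"
    and u: "(u, b) \<in> schroedinger_op l q" "ip l u e = 0"
  shows "(L2_norm l u)\<^sup>2 / (C + 1) \<le> Re (ip l b u)"
proof -
  note L = schroedinger_L2 [OF u(1)]
  obtain w where w: "(w, u) \<in> schroedinger_op l q" "ip l w e = 0" "L2_norm l w \<le> C * L2_norm l u"
    using solv [OF L(1) u(2)] by blast
  note wL = schroedinger_L2(1) [OF w(1)]
  define t where "t = complex_of_real (1 / (C + 1))"
  have "Re (ip l u w) \<le> L2_norm l u * L2_norm l w"
    using ip_Cauchy_Schwarz [OF L(1) wL] complex_Re_le_cmod order_trans by blast
  also have "\<dots> \<le> L2_norm l u * (C * L2_norm l u)" using w(3) by (intro mult_left_mono) auto
  finally have uw: "Re (ip l u w) \<le> C * (L2_norm l u)\<^sup>2" by (simp add: power2_eq_square mult_ac)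
  have "(\<lambda>x. 1 * u x + (- t) * w x, \<lambda>x. 1 * b x + (- t) * u x) \<in> schroedinger_op l q"
    by (rule schroedinger_lincomb [OF l u(1) w(1)])
  then have "0 \<le> Re (ip l (\<lambda>x. 1 * b x + (- t) * u x) (\<lambda>x. 1 * u x + (- t) * w x))"
    by (rule nonneg) (use L wL e u(2) w(2) in \<open>simp only: ip_add_left ip_cmult_left L2_cmult, simp\<close>)
  also have "ip l (\<lambda>x. 1 * b x + (- t) * u x) (\<lambda>x. 1 * u x + (- t) * w x)
      = ip l b u - t * ip l u u - t * ip l b w + t * t * ip l u w"
    using L wL by (simp only: ip_add_left ip_add_right ip_cmult_left ip_cmult_right L2_add L2_cmult)
      (simp add: t_def algebra_simps)
  also have "ip l b w = ip l u u"
    by (rule schroedinger_symmetric [OF l q u(1) w(1)])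
  also have "Re (ip l b u - t * ip l u u - t * ip l u u + t * t * ip l u w)
      = Re (ip l b u) - 2 * (1 / (C + 1)) * (L2_norm l u)\<^sup>2 + (1 / (C + 1))\<^sup>2 * Re (ip l u w)"
    by (simp add: t_def ip_self power2_eq_square)
  finally show ?thesis
    by (rule quadratic_gain [OF \<open>0 \<le> C\<close> uw zero_le_power2])
qed

lemma schroedinger_shift:
  assumes l: "0 < l" and q: "continuous_on {0..l} q"
  shows "(u, a) \<in> schroedinger_op l q \<Longrightarrow>
      (u, \<lambda>x. a x + complex_of_real \<sigma> * u x) \<in> schroedinger_op l (\<lambda>x. q x - \<sigma>)"
    and "(u, a) \<in> schroedinger_op l (\<lambda>x. q x - \<sigma>) \<Longrightarrow>
      (u, \<lambda>x. a x - complex_of_real \<sigma> * u x) \<in> schroedinger_op l q"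
  using schroedinger_change_potential [OF l, of u a q "\<lambda>x. q x - \<sigma>"]
    schroedinger_change_potential [OF l, of u a "\<lambda>x. q x - \<sigma>" q] q
  by (simp_all add: continuous_on_diff)

lemma project_off:
  assumes e: "e \<in> L2 l" and ne: "\<not> (AE x in interval_measure l. e x = 0)" and w: "w \<in> L2 l"
  defines "d \<equiv> ip l w e / ip l e e"
  shows "ip l (\<lambda>x. w x - d * e x) e = 0" "L2_norm l (\<lambda>x. w x - d * e x) \<le> 2 * L2_norm l w"
proof -
  have ee: "ip l e e \<noteq> 0" using ip_self_eq_0 [OF e] ne by blast
  then have en: "0 < L2_norm l e" by (simp add: ip_self less_le)
  show "ip l (\<lambda>x. w x - d * e x) e = 0"
  proof -
    have "ip l (\<lambda>x. w x - d * e x) e = ip l w e - d * ip l e e"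
      unfolding d_def using e w by (simp only: ip_diff_left L2_cmult ip_cmult_left)
    then show ?thesis using ee by (simp add: d_def)
  qed
  have "L2_norm l (\<lambda>x. w x + (- d) * e x) \<le> L2_norm l w + L2_norm l (\<lambda>x. (- d) * e x)"
    by (intro L2_norm_triangle w L2_cmult e)
  also have "L2_norm l (\<lambda>x. (- d) * e x) = cmod (ip l w e) / L2_norm l e"
    using en unfolding L2_norm_cmult d_def by (simp add: ip_self norm_divide norm_mult norm_power power2_eq_square)
  also have "\<dots> \<le> L2_norm l w"
    using en ip_Cauchy_Schwarz [OF w e] by (simp add: divide_le_eq)
  finally show "L2_norm l (\<lambda>x. w x - d * e x) \<le> 2 * L2_norm l w" by simp
qed

text \<open>
  On the complement of the eigenfunction, \<open>L + \<sigma>\<close> has a bounded inverse for every \<open>\<sigma> \<ge> 0\<close>, including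
  \<open>\<sigma> = \<tau>\<close>, where the range is the whole complement. So nonnegativity descends from large \<open>\<sigma>\<close> to \<open>\<sigma> = 0\<close>, and bounded invertibility at
  \<open>\<sigma> = 0\<close> improves it to coercivity. It is applied to \<open>L\<^sub>+\<close> with \<open>\<tau> > 0\<close> and to \<open>L\<^sub>-\<close> with
  \<open>\<tau> = 0\<close>.
\<close>

lemma schroedinger_positive_on_complement:
  assumes l: "0 < l" and q: "continuous_on {0..l} q" and "0 \<le> \<tau>"
    and e0: "(e0, \<lambda>x. - (complex_of_real \<tau> * e0 x)) \<in> schroedinger_op l q"
      "\<not> (AE x in interval_measure l. e0 x = 0)"
    and only: "\<And>\<sigma> e. 0 \<le> \<sigma> \<Longrightarrow> (e, \<lambda>x. - (complex_of_real \<sigma> * e x)) \<in> schroedinger_op l q \<Longrightarrow>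
      \<not> (AE x in interval_measure l. e x = 0) \<Longrightarrow> \<sigma> = \<tau>"
  obtains e c where "(e, \<lambda>x. - (complex_of_real \<tau> * e x)) \<in> schroedinger_op l q"
    "\<not> (AE x in interval_measure l. e x = 0)" "0 < c"
    "\<And>u a. (u, a) \<in> schroedinger_op l q \<Longrightarrow> ip l u e = 0 \<Longrightarrow> c * (L2_norm l u)\<^sup>2 \<le> Re (ip l a u)"
    "\<And>f. f \<in> L2 l \<Longrightarrow> ip l f e = 0 \<Longrightarrow> \<exists>w. (w, \<lambda>x. f x - complex_of_real \<tau> * w x) \<in> schroedinger_op l q"
proof -
  have cq: "continuous_on {0..l} (\<lambda>x. q x - \<sigma>)" for \<sigma> using q by (intro continuous_intros)
  have eL0: "e0 \<in> L2 l" by (rule schroedinger_L2 [OF e0(1)])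
  have e0': "(e0, \<lambda>x. 0) \<in> schroedinger_op l (\<lambda>x. q x - \<tau>)"
    using schroedinger_shift(1) [OF l q e0(1), of \<tau>] by simp
  obtain e C1 where e: "(e, \<lambda>x. 0) \<in> schroedinger_op l (\<lambda>x. q x - \<tau>)"
      "\<not> (AE x in interval_measure l. e x = 0)" "0 \<le> C1"
    and C1: "\<And>f. f \<in> L2 l \<Longrightarrow> ip l f e = 0 \<Longrightarrow>
      \<exists>w. (w, f) \<in> schroedinger_op l (\<lambda>x. q x - \<tau>) \<and> L2_norm l w \<le> C1 * L2_norm l f"
  proof (rule schroedinger_alternative [OF l cq [of \<tau>]])
    fix C assume "\<And>f. f \<in> L2 l \<Longrightarrow>
      \<exists>w. (w, f) \<in> schroedinger_op l (\<lambda>x. q x - \<tau>) \<and> L2_norm l w \<le> C * L2_norm l f"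
    then obtain w where "(w, e0) \<in> schroedinger_op l (\<lambda>x. q x - \<tau>)" using eL0 by blast
    from schroedinger_symmetric [OF l cq this e0'] have "ip l e0 e0 = 0" by simp
    then show thesis using ip_self_eq_0 [OF eL0] e0(2) by blast
  qed (rule that)
  have eL: "e \<in> L2 l" by (rule schroedinger_L2 [OF e(1)])
  have eq: "(e, \<lambda>x. - (complex_of_real \<tau> * e x)) \<in> schroedinger_op l q"
    using schroedinger_shift(2) [OF l q e(1)] by simp
  have resolvent: "\<exists>C\<ge>0. \<forall>f. f \<in> L2 l \<longrightarrow> ip l f e = 0 \<longrightarrow>
      (\<exists>w. (w, f) \<in> schroedinger_op l (\<lambda>x. q x - \<sigma>) \<and> ip l w e = 0 \<and> L2_norm l w \<le> C * L2_norm l f)"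
    if "0 \<le> \<sigma>" for \<sigma>
  proof (cases "\<sigma> = \<tau>")
    case True
    show ?thesis
    proof (intro exI [of _ "2 * C1"] conjI allI impI)
      show "0 \<le> 2 * C1" using e(3) by simp
      fix f assume "f \<in> L2 l" "ip l f e = 0"
      then obtain w where w: "(w, f) \<in> schroedinger_op l (\<lambda>x. q x - \<sigma>)" "L2_norm l w \<le> C1 * L2_norm l f"
        using C1 True by blast
      define d where "d = ip l w e / ip l e e"
      note pr = project_off [OF eL e(2) schroedinger_L2(1) [OF w(1)], folded d_def]
      have "(\<lambda>x. 1 * w x + (- d) * e x, \<lambda>x. 1 * f x + (- d) * 0) \<in> schroedinger_op l (\<lambda>x. q x - \<sigma>)"
        using schroedinger_lincomb [OF l w(1) e(1) [folded True]] .
      then have "(\<lambda>x. w x - d * e x, f) \<in> schroedinger_op l (\<lambda>x. q x - \<sigma>)" by simp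
      moreover have "L2_norm l (\<lambda>x. w x - d * e x) \<le> 2 * C1 * L2_norm l f" using pr(2) w(2) by simp
      ultimately show "\<exists>w. (w, f) \<in> schroedinger_op l (\<lambda>x. q x - \<sigma>) \<and> ip l w e = 0 \<and>
          L2_norm l w \<le> 2 * C1 * L2_norm l f"
        using pr(1) by blast
    qed
  next
    case False
    show ?thesis
    proof (rule schroedinger_alternative [OF l cq [of \<sigma>]])
      fix e' assume "(e', \<lambda>x. 0) \<in> schroedinger_op l (\<lambda>x. q x - \<sigma>)"
        "\<not> (AE x in interval_measure l. e' x = 0)"
      then show ?thesis
        using only [OF that, of e'] schroedinger_shift(2) [OF l q, of e' "\<lambda>x. 0" \<sigma>] False by simp
    next
      fix C assume solvable: "0 \<le> C" "\<And>f. f \<in> L2 l \<Longrightarrow>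
        \<exists>w. (w, f) \<in> schroedinger_op l (\<lambda>x. q x - \<sigma>) \<and> L2_norm l w \<le> C * L2_norm l f"
      have eS: "(e, \<lambda>x. complex_of_real (\<sigma> - \<tau>) * e x) \<in> schroedinger_op l (\<lambda>x. q x - \<sigma>)"
        using schroedinger_shift(1) [OF l q eq, of \<sigma>] by (simp add: algebra_simps)
      have "ip l w e = 0" if "(w, f) \<in> schroedinger_op l (\<lambda>x. q x - \<sigma>)" "ip l f e = 0" for w f
        using schroedinger_symmetric [OF l cq that(1) eS] that(2) False by (simp add: ip_cmult_right)
      then show ?thesis using solvable by blast
    qed
  qed
  have gain: "\<exists>c>0. \<forall>u a. (u, a) \<in> schroedinger_op l q \<longrightarrow> ip l u e = 0 \<longrightarrow>
      c * (L2_norm l u)\<^sup>2 \<le> Re (ip l a u) + \<sigma> * (L2_norm l u)\<^sup>2"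
    if "0 \<le> \<sigma>" and nn: "\<And>u a. (u, a) \<in> schroedinger_op l q \<Longrightarrow> ip l u e = 0 \<Longrightarrow>
      0 \<le> Re (ip l a u) + \<sigma> * (L2_norm l u)\<^sup>2" for \<sigma>
  proof -
    have form: "Re (ip l (\<lambda>x. a x + complex_of_real \<sigma> * u x) u) = Re (ip l a u) + \<sigma> * (L2_norm l u)\<^sup>2"
      if "a \<in> L2 l" "u \<in> L2 l" for a u
      using that by (simp add: ip_add_left L2_cmult ip_cmult_left ip_self)
    obtain C where C: "0 \<le> C" "\<And>f. f \<in> L2 l \<Longrightarrow> ip l f e = 0 \<Longrightarrow>
      \<exists>w. (w, f) \<in> schroedinger_op l (\<lambda>x. q x - \<sigma>) \<and> ip l w e = 0 \<and> L2_norm l w \<le> C * L2_norm l f"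
      using resolvent [OF \<open>0 \<le> \<sigma>\<close>] by blast
    show ?thesis
    proof (intro exI [of _ "1 / (C + 1)"] conjI allI impI)
      show "0 < 1 / (C + 1)" using C(1) by simp
      fix u a assume u: "(u, a) \<in> schroedinger_op l q" "ip l u e = 0"
      have "(L2_norm l u)\<^sup>2 / (C + 1) \<le> Re (ip l (\<lambda>x. a x + complex_of_real \<sigma> * u x) u)"
      proof (rule form_coercive [OF l cq _ C(2) C(1) eL schroedinger_shift(1) [OF l q u(1)] u(2)])
        fix u b assume v: "(u, b) \<in> schroedinger_op l (\<lambda>x. q x - \<sigma>)" "ip l u e = 0"
        note v' = schroedinger_shift(2) [OF l q v(1)]
        show "0 \<le> Re (ip l b u)"
          using nn [OF v' v(2)] schroedinger_L2 [OF v(1)]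
          by (simp add: ip_diff_left L2_cmult ip_cmult_left ip_self)
      qed
      then show "1 / (C + 1) * (L2_norm l u)\<^sup>2 \<le> Re (ip l a u) + \<sigma> * (L2_norm l u)\<^sup>2"
        using form schroedinger_L2 [OF u(1)] by simp
    qed
  qed
  obtain K where K: "0 \<le> K" "\<And>x. x \<in> {0..l} \<Longrightarrow> \<bar>q x\<bar> \<le> K"
    using continuous_real_bound [OF q] by blast
  define X where "X = {(u, a). (u, a) \<in> schroedinger_op l q \<and> ip l u e = 0}"
  have "0 \<le> (\<lambda>(u, a). Re (ip l a u)) p" if "p \<in> X" for p
  proof (rule form_descent [where B = "\<lambda>(u, a). (L2_norm l u)\<^sup>2" and \<mu> = K and X = X])
    show "0 \<le> (case p of (u, a) \<Rightarrow> Re (ip l a u)) + K * (case p of (u, a) \<Rightarrow> (L2_norm l u)\<^sup>2)" if "p \<in> X" for p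
      using that schroedinger_bounded_below [OF l q _ K(2)] by (fastforce simp: X_def)
    fix \<kappa> :: real assume "0 < \<kappa>" and
      "\<And>p. p \<in> X \<Longrightarrow> 0 \<le> (case p of (u, a) \<Rightarrow> Re (ip l a u)) + \<kappa> * (case p of (u, a) \<Rightarrow> (L2_norm l u)\<^sup>2)"
    then have "\<And>u a. (u, a) \<in> schroedinger_op l q \<Longrightarrow> ip l u e = 0 \<Longrightarrow> 0 \<le> Re (ip l a u) + \<kappa> * (L2_norm l u)\<^sup>2"
      by (fastforce simp: X_def)
    with gain [of \<kappa>] \<open>0 < \<kappa>\<close> obtain c where "0 < c" and c: "\<And>u a. (u, a) \<in> schroedinger_op l q \<Longrightarrow> ip l u e = 0 \<Longrightarrow>
        c * (L2_norm l u)\<^sup>2 \<le> Re (ip l a u) + \<kappa> * (L2_norm l u)\<^sup>2" by (meson less_imp_le)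
    have "\<forall>p\<in>X. 0 \<le> (case p of (u, a) \<Rightarrow> Re (ip l a u)) + (\<kappa> - c) * (case p of (u, a) \<Rightarrow> (L2_norm l u)\<^sup>2)"
      using c by (auto simp: X_def algebra_simps)
    then show "\<exists>\<epsilon>>0. \<forall>p\<in>X. 0 \<le> (case p of (u, a) \<Rightarrow> Re (ip l a u)) + (\<kappa> - \<epsilon>) * (case p of (u, a) \<Rightarrow> (L2_norm l u)\<^sup>2)"
      using \<open>0 < c\<close> by blast
  qed (use K that in auto)
  then have "\<And>u a. (u, a) \<in> schroedinger_op l q \<Longrightarrow> ip l u e = 0 \<Longrightarrow> 0 \<le> Re (ip l a u) + 0 * (L2_norm l u)\<^sup>2"
    by (fastforce simp: X_def)
  with gain [of 0] obtain c where c: "0 < c" "\<And>u a. (u, a) \<in> schroedinger_op l q \<Longrightarrow> ip l u e = 0 \<Longrightarrow>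
        c * (L2_norm l u)\<^sup>2 \<le> Re (ip l a u)" by auto
  have "\<exists>w. (w, \<lambda>x. f x - complex_of_real \<tau> * w x) \<in> schroedinger_op l q" if "f \<in> L2 l" "ip l f e = 0" for f
    using C1 [OF that] schroedinger_shift(2) [OF l q] by blast
  with that [OF eq e(2) c] show thesis by blast
qed

section \<open>Existence of a positive eigenvalue\<close>

lemma ip_Re_commute: "Re (ip l u v) = Re (ip l v u)"
  using arg_cong [OF ip_cnj [of l v u], of Re] by simp

text \<open>
  The form \<open>\<langle>L\<^sub>h z, z\<rangle>\<close> written in terms of \<open>u = L\<^sub>h z\<close> is the form of \<open>L\<^sub>h\<^sup>-\<^sup>1\<close>; it does not change
  when a multiple of the kernel element is added to \<open>z\<close>.
\<close>

lemma form_on_kernel_complement: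
  assumes l: "0 < l" and h: "continuous_on {0..l} h"
    and v0: "(v0, \<lambda>x. 0) \<in> schroedinger_op l h" "\<not> (AE x in interval_measure l. v0 x = 0)"
    and c: "0 < c" "\<And>v a. (v, a) \<in> schroedinger_op l h \<Longrightarrow> ip l v v0 = 0 \<Longrightarrow> c * (L2_norm l v)\<^sup>2 \<le> Re (ip l a v)"
    and z: "(z, u) \<in> schroedinger_op l h"
  shows "0 \<le> Re (ip l u z)" "Re (ip l u z) \<le> (L2_norm l u)\<^sup>2 / c"
    "Re (ip l u z) = 0 \<Longrightarrow> \<exists>d. AE x in interval_measure l. z x = d * v0 x"
proof -
  note vL = schroedinger_L2(1) [OF v0(1)]
  note zL = schroedinger_L2 [OF z]
  define d where "d = ip l z v0 / ip l v0 v0"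
  define y where "y = (\<lambda>x. z x - d * v0 x)"
  have y0: "ip l y v0 = 0" unfolding y_def d_def by (rule project_off [OF vL v0(2) zL(1)])
  have "(\<lambda>x. 1 * z x + (- d) * v0 x, \<lambda>x. 1 * u x + (- d) * 0) \<in> schroedinger_op l h"
    by (rule schroedinger_lincomb [OF l z v0(1)])
  then have y: "(y, u) \<in> schroedinger_op l h" by (simp add: y_def)
  have "ip l u v0 = 0" using schroedinger_symmetric [OF l h z v0(1)] by simp
  then have eq: "ip l u z = ip l u y"
    unfolding y_def using vL zL by (simp add: ip_diff_right L2_cmult ip_cmult_right)
  have lo: "c * (L2_norm l y)\<^sup>2 \<le> Re (ip l u y)" by (rule c(2) [OF y y0])
  moreover have "0 \<le> c * (L2_norm l y)\<^sup>2" using c(1) by simp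
  ultimately have "0 \<le> Re (ip l u y)" by linarith
  then show "0 \<le> Re (ip l u z)" using eq by simp
  show "\<exists>d. AE x in interval_measure l. z x = d * v0 x" if "Re (ip l u z) = 0"
  proof -
    have "L2_norm l y = 0" using lo that eq c(1) by (simp add: mult_le_0_iff)
    then have "AE x in interval_measure l. y x = 0" using L2_norm_eq_0 [OF schroedinger_L2(1) [OF y]] by simp
    then have "AE x in interval_measure l. z x = d * v0 x" by eventually_elim (simp add: y_def)
    then show ?thesis by blast
  qed
  have up: "Re (ip l u y) \<le> L2_norm l u * L2_norm l y"
    using ip_Cauchy_Schwarz [OF zL(2) schroedinger_L2(1) [OF y]] complex_Re_le_cmod order_trans by blast
  have "c * L2_norm l y \<le> L2_norm l u"
  proof (cases "L2_norm l y = 0")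
    case False
    then have "0 < L2_norm l y" by (simp add: less_le)
    moreover have "(c * L2_norm l y) * L2_norm l y \<le> L2_norm l u * L2_norm l y"
      using lo up by (simp add: power2_eq_square mult.assoc)
    ultimately show ?thesis using mult_right_le_imp_le by blast
  qed simp
  then have "L2_norm l y \<le> L2_norm l u / c" using c(1) by (simp add: field_simps)
  then have "L2_norm l u * L2_norm l y \<le> L2_norm l u * (L2_norm l u / c)" by (intro mult_left_mono) auto
  then show "Re (ip l u z) \<le> (L2_norm l u)\<^sup>2 / c" using up eq by (simp add: power2_eq_square)
qed

text \<open>
  Write \<open>A = \<langle>L\<^sub>g u, u\<rangle>\<close> and \<open>B = \<langle>u, L\<^sub>h\<^sup>-\<^sup>1 u\<rangle>\<close> for \<open>u\<close> orthogonal to \<open>v0\<close>; the function \<open>z\<close> in a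
  triple of \<open>X\<close> is a preimage of \<open>u\<close> under \<open>L\<^sub>h\<close>. The Euler-Lagrange equation of the quotient \<open>A / B\<close>
  at the value \<open>- r\<^sup>2\<close> is the eigenvalue equation for \<open>r\<close>. If there is no positive
  eigenvalue then \<open>L\<^sub>g + \<kappa> L\<^sub>h\<^sup>-\<^sup>1\<close> is boundedly invertible for all \<open>\<kappa> > 0\<close>, and nonnegativity of \<open>A + \<kappa> B\<close>
  descends to \<open>\<kappa> = 0\<close>. But \<open>A\<close> takes a negative value: subtract from the eigenfunction \<open>e\<close> the
  multiple of \<open>uh = L\<^sub>g\<^sup>-\<^sup>1 v0\<close> that makes it orthogonal to \<open>v0\<close>. This is where the sign of
  \<open>\<langle>uh, v0\<rangle>\<close> enters.
\<close>

lemma positive_eigenvalue_exists: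
  assumes l: "0 < l" and g: "continuous_on {0..l} g" and h: "continuous_on {0..l} h"
    and v0: "(v0, \<lambda>x. 0) \<in> schroedinger_op l h" "\<not> (AE x in interval_measure l. v0 x = 0)"
    and c: "0 < c" "\<And>v a. (v, a) \<in> schroedinger_op l h \<Longrightarrow> ip l v v0 = 0 \<Longrightarrow> c * (L2_norm l v)\<^sup>2 \<le> Re (ip l a v)"
    and onto: "\<And>f. f \<in> L2 l \<Longrightarrow> ip l f v0 = 0 \<Longrightarrow> \<exists>w. (w, f) \<in> schroedinger_op l h"
    and e: "(e, \<lambda>x. - (complex_of_real \<tau> * e x)) \<in> schroedinger_op l g" "0 < \<tau>"
      "\<not> (AE x in interval_measure l. e x = 0)"
    and uh: "(uh, v0) \<in> schroedinger_op l g" "0 < Re (ip l uh v0)"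
  shows "\<exists>r>0. \<exists>u v. (u, \<lambda>x. complex_of_real r * v x) \<in> schroedinger_op l g \<and>
    (v, \<lambda>x. - (complex_of_real r * u x)) \<in> schroedinger_op l h \<and>
    \<not> (AE x in interval_measure l. u x = 0 \<and> v x = 0)"
proof (rule ccontr)
  assume none: "\<not> ?thesis"
  define X where "X = {(u, b, z). (u, b) \<in> schroedinger_op l g \<and> (z, u) \<in> schroedinger_op l h}"
  define A where "A = (\<lambda>(u, b, z :: real \<Rightarrow> complex). Re (ip l b u))"
  define Bf where "Bf = (\<lambda>(u, b :: real \<Rightarrow> complex, z). Re (ip l u z))"
  have fk: "0 \<le> Re (ip l u z)" "Re (ip l u z) \<le> (L2_norm l u)\<^sup>2 / c"
    if "(z, u) \<in> schroedinger_op l h" for z u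
    using form_on_kernel_complement [OF l h v0 c(1) _ that] c(2) by blast+
  obtain M where M: "0 \<le> M" "\<And>x. x \<in> {0..l} \<Longrightarrow> \<bar>g x - h x\<bar> \<le> M"
    using continuous_real_bound [of l "\<lambda>x. g x - h x"] g h continuous_on_diff by blast
  have A_nonneg: "0 \<le> A p" if "p \<in> X" for p
  proof (rule form_descent [where B = Bf and \<mu> = "M\<^sup>2 / 4" and X = X])
    show "0 \<le> Bf p" if "p \<in> X" for p using that fk(1) by (auto simp: X_def Bf_def)
    show "0 \<le> A p + M\<^sup>2 / 4 * Bf p" if pX: "p \<in> X" for p
    proof -
      obtain u b z where p: "p = (u, b, z)" and u: "(u, b) \<in> schroedinger_op l g"
        and z: "(z, u) \<in> schroedinger_op l h" using pX by (auto simp: X_def)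
      note uL = schroedinger_L2 [OF u] and zL = schroedinger_L2 [OF z]
      define b' where "b' = (\<lambda>x. b x + complex_of_real (g x - h x) * u x)"
      have b': "(u, b') \<in> schroedinger_op l h"
        unfolding b'_def by (rule schroedinger_change_potential [OF l u g h])
      have guL: "(\<lambda>x. complex_of_real (g x - h x) * u x) \<in> L2 l"
        using g h by (intro L2_mult_continuous uL continuous_intros)
      note bL = schroedinger_L2(2) [OF b']
      \<comment> \<open>\<open>M / 2\<close> completes the square: the bound \<open>M\<^sup>2 / 4\<close> for \<open>\<kappa>\<close> says that real eigenvalues are at most \<open>M / 2\<close>\<close>
      define t where "t = complex_of_real (M / 2)"
      have "(\<lambda>x. 1 * u x + (- t) * z x, \<lambda>x. 1 * b' x + (- t) * u x) \<in> schroedinger_op l h"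
        by (rule schroedinger_lincomb [OF l b' z])
      then have "0 \<le> Re (ip l (\<lambda>x. 1 * b' x + (- t) * u x) (\<lambda>x. 1 * u x + (- t) * z x))"
        by (rule fk(1))
      also have "ip l (\<lambda>x. 1 * b' x + (- t) * u x) (\<lambda>x. 1 * u x + (- t) * z x)
          = ip l b' u - t * ip l u u - t * ip l b' z + t * t * ip l u z"
        using uL zL bL by (simp only: ip_add_left ip_add_right ip_cmult_left ip_cmult_right L2_add L2_cmult)
          (simp add: t_def algebra_simps)
      also have "ip l b' z = ip l u u"
        by (rule schroedinger_symmetric [OF l h b' z])
      also have "Re (ip l b' u - t * ip l u u - t * ip l u u + t * t * ip l u z)
          = Re (ip l b' u) - M * (L2_norm l u)\<^sup>2 + M\<^sup>2 / 4 * Re (ip l u z)"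
        by (simp add: t_def ip_self power2_eq_square)
      also have "Re (ip l b' u) \<le> Re (ip l b u) + M * (L2_norm l u)\<^sup>2"
        using ip_multiplier_bound [OF _ M(2) uL(1)] g h uL guL
        by (simp add: b'_def ip_add_left continuous_on_diff)
      finally show ?thesis by (simp add: p A_def Bf_def)
    qed
    fix \<kappa> :: real assume \<kappa>: "0 < \<kappa>" and nn: "\<And>p. p \<in> X \<Longrightarrow> 0 \<le> A p + \<kappa> * Bf p"
    obtain C where C: "0 \<le> C"
      "\<And>f. f \<in> L2 l \<Longrightarrow> \<exists>w y. (w, \<lambda>x. f x - complex_of_real \<kappa> * y x) \<in> schroedinger_op l g \<and>
        (y, w) \<in> schroedinger_op l h \<and> L2_norm l w \<le> C * L2_norm l f"
    proof (rule system_alternative [OF l g h, of "- complex_of_real \<kappa>" 1])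
      fix u v assume u: "(u, \<lambda>x. - complex_of_real \<kappa> * v x) \<in> schroedinger_op l g"
        "(v, \<lambda>x. 1 * u x) \<in> schroedinger_op l h" "\<not> (AE x in interval_measure l. u x = 0 \<and> v x = 0)"
      define r where "r = sqrt \<kappa>"
      have r: "0 < r" "complex_of_real r * complex_of_real r = complex_of_real \<kappa>"
        using \<kappa> by (auto simp: r_def simp flip: of_real_mult)
      \<comment> \<open>rescaling turns the couplings \<open>- \<kappa>\<close> and \<open>1\<close> into \<open>r\<close> and \<open>- r\<close>\<close>
      define v' where "v' = (\<lambda>x. - complex_of_real r * v x)"
      have "(u, \<lambda>x. complex_of_real r * v' x) \<in> schroedinger_op l g"
        using u(1) r(2) by (simp add: v'_def mult.assoc [symmetric])
      moreover have "(v', \<lambda>x. - (complex_of_real r * u x)) \<in> schroedinger_op l h"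
        using schroedinger_cmult [OF l u(2), of "- complex_of_real r"] by (simp add: v'_def)
      moreover have "\<not> (AE x in interval_measure l. u x = 0 \<and> v' x = 0)"
        using u(3) r(1) by (simp add: v'_def)
      ultimately show thesis using none r(1) by blast
    next
      fix C assume "0 \<le> C" and C: "\<And>f k. f \<in> L2 l \<Longrightarrow> k \<in> L2 l \<Longrightarrow>
        \<exists>u v. (u, \<lambda>x. f x + - complex_of_real \<kappa> * v x) \<in> schroedinger_op l g \<and>
        (v, \<lambda>x. k x + 1 * u x) \<in> schroedinger_op l h \<and>
        L2_norm l u \<le> C * L2_norm l (\<lambda>x. (f x, k x)) \<and> L2_norm l v \<le> C * L2_norm l (\<lambda>x. (f x, k x))"
      have nf: "L2_norm l (\<lambda>x. (f x, 0 :: complex)) = L2_norm l f" for f :: "real \<Rightarrow> complex"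
        by (simp add: L2_norm_def norm_prod_def)
      show thesis
        using C [OF _ L2_zero, unfolded nf] by (intro that [OF \<open>0 \<le> C\<close>]) fastforce
    qed
    have coercive: "c / (C + 1) * Bf p \<le> A p + \<kappa> * Bf p" if pX: "p \<in> X" for p
    proof -
      obtain u b z where p: "p = (u, b, z)" and u: "(u, b) \<in> schroedinger_op l g"
        and z: "(z, u) \<in> schroedinger_op l h" using pX by (auto simp: X_def)
      note uL = schroedinger_L2 [OF u] and zL = schroedinger_L2 [OF z]
      obtain w y where w: "(w, \<lambda>x. u x - complex_of_real \<kappa> * y x) \<in> schroedinger_op l g"
        and y: "(y, w) \<in> schroedinger_op l h" and wu: "L2_norm l w \<le> C * L2_norm l u"
        using C(2) [OF uL(1)] by blast
      note wL = schroedinger_L2 [OF w] and yL = schroedinger_L2 [OF y]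
      define t where "t = complex_of_real (1 / (C + 1))"
      let ?k = "complex_of_real \<kappa>"
      let ?u = "\<lambda>x. 1 * u x + (- t) * w x" and ?b = "\<lambda>x. 1 * b x + (- t) * (u x - ?k * y x)"
        and ?z = "\<lambda>x. 1 * z x + (- t) * y x"
      have "(?u, ?b, ?z) \<in> X"
        unfolding X_def using schroedinger_lincomb [OF l u w, of 1 "- t"] schroedinger_lincomb [OF l z y, of 1 "- t"]
        by blast
      then have "0 \<le> Re (ip l ?b ?u) + \<kappa> * Re (ip l ?u ?z)"
        using nn by (auto simp: A_def Bf_def)
      also have "\<dots> = Re (ip l ?b ?u) + \<kappa> * Re (ip l ?z ?u)"
        by (simp only: ip_Re_commute [of l ?u ?z])
      also have "\<dots> = Re (ip l ?b ?u + ?k * ip l ?z ?u)" by simp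
      also have "ip l ?b ?u + ?k * ip l ?z ?u
          = (ip l b u + ?k * ip l z u) - t * ip l u u - t * (ip l b w + ?k * ip l z w) + t * t * ip l u w"
        using uL zL wL yL by (simp only: ip_add_left ip_add_right ip_diff_left ip_cmult_left ip_cmult_right
            L2_add L2_cmult L2_diff) (simp add: t_def algebra_simps)
      also have "ip l b w + ?k * ip l z w = ip l u u"
      proof -
        have "ip l b w = ip l u (\<lambda>x. u x - ?k * y x)" by (rule schroedinger_symmetric [OF l g u w])
        also have "\<dots> = ip l u u - ?k * ip l u y"
          using uL yL by (simp add: ip_diff_right L2_cmult ip_cmult_right)
        also have "ip l u y = ip l z w" by (rule schroedinger_symmetric [OF l h z y])
        finally show ?thesis by simp
      qed
      also have "Re ((ip l b u + ?k * ip l z u) - t * ip l u u - t * ip l u u + t * t * ip l u w)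
          = (Re (ip l b u) + \<kappa> * Re (ip l z u)) - 2 * (1 / (C + 1)) * (L2_norm l u)\<^sup>2 + (1 / (C + 1))\<^sup>2 * Re (ip l u w)"
        by (simp add: t_def ip_self power2_eq_square)
      finally have ineq: "0 \<le> (Re (ip l b u) + \<kappa> * Re (ip l z u)) - 2 * (1 / (C + 1)) * (L2_norm l u)\<^sup>2
          + (1 / (C + 1))\<^sup>2 * Re (ip l u w)" .
      have "Re (ip l u w) \<le> L2_norm l u * L2_norm l w"
        using ip_Cauchy_Schwarz [OF uL(1) wL(1)] complex_Re_le_cmod order_trans by blast
      also have "\<dots> \<le> L2_norm l u * (C * L2_norm l u)" using wu by (intro mult_left_mono) auto
      finally have uw: "Re (ip l u w) \<le> C * (L2_norm l u)\<^sup>2" by (simp add: power2_eq_square mult_ac)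
      have "(L2_norm l u)\<^sup>2 / (C + 1) \<le> Re (ip l b u) + \<kappa> * Re (ip l z u)"
        by (rule quadratic_gain [OF C(1) uw zero_le_power2 ineq])
      moreover have "c / (C + 1) * Re (ip l u z) \<le> (L2_norm l u)\<^sup>2 / (C + 1)"
      proof -
        have "c * Re (ip l u z) \<le> (L2_norm l u)\<^sup>2" using fk(2) [OF z] c(1) by (simp add: field_simps)
        then show ?thesis using C(1) by (simp add: divide_right_mono)
      qed
      moreover have "Re (ip l z u) = Re (ip l u z)"
        by (rule ip_Re_commute)
      ultimately show ?thesis by (simp add: p A_def Bf_def)
    qed
    have "\<forall>p\<in>X. 0 \<le> A p + (\<kappa> - c / (C + 1)) * Bf p"
      using coercive by (auto simp: algebra_simps)
    moreover have "0 < c / (C + 1)" using c(1) C(1) by simp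
    ultimately show "\<exists>\<epsilon>>0. \<forall>p\<in>X. 0 \<le> A p + (\<kappa> - \<epsilon>) * Bf p" by blast
  qed (use that in auto)
  note eL = schroedinger_L2 [OF e(1)] and uhL = schroedinger_L2 [OF uh(1)]
  define r where "r = Re (ip l v0 uh)"
  have vu: "ip l v0 uh = complex_of_real r"
    using schroedinger_form_real [OF l g uh(1)] by (simp add: r_def)
  have uv: "ip l uh v0 = complex_of_real r"
    using ip_cnj [of l v0 uh] vu by simp
  have r: "0 < r" using uh(2) uv by simp
  define s where "s = ip l e v0"
  define t where "t = s / complex_of_real r"
  let ?u = "\<lambda>x. 1 * e x + (- t) * uh x"
    and ?b = "\<lambda>x. 1 * (- (complex_of_real \<tau> * e x)) + (- t) * v0 x"
  have u: "(?u, ?b) \<in> schroedinger_op l g" by (rule schroedinger_lincomb [OF l e(1) uh(1)])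
  have "ip l ?u v0 = 0"
    using eL uhL r by (simp only: ip_add_left ip_cmult_left L2_cmult) (simp add: t_def s_def uv)
  then obtain z where "(z, ?u) \<in> schroedinger_op l h"
    using onto [OF schroedinger_L2(1) [OF u]] by blast
  then have "0 \<le> A (?u, ?b, z)" by (intro A_nonneg) (use u in \<open>simp add: X_def\<close>)
  then have nn: "0 \<le> Re (ip l ?b ?u)" by (simp only: A_def split_conv)
  have es: "complex_of_real \<tau> * ip l e uh = - s"
  proof -
    have "ip l (\<lambda>x. - (complex_of_real \<tau> * e x)) uh = ip l e v0"
      by (rule schroedinger_symmetric [OF l g e(1) uh(1)])
    then have "- (complex_of_real \<tau> * ip l e uh) = s"
      by (simp only: ip_uminus_left ip_cmult_left s_def)
    then show ?thesis by (metis minus_minus)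
  qed
  have "ip l ?b ?u = - (complex_of_real \<tau> * ip l e e) + cnj t * (complex_of_real \<tau> * ip l e uh)
      - t * ip l v0 e + t * cnj t * ip l v0 uh"
    using eL uhL by (simp only: ip_add_left ip_add_right ip_uminus_left ip_cmult_left ip_cmult_right
            L2_add L2_cmult L2_uminus) (simp add: algebra_simps)
  also have "\<dots> = - complex_of_real (\<tau> * (L2_norm l e)\<^sup>2) - complex_of_real ((cmod s)\<^sup>2 / r)"
  proof -
    have "ip l v0 e = cnj s" using ip_cnj [of l e v0] by (simp add: s_def)
    moreover have "s * cnj s = complex_of_real ((cmod s)\<^sup>2)" by (simp only: complex_norm_square)
    ultimately show ?thesis
      unfolding es vu using r by (simp add: t_def ip_self field_simps)
  qed
  finally have "Re (ip l ?b ?u) = - (\<tau> * (L2_norm l e)\<^sup>2) - (cmod s)\<^sup>2 / r" by simp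
  moreover have "0 < \<tau> * (L2_norm l e)\<^sup>2"
    using e(2,3) L2_norm_eq_0 [OF eL(1)] by (intro mult_pos_pos) auto
  moreover have "0 \<le> (cmod s)\<^sup>2 / r" using r by simp
  ultimately show False using nn by linarith
qed

section \<open>Eigenvalues and multiplicities\<close>

lemma scaleC_eq_0: "c *\<^sub>C (x :: 'v::complex_normed) = 0 \<longleftrightarrow> c = 0 \<or> x = 0"
  by (metis mult_eq_0_iff norm_eq_zero norm_scaleC)

lemma eigenvalue_multiplicity:
  fixes T :: "'v::{complex_normed,euclidean_space} operator"
  assumes "eigenvalue l T \<mu>"
  shows "1 \<le> multiplicity l T \<mu>"
proof -
  obtain u where u: "(u, \<lambda>x. \<mu> *\<^sub>C u x) \<in> T" "\<not> (AE x in interval_measure l. u x = 0)"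
    using assms by (auto simp: eigenvalue_def)
  have "u \<in> ker_power l T \<mu> (Suc 0)"
    using u(1) by (auto intro!: exI [of _ "\<lambda>x. \<mu> *\<^sub>C u x"])
  then have mem: "u \<in> (\<Union>k. ker_power l T \<mu> k)" by blast
  have "c = 0" if "AE x in interval_measure l. c *\<^sub>C u x = 0" for c
    using that u(2) by (cases "c = 0") (auto simp: scaleC_eq_0)
  then have "(1::nat) \<in> {n. \<exists>b :: nat \<Rightarrow> real \<Rightarrow> 'v. (\<forall>i<n. b i \<in> (\<Union>k. ker_power l T \<mu> k)) \<and>
      (\<forall>c. (AE x in interval_measure l. (\<Sum>i<n. c i *\<^sub>C b i x) = 0) \<longrightarrow> (\<forall>i<n. c i = 0))}"
    using mem by (auto intro!: exI [of _ "\<lambda>i. u"])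
  then have "enat 1 \<le> ae_dim l (\<Union>k. ker_power l T \<mu> k)"
    unfolding ae_dim_def by (rule SUP_upper)
  then show ?thesis by (simp add: multiplicity_def one_enat_def)
qed

lemma num_eigenvalues_ge:
  fixes T :: "'v::{complex_normed,euclidean_space} operator"
  assumes "finite F" "F \<subseteq> \<Lambda>" "\<And>\<mu>. \<mu> \<in> F \<Longrightarrow> eigenvalue l T \<mu>"
  shows "enat (card F) \<le> num_eigenvalues l T \<Lambda>"
proof -
  have "enat (card F) = (\<Sum>\<mu>\<in>F. 1)" by (simp add: of_nat_eq_enat [symmetric])
  also have "\<dots> \<le> (\<Sum>\<mu>\<in>F. multiplicity l T \<mu>)"
    using assms(3) eigenvalue_multiplicity by (intro sum_mono) blast
  also have "\<dots> \<le> num_eigenvalues l T \<Lambda>"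
    unfolding num_eigenvalues_def using assms by (intro SUP_upper) auto
  finally show ?thesis .
qed

lemma num_eigenvalues_eq_0:
  fixes T :: "'v::{complex_normed,euclidean_space} operator"
  assumes "num_eigenvalues l T \<Lambda> = 0" "\<mu> \<in> \<Lambda>"
  shows "\<not> eigenvalue l T \<mu>"
  using num_eigenvalues_ge [of "{\<mu>}" \<Lambda> l T] assms by (auto simp: zero_enat_def)

lemma num_eigenvalues_eq_1_unique:
  fixes T :: "'v::{complex_normed,euclidean_space} operator"
  assumes "num_eigenvalues l T \<Lambda> = 1" "\<mu> \<in> \<Lambda>" "\<nu> \<in> \<Lambda>" "eigenvalue l T \<mu>" "eigenvalue l T \<nu>"
  shows "\<mu> = \<nu>"
  using num_eigenvalues_ge [of "{\<mu>, \<nu>}" \<Lambda> l T] assms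
  by (cases "\<mu> = \<nu>") (auto simp: one_enat_def)

lemma num_eigenvalues_eq_1_exists:
  assumes "num_eigenvalues l T \<Lambda> = 1"
  obtains \<mu> where "\<mu> \<in> \<Lambda>" "eigenvalue l T \<mu>"
proof (rule ccontr)
  assume "\<not> thesis"
  then have "{\<mu> \<in> \<Lambda>. eigenvalue l T \<mu>} = {}" using that by blast
  then have "{F. finite F \<and> F \<subseteq> {\<mu> \<in> \<Lambda>. eigenvalue l T \<mu>}} = {{}}" by auto
  then have "num_eigenvalues l T \<Lambda> = 0"
    unfolding num_eigenvalues_def by simp
  then show False using assms by simp
qed

lemma eigenvalue_in_Spec:
  fixes T :: "'v::{complex_normed,euclidean_space} operator"
  assumes dom: "\<And>u z. (u, z) \<in> T \<Longrightarrow> u \<in> L2 l" and "eigenvalue l T \<mu>"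
  shows "\<mu> \<in> Spec l T"
proof (rule ccontr)
  assume "\<mu> \<notin> Spec l T"
  then obtain C where C: "\<And>u z. (u, z) \<in> T \<Longrightarrow> L2_norm l u \<le> C * L2_norm l (\<lambda>x. z x - \<mu> *\<^sub>C u x)"
    unfolding Spec_def resolvent_set_def by blast
  obtain u where u: "(u, \<lambda>x. \<mu> *\<^sub>C u x) \<in> T" "\<not> (AE x in interval_measure l. u x = 0)"
    using assms by (auto simp: eigenvalue_def)
  have "L2_norm l u \<le> 0" using C [OF u(1)] by (simp add: L2_norm_def)
  then have "L2_norm l u = 0" by (simp add: order_antisym)
  then show False using u L2_norm_eq_0 [OF dom [OF u(1)]] by simp
qed

lemma schroedinger_eigenvalue_iff:
  "eigenvalue l (schroedinger_op l q) \<mu> \<longleftrightarrow>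
    (\<exists>e. (e, \<lambda>x. \<mu> * e x) \<in> schroedinger_op l q \<and> \<not> (AE x in interval_measure l. e x = 0))"
  by (simp add: eigenvalue_def scaleC_complex_def)

text \<open>
  If every right-hand side is attained then, by symmetry, the kernel is trivial, and the bound for
  one preimage is a bound for all elements of the domain.
\<close>

lemma zero_in_Spec_imp_kernel:
  assumes l: "0 < l" and q: "continuous_on {0..l} q" and "0 \<in> Spec l (schroedinger_op l q)"
  obtains e where "(e, \<lambda>x. 0) \<in> schroedinger_op l q" "\<not> (AE x in interval_measure l. e x = 0)"
proof (rule schroedinger_alternative [OF l q])
  fix C assume C: "0 \<le> C" "\<And>f. f \<in> L2 l \<Longrightarrow> \<exists>w. (w, f) \<in> schroedinger_op l q \<and> L2_norm l w \<le> C * L2_norm l f"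
  have bd: "L2_norm l u \<le> C * L2_norm l z" if uz: "(u, z) \<in> schroedinger_op l q" for u z
  proof -
    obtain w where w: "(w, z) \<in> schroedinger_op l q" "L2_norm l w \<le> C * L2_norm l z"
      using C(2) schroedinger_L2 [OF uz] by blast
    have d: "(\<lambda>x. u x - w x, \<lambda>x. z x - z x) \<in> schroedinger_op l q"
      by (rule schroedinger_diff [OF l uz w(1)])
    obtain y where "(y, \<lambda>x. u x - w x) \<in> schroedinger_op l q"
      using C(2) schroedinger_L2 [OF d] by blast
    from schroedinger_symmetric [OF l q this d] have "ip l (\<lambda>x. u x - w x) (\<lambda>x. u x - w x) = 0" by simp
    from ip_self_eq_0 [OF schroedinger_L2(1) [OF d] this] have "AE x in interval_measure l. u x = w x" by simp
    then have "L2_norm l u = L2_norm l w"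
      by (rule L2_norm_AE_cong [OF schroedinger_L2(1) [OF w(1)]])
    then show ?thesis using w(2) by simp
  qed
  have "0 \<in> resolvent_set l (schroedinger_op l q)"
    unfolding resolvent_set_def
  proof (intro CollectI conjI ballI)
    fix w :: "real \<Rightarrow> complex" assume "w \<in> L2 l"
    then show "\<exists>u z. (u, z) \<in> schroedinger_op l q \<and> (AE x in interval_measure l. z x - 0 *\<^sub>C u x = w x)"
      using C(2) by (fastforce simp: scaleC_complex_def)
  next
    show "\<exists>C. \<forall>(u, z)\<in>schroedinger_op l q. L2_norm l u \<le> C * L2_norm l (\<lambda>x. z x - 0 *\<^sub>C u x)"
      using bd by (auto simp: scaleC_complex_def)
  qed
  then show thesis using assms(3) by (simp add: Spec_def)
qed (rule that)

section \<open>The Hamiltonian operator\<close>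

lemma N_op_iff: "(w, z) \<in> N_op l g h \<longleftrightarrow>
    (\<lambda>x. snd (w x), \<lambda>x. - fst (z x)) \<in> schroedinger_op l h \<and>
    (\<lambda>x. fst (w x), \<lambda>x. snd (z x)) \<in> schroedinger_op l g"
proof
  assume "(w, z) \<in> N_op l g h"
  then show "(\<lambda>x. snd (w x), \<lambda>x. - fst (z x)) \<in> schroedinger_op l h \<and>
    (\<lambda>x. fst (w x), \<lambda>x. snd (z x)) \<in> schroedinger_op l g"
    by (auto simp: N_op_def)
next
  assume a: "(\<lambda>x. snd (w x), \<lambda>x. - fst (z x)) \<in> schroedinger_op l h \<and>
    (\<lambda>x. fst (w x), \<lambda>x. snd (z x)) \<in> schroedinger_op l g"
  show "(w, z) \<in> N_op l g h"
    unfolding N_op_def using a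
    by (intro CollectI exI [of _ "\<lambda>x. fst (w x)"] exI [of _ "\<lambda>x. snd (w x)"]
        exI [of _ "\<lambda>x. - fst (z x)"] exI [of _ "\<lambda>x. snd (z x)"]) auto
qed

lemma N_op_L2:
  assumes "(w, z) \<in> N_op l g h"
  shows "w \<in> L2 l" "z \<in> L2 l"
proof -
  have a: "(\<lambda>x. snd (w x), \<lambda>x. - fst (z x)) \<in> schroedinger_op l h"
    "(\<lambda>x. fst (w x), \<lambda>x. snd (z x)) \<in> schroedinger_op l g"
    using assms by (auto simp: N_op_iff)
  show "w \<in> L2 l" using schroedinger_L2(1) [OF a(1)] schroedinger_L2(1) [OF a(2)] by (simp add: L2_pair)
  show "z \<in> L2 l" using L2_uminus [OF schroedinger_L2(2) [OF a(1)]] schroedinger_L2(2) [OF a(2)] by (simp add: L2_pair)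
qed

lemma N_op_lincomb:
  assumes "0 < l" "(w, z) \<in> N_op l g h" "(w', z') \<in> N_op l g h"
  shows "(\<lambda>x. c *\<^sub>C w x + d *\<^sub>C w' x, \<lambda>x. c *\<^sub>C z x + d *\<^sub>C z' x) \<in> N_op l g h"
proof -
  note S = assms(2,3) [unfolded N_op_iff]
  have "(\<lambda>x. c * snd (w x) + d * snd (w' x), \<lambda>x. c * (- fst (z x)) + d * (- fst (z' x))) \<in> schroedinger_op l h"
    by (rule schroedinger_lincomb [OF assms(1) conjunct1 [OF S(1)] conjunct1 [OF S(2)]])
  moreover have "(\<lambda>x. c * fst (w x) + d * fst (w' x), \<lambda>x. c * snd (z x) + d * snd (z' x)) \<in> schroedinger_op l g"
    by (rule schroedinger_lincomb [OF assms(1) conjunct2 [OF S(1)] conjunct2 [OF S(2)]])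
  ultimately show ?thesis by (simp add: N_op_iff scaleC_prod_def scaleC_complex_def)
qed

lemma N_op_AE_cong:
  assumes l: "0 < l" and wz: "(w, z) \<in> N_op l g h" and ae: "AE x in interval_measure l. w' x = w x"
    "AE x in interval_measure l. z' x = z x"
  shows "(w', z') \<in> N_op l g h"
proof -
  note S = wz [unfolded N_op_iff]
  have "(\<lambda>x. snd (w' x), \<lambda>x. - fst (z' x)) \<in> schroedinger_op l h"
    by (rule schroedinger_AE_cong [OF l conjunct1 [OF S]]; use ae in eventually_elim; simp)
  moreover have "(\<lambda>x. fst (w' x), \<lambda>x. snd (z' x)) \<in> schroedinger_op l g"
    by (rule schroedinger_AE_cong [OF l conjunct2 [OF S]]; use ae in eventually_elim; simp)
  ultimately show ?thesis by (simp add: N_op_iff)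
qed

lemma N_op_unique:
  assumes "0 < l" "(w, z) \<in> N_op l g h" "(w', z') \<in> N_op l g h" "AE x in interval_measure l. w x = w' x"
  shows "AE x in interval_measure l. z x = z' x"
proof -
  note S = assms(2,3) [unfolded N_op_iff]
  have "AE x in interval_measure l. snd (w x) = snd (w' x)"
    using assms(4) by eventually_elim simp
  from schroedinger_unique [OF assms(1) conjunct1 [OF S(1)] conjunct1 [OF S(2)] this]
  have "AE x in interval_measure l. - fst (z x) = - fst (z' x)" .
  moreover have "AE x in interval_measure l. fst (w x) = fst (w' x)"
    using assms(4) by eventually_elim simp
  from schroedinger_unique [OF assms(1) conjunct2 [OF S(1)] conjunct2 [OF S(2)] this]
  have "AE x in interval_measure l. snd (z x) = snd (z' x)" .
  ultimately show ?thesis by eventually_elim (simp add: prod_eq_iff)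
qed

text \<open>
  The symplectic form. Since \<open>N\<close> is skew with respect to it, \<open>symp (N w) w\<close> is the energy
  \<open>\<langle>L\<^sub>+ u, u\<rangle> + \<langle>L\<^sub>- v, v\<rangle>\<close> of \<open>w = (u, v)\<close>, the quadratic form that is conserved by the flow of \<open>N\<close>.
\<close>

definition symp :: "real \<Rightarrow> (real \<Rightarrow> complex \<times> complex) \<Rightarrow> (real \<Rightarrow> complex \<times> complex) \<Rightarrow> complex" where
  "symp l w z = ip l (\<lambda>x. snd (w x)) (\<lambda>x. fst (z x)) - ip l (\<lambda>x. fst (w x)) (\<lambda>x. snd (z x))"

lemma symp_lincomb_left:
  assumes "w \<in> L2 l" "w' \<in> L2 l" "z \<in> L2 l"
  shows "symp l (\<lambda>x. c *\<^sub>C w x + d *\<^sub>C w' x) z = c * symp l w z + d * symp l w' z"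
  using assms unfolding L2_pair symp_def
  by (simp add: scaleC_prod_def scaleC_complex_def ip_add_left L2_cmult ip_cmult_left algebra_simps)

lemma symp_lincomb_right:
  assumes "w \<in> L2 l" "w' \<in> L2 l" "z \<in> L2 l"
  shows "symp l z (\<lambda>x. c *\<^sub>C w x + d *\<^sub>C w' x) = cnj c * symp l z w + cnj d * symp l z w'"
  using assms unfolding L2_pair symp_def
  by (simp add: scaleC_prod_def scaleC_complex_def ip_add_right L2_cmult ip_cmult_right algebra_simps)

lemma symp_AE_zero:
  assumes "w \<in> L2 l" "z \<in> L2 l"
  shows "(AE x in interval_measure l. w x = 0) \<Longrightarrow> symp l w z = 0"
    "(AE x in interval_measure l. z x = 0) \<Longrightarrow> symp l w z = 0"
proof -
  have L: "(\<lambda>x. fst (w x)) \<in> L2 l" "(\<lambda>x. snd (w x)) \<in> L2 l" "(\<lambda>x. fst (z x)) \<in> L2 l" "(\<lambda>x. snd (z x)) \<in> L2 l"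
    using assms by (simp_all add: L2_pair)
  note z = L2_zero [where ?'v = complex]
  show "symp l w z = 0" if "AE x in interval_measure l. w x = 0"
  proof -
    have "ip l (\<lambda>x. snd (w x)) (\<lambda>x. fst (z x)) = ip l (\<lambda>x. 0) (\<lambda>x. fst (z x))"
      "ip l (\<lambda>x. fst (w x)) (\<lambda>x. snd (z x)) = ip l (\<lambda>x. 0) (\<lambda>x. snd (z x))"
      using that by (intro ip_AE_cong z L; auto elim: eventually_mono)+
    then show ?thesis by (simp add: symp_def)
  qed
  show "symp l w z = 0" if "AE x in interval_measure l. z x = 0"
  proof -
    have "ip l (\<lambda>x. snd (w x)) (\<lambda>x. fst (z x)) = ip l (\<lambda>x. snd (w x)) (\<lambda>x. 0)"
      "ip l (\<lambda>x. fst (w x)) (\<lambda>x. snd (z x)) = ip l (\<lambda>x. fst (w x)) (\<lambda>x. 0)"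
      using that by (intro ip_AE_cong z L; auto elim: eventually_mono)+
    then show ?thesis by (simp add: symp_def)
  qed
qed

lemma symp_skew:
  assumes l: "0 < l" and g: "continuous_on {0..l} g" and h: "continuous_on {0..l} h"
    and w: "(w, w') \<in> N_op l g h" and z: "(z, z') \<in> N_op l g h"
  shows "symp l w' z = - symp l w z'"
proof -
  have "ip l (\<lambda>x. - fst (w' x)) (\<lambda>x. snd (z x)) = ip l (\<lambda>x. snd (w x)) (\<lambda>x. - fst (z' x))"
    using w z by (intro schroedinger_symmetric [OF l h]) (auto simp: N_op_iff)
  moreover have "ip l (\<lambda>x. snd (w' x)) (\<lambda>x. fst (z x)) = ip l (\<lambda>x. fst (w x)) (\<lambda>x. snd (z' x))"
    using w z by (intro schroedinger_symmetric [OF l g]) (auto simp: N_op_iff)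
  ultimately show ?thesis by (simp add: symp_def ip_uminus_left ip_uminus_right)
qed

lemma ker_power_L2: "w \<in> ker_power l (N_op l g h) \<mu> k \<Longrightarrow> w \<in> L2 l"
  by (cases k) (auto dest: N_op_L2)

text \<open>
  As for eigenvectors of a skew-adjoint operator, with a double induction on the orders of the two
  generalised eigenvectors.
\<close>

lemma symp_generalized_eigenvectors:
  assumes l: "0 < l" and g: "continuous_on {0..l} g" and h: "continuous_on {0..l} h"
    and ne: "\<nu> + cnj \<mu> \<noteq> 0"
    and w: "w \<in> ker_power l (N_op l g h) \<nu> j" and z: "z \<in> ker_power l (N_op l g h) \<mu> k"
  shows "symp l w z = 0"
  using w z
proof (induction j arbitrary: w z k)
  case 0
  then show ?case using symp_AE_zero(1) ker_power_L2 [OF 0(2)] by simp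
next
  case (Suc j)
  note IHj = Suc.IH
  obtain w1 where w1: "(w, w1) \<in> N_op l g h" "(\<lambda>x. w1 x - \<nu> *\<^sub>C w x) \<in> ker_power l (N_op l g h) \<nu> j"
    using Suc.prems(1) by auto
  show ?case
    using Suc.prems(2)
  proof (induction k arbitrary: z)
    case 0
    then show ?case using symp_AE_zero(2) N_op_L2 [OF w1(1)] by simp
  next
    case (Suc k)
    obtain z1 where z1: "(z, z1) \<in> N_op l g h" "(\<lambda>x. z1 x - \<mu> *\<^sub>C z x) \<in> ker_power l (N_op l g h) \<mu> k"
      using Suc.prems by auto
    note L = N_op_L2 [OF w1(1)] N_op_L2 [OF z1(1)]
    have one: "1 *\<^sub>C x = x" "(- c) *\<^sub>C x = - (c *\<^sub>C x)" for x :: "complex \<times> complex" and c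
      by (simp_all add: scaleC_prod_def scaleC_complex_def prod_eq_iff)
    have "symp l w1 z - \<nu> * symp l w z = 0"
      using IHj [OF w1(2) Suc.prems] symp_lincomb_left [OF L(2,1,3), of 1 "- \<nu>"] by (simp add: one)
    moreover have "symp l w z1 - cnj \<mu> * symp l w z = 0"
      using Suc.IH [OF z1(2)] symp_lincomb_right [OF L(4,3,1), of 1 "- \<mu>"] by (simp add: one)
    moreover have "symp l w1 z = - symp l w z1" by (rule symp_skew [OF l g h w1(1) z1(1)])
    ultimately have "\<nu> * symp l w z = - (cnj \<mu> * symp l w z)" by simp
    then have "(\<nu> + cnj \<mu>) * symp l w z = 0" by (simp add: distrib_right)
    then show ?case using ne by simp
  qed
qed

text \<open>
  Here \<open>w1\<close> is \<open>N w\<close>, which differs from \<open>\<nu> w\<close> by a generalised eigenvector of lower order. The energy is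
  the sesquilinear form \<open>symp (N w) z\<close>, so it vanishes on the span of the generalised eigenvectors for
  positive eigenvalues.
\<close>

lemma energy_vanishes:
  assumes l: "0 < l" and g: "continuous_on {0..l} g" and h: "continuous_on {0..l} h"
    and w: "w \<in> ker_power l (N_op l g h) \<nu> k"
  obtains w1 where "(w, w1) \<in> N_op l g h"
    "\<And>z \<mu> j. z \<in> ker_power l (N_op l g h) \<mu> j \<Longrightarrow> \<nu> + cnj \<mu> \<noteq> 0 \<Longrightarrow> symp l w1 z = 0"
proof (cases k)
  case 0
  then have w0: "AE x in interval_measure l. w x = 0" using w by simp
  have "(\<lambda>x. 0, \<lambda>x. 0) \<in> schroedinger_op l q" for q
    by (rule classical_dirichlet_solution [OF l L2_zero L2_zero, of _ 0]) auto
  then have "(\<lambda>x. (0, 0), \<lambda>x. (0, 0)) \<in> N_op l g h" by (simp add: N_op_iff)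
  then have "(w, \<lambda>x. 0) \<in> N_op l g h"
    by (rule N_op_AE_cong [OF l]) (use w0 in \<open>auto simp: zero_prod_def\<close>)
  then show thesis by (rule that) (simp add: symp_def)
next
  case (Suc k')
  then obtain w1 where w1: "(w, w1) \<in> N_op l g h" "(\<lambda>x. w1 x - \<nu> *\<^sub>C w x) \<in> ker_power l (N_op l g h) \<nu> k'"
    using w by auto
  show thesis
  proof (rule that [OF w1(1)])
    fix z \<mu> j assume z: "z \<in> ker_power l (N_op l g h) \<mu> j" "\<nu> + cnj \<mu> \<noteq> 0"
    have one: "1 *\<^sub>C x = x" "(- c) *\<^sub>C x = - (c *\<^sub>C x)" for x :: "complex \<times> complex" and c
      by (simp_all add: scaleC_prod_def scaleC_complex_def prod_eq_iff)
    have "symp l w1 z - \<nu> * symp l w z = 0"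
      using symp_generalized_eigenvectors [OF l g h z(2) w1(2) z(1)]
        symp_lincomb_left [OF N_op_L2(2,1) [OF w1(1)] ker_power_L2 [OF z(1)], of 1 "- \<nu>"] by (simp add: one)
    then show "symp l w1 z = 0"
      using symp_generalized_eigenvectors [OF l g h z(2) w z(1)] by simp
  qed
qed

section \<open>The spectrum of the Hamiltonian operator\<close>

text \<open>
  The situation of the first part of the theorem after normalisation: \<open>v0\<close> spans the kernel of
  \<open>L\<^sub>- = L\<^sub>h\<close>, \<open>uh\<close> is its preimage under \<open>L\<^sub>+ = L\<^sub>g\<close>, and both operators are strictly positive on the
  complements of \<open>e\<close> and \<open>v0\<close>.
\<close>

locale index_one_pair =
  fixes l :: real and g h :: "real \<Rightarrow> real" and e v0 uh :: "real \<Rightarrow> complex" and \<tau> cg ch :: real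
  assumes l: "0 < l" and g: "continuous_on {0..l} g" and h: "continuous_on {0..l} h"
    and e: "(e, \<lambda>x. - (complex_of_real \<tau> * e x)) \<in> schroedinger_op l g"
      "\<not> (AE x in interval_measure l. e x = 0)" "0 < \<tau>"
    and cg: "0 < cg" "\<And>u b. (u, b) \<in> schroedinger_op l g \<Longrightarrow> ip l u e = 0 \<Longrightarrow> cg * (L2_norm l u)\<^sup>2 \<le> Re (ip l b u)"
    and v0: "(v0, \<lambda>x. 0) \<in> schroedinger_op l h" "\<not> (AE x in interval_measure l. v0 x = 0)"
    and ch: "0 < ch" "\<And>v a. (v, a) \<in> schroedinger_op l h \<Longrightarrow> ip l v v0 = 0 \<Longrightarrow> ch * (L2_norm l v)\<^sup>2 \<le> Re (ip l a v)"
    and onto: "\<And>f. f \<in> L2 l \<Longrightarrow> ip l f v0 = 0 \<Longrightarrow> \<exists>w. (w, f) \<in> schroedinger_op l h"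
    and uh: "(uh, v0) \<in> schroedinger_op l g"
begin

abbreviation N where "N \<equiv> N_op l g h"

lemma h_form:
  assumes "(z, u) \<in> schroedinger_op l h"
  shows "0 \<le> Re (ip l u z)" "Re (ip l u z) = 0 \<Longrightarrow> \<exists>d. AE x in interval_measure l. z x = d * v0 x"
  using form_on_kernel_complement [OF l h v0 ch(1) _ assms] ch(2) by blast+

lemma index_real:
  "ip l v0 uh = complex_of_real (Re (ip l uh v0))" "ip l uh v0 = complex_of_real (Re (ip l uh v0))"
proof -
  show *: "ip l v0 uh = complex_of_real (Re (ip l uh v0))"
    using schroedinger_form_real [OF l g uh] ip_Re_commute [of l v0 uh] by simp
  show "ip l uh v0 = complex_of_real (Re (ip l uh v0))"
    using arg_cong [OF *, of cnj] by (simp add: ip_cnj)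
qed

text \<open>
  \<open>N (uh, 0) = (0, v0)\<close> and \<open>N (0, v0) = 0\<close>.
\<close>

lemma uh_generalized_kernel: "(\<lambda>x. (uh x, 0)) \<in> ker_power l N 0 2"
proof -
  have z: "(\<lambda>x. 0, \<lambda>x. 0) \<in> schroedinger_op l q" for q
    by (rule classical_dirichlet_solution [OF l L2_zero L2_zero, of _ 0]) auto
  have sc: "0 *\<^sub>C x = 0" for x :: "complex \<times> complex" by (simp add: scaleC_prod_def scaleC_complex_def zero_prod_def)
  have 1: "(\<lambda>x. (uh x, 0), \<lambda>x. (0, v0 x)) \<in> N"
    using z uh by (simp add: N_op_iff)
  have 2: "(\<lambda>x. (0, v0 x), \<lambda>x. (0, 0)) \<in> N"
    using z v0(1) by (simp add: N_op_iff)
  have "(\<lambda>x. (0, v0 x)) \<in> ker_power l N 0 (Suc 0)"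
    using 2 by (auto simp: sc zero_prod_def L2_pair intro!: exI [of _ "\<lambda>x. (0, 0)"])
  then have "(\<lambda>x. (uh x, 0)) \<in> ker_power l N 0 (Suc (Suc 0))"
    using 1 by (subst ker_power.simps) (auto simp: sc simp del: ker_power.simps intro!: exI [of _ "\<lambda>x. (0, v0 x)"])
  then show ?thesis by (simp add: numeral_2_eq_2)
qed

text \<open>
  Choose a combination \<open>w = (u, v)\<close> with \<open>u\<close> orthogonal to \<open>e\<close>. Its energy vanishes, but both parts
  of the energy are nonnegative; hence \<open>u = 0\<close> and \<open>v\<close> is a multiple \<open>d v0\<close> of the kernel element.
  Finally \<open>w\<close> is symplectically orthogonal to the generalised kernel vector \<open>(uh, 0)\<close>, which says
  \<open>d \<langle>v0, uh\<rangle> = 0\<close>.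
\<close>

lemma generalized_eigenvectors_dependent:
  assumes ne: "Re (ip l uh v0) \<noteq> 0"
    and pos: "0 < r1" "0 < r2"
    and w1: "w1 \<in> ker_power l N (complex_of_real r1) j" and w2: "w2 \<in> ker_power l N (complex_of_real r2) k"
  obtains c1 c2 where "c1 \<noteq> 0 \<or> c2 \<noteq> 0" "AE x in interval_measure l. c1 *\<^sub>C w1 x + c2 *\<^sub>C w2 x = 0"
proof -
  obtain z1 where z1: "(w1, z1) \<in> N"
    "\<And>z \<mu> j. z \<in> ker_power l N \<mu> j \<Longrightarrow> complex_of_real r1 + cnj \<mu> \<noteq> 0 \<Longrightarrow> symp l z1 z = 0"
    using energy_vanishes [OF l g h w1] by blast
  obtain z2 where z2: "(w2, z2) \<in> N"
    "\<And>z \<mu> j. z \<in> ker_power l N \<mu> j \<Longrightarrow> complex_of_real r2 + cnj \<mu> \<noteq> 0 \<Longrightarrow> symp l z2 z = 0"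
    using energy_vanishes [OF l g h w2] by blast
  note L = N_op_L2 [OF z1(1)] N_op_L2 [OF z2(1)]
  have eL: "e \<in> L2 l" by (rule schroedinger_L2 [OF e(1)])
  have nz: "complex_of_real r + cnj (complex_of_real r') \<noteq> 0" if "0 < r" "0 < r'" for r r'
    using that by (simp flip: of_real_add)
  define \<alpha> where "\<alpha> = ip l (\<lambda>x. fst (w1 x)) e"
  define \<beta> where "\<beta> = ip l (\<lambda>x. fst (w2 x)) e"
  obtain c1 c2 where c: "c1 \<noteq> 0 \<or> c2 \<noteq> 0" "c1 * \<alpha> + c2 * \<beta> = 0"
  proof (cases "\<alpha> = 0")
    case True
    then show thesis using that [of 1 0] by simp
  next
    case False
    then show thesis using that [of "- \<beta> / \<alpha>" 1] by simp
  qed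
  define w where "w = (\<lambda>x. c1 *\<^sub>C w1 x + c2 *\<^sub>C w2 x)"
  define z where "z = (\<lambda>x. c1 *\<^sub>C z1 x + c2 *\<^sub>C z2 x)"
  have N: "(w, z) \<in> N" unfolding w_def z_def by (rule N_op_lincomb [OF l z1(1) z2(1)])
  note wL = N_op_L2 [OF N]
  have comp: "(\<lambda>x. fst (w x)) \<in> L2 l" "(\<lambda>x. snd (w x)) \<in> L2 l" using wL by (simp_all add: L2_pair)
  have gS: "(\<lambda>x. fst (w x), \<lambda>x. snd (z x)) \<in> schroedinger_op l g"
    and hS: "(\<lambda>x. snd (w x), \<lambda>x. - fst (z x)) \<in> schroedinger_op l h"
    using N by (simp_all add: N_op_iff)
  have "symp l z w = 0"
    unfolding z_def w_def
    using z1(2) [OF w1 nz] z1(2) [OF w2 nz] z2(2) [OF w1 nz] z2(2) [OF w2 nz] pos L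
    by (simp only: symp_lincomb_left symp_lincomb_right wL [unfolded w_def z_def]) simp
  then have energy: "Re (ip l (\<lambda>x. snd (z x)) (\<lambda>x. fst (w x))) + Re (ip l (\<lambda>x. - fst (z x)) (\<lambda>x. snd (w x))) = 0"
    by (simp add: symp_def ip_uminus_left flip: minus_complex.simps)
  have "ip l (\<lambda>x. fst (w x)) e = 0"
    using c(2) L eL unfolding w_def \<alpha>_def \<beta>_def
    by (simp add: scaleC_prod_def scaleC_complex_def ip_add_left L2_cmult ip_cmult_left L2_pair)
  then have lo: "cg * (L2_norm l (\<lambda>x. fst (w x)))\<^sup>2 \<le> Re (ip l (\<lambda>x. snd (z x)) (\<lambda>x. fst (w x)))"
    by (rule cg(2) [OF gS])
  have lo': "0 \<le> cg * (L2_norm l (\<lambda>x. fst (w x)))\<^sup>2" using cg(1) by simp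
  have "cg * (L2_norm l (\<lambda>x. fst (w x)))\<^sup>2 = 0" using energy lo lo' h_form(1) [OF hS] by linarith
  then have "L2_norm l (\<lambda>x. fst (w x)) = 0" using cg(1) by simp
  then have fst0: "AE x in interval_measure l. fst (w x) = 0" using L2_norm_eq_0 [OF comp(1)] by simp
  have "Re (ip l (\<lambda>x. - fst (z x)) (\<lambda>x. snd (w x))) = 0" using energy lo lo' h_form(1) [OF hS] by linarith
  then obtain d where d: "AE x in interval_measure l. snd (w x) = d * v0 x" using h_form(2) [OF hS] by blast
  have v0L: "v0 \<in> L2 l" by (rule schroedinger_L2 [OF v0(1)])
  have uhL: "uh \<in> L2 l" by (rule schroedinger_L2 [OF uh])
  have "symp l w (\<lambda>x. (uh x, 0)) = 0"
  proof -
    have "symp l w1 (\<lambda>x. (uh x, 0)) = 0" "symp l w2 (\<lambda>x. (uh x, 0)) = 0"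
      using symp_generalized_eigenvectors [OF l g h _ w1 uh_generalized_kernel]
        symp_generalized_eigenvectors [OF l g h _ w2 uh_generalized_kernel] pos by auto
    then show ?thesis
      unfolding w_def using L uhL by (subst symp_lincomb_left) (auto simp: L2_pair)
  qed
  then have "ip l (\<lambda>x. snd (w x)) uh = 0" by (simp add: symp_def)
  moreover have "ip l (\<lambda>x. snd (w x)) uh = ip l (\<lambda>x. d * v0 x) uh"
    using d by (intro ip_AE_cong L2_cmult v0L uhL) auto
  ultimately have d0: "d = 0" using ne index_real(1) by (simp add: ip_cmult_left)
  from fst0 d have "AE x in interval_measure l. w x = 0"
    by eventually_elim (simp add: d0 prod_eq_iff)
  then show thesis using that c(1) unfolding w_def by blast
qed

lemma eigenvalue_imp_generalized:
  assumes "eigenvalue l N \<mu>"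
  obtains w where "(w, \<lambda>x. \<mu> *\<^sub>C w x) \<in> N" "w \<in> ker_power l N \<mu> (Suc 0)" "\<not> (AE x in interval_measure l. w x = 0)"
proof -
  obtain w where w: "(w, \<lambda>x. \<mu> *\<^sub>C w x) \<in> N" "\<not> (AE x in interval_measure l. w x = 0)"
    using assms by (auto simp: eigenvalue_def)
  then have "w \<in> ker_power l N \<mu> (Suc 0)" by (auto intro!: exI [of _ "\<lambda>x. \<mu> *\<^sub>C w x"])
  with w show thesis using that by blast
qed

lemma multiplicity_le_1:
  assumes ne: "Re (ip l uh v0) \<noteq> 0" and "0 < r"
  shows "multiplicity l N (complex_of_real r) \<le> 1"
  unfolding multiplicity_def ae_dim_def
proof (rule SUP_least)
  fix n assume "n \<in> {n. \<exists>b :: nat \<Rightarrow> real \<Rightarrow> complex \<times> complex. (\<forall>i<n. b i \<in> (\<Union>k. ker_power l N (complex_of_real r) k)) \<and>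
      (\<forall>c. (AE x in interval_measure l. (\<Sum>i<n. c i *\<^sub>C b i x) = 0) \<longrightarrow> (\<forall>i<n. c i = 0))}"
  then obtain b :: "nat \<Rightarrow> real \<Rightarrow> complex \<times> complex" where
    b: "\<And>i. i < n \<Longrightarrow> b i \<in> (\<Union>k. ker_power l N (complex_of_real r) k)"
    and ind: "\<And>c i. (AE x in interval_measure l. (\<Sum>i<n. c i *\<^sub>C b i x) = 0) \<Longrightarrow> i < n \<Longrightarrow> c i = 0" by blast
  have "n \<le> 1"
  proof (rule ccontr)
    assume "\<not> n \<le> 1"
    then have n: "0 < n" "1 < n" by auto
    obtain j k where jk: "b 0 \<in> ker_power l N (complex_of_real r) j" "b 1 \<in> ker_power l N (complex_of_real r) k"
      using b [OF n(1)] b [OF n(2)] by blast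
    obtain c1 c2 where c: "c1 \<noteq> 0 \<or> c2 \<noteq> 0"
      "AE x in interval_measure l. c1 *\<^sub>C b 0 x + c2 *\<^sub>C b 1 x = 0"
      by (rule generalized_eigenvectors_dependent [OF ne \<open>0 < r\<close> \<open>0 < r\<close> jk])
    define c where "c = (\<lambda>i :: nat. if i = 0 then c1 else if i = 1 then c2 else 0)"
    have "(\<Sum>i<n. c i *\<^sub>C b i x) = c1 *\<^sub>C b 0 x + c2 *\<^sub>C b 1 x" for x
    proof -
      have "(\<Sum>i<n. c i *\<^sub>C b i x) = (\<Sum>i\<in>{0, 1}. c i *\<^sub>C b i x)"
        using n by (intro sum.mono_neutral_right) (auto simp: c_def scaleC_eq_0)
      then show ?thesis by (simp add: c_def)
    qed
    then have "AE x in interval_measure l. (\<Sum>i<n. c i *\<^sub>C b i x) = 0" using c(2) by simp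
    from ind [OF this n(1)] ind [OF this n(2)] c(1) show False by (simp add: c_def)
  qed
  then show "enat n \<le> 1" by (simp add: one_enat_def)
qed

lemma positive_eigenvalue_unique:
  assumes ne: "Re (ip l uh v0) \<noteq> 0" and pos: "0 < r1" "0 < r2"
    and eig: "eigenvalue l N (complex_of_real r1)" "eigenvalue l N (complex_of_real r2)"
  shows "r1 = r2"
proof (rule ccontr)
  assume neq: "r1 \<noteq> r2"
  obtain w1 where w1: "(w1, \<lambda>x. complex_of_real r1 *\<^sub>C w1 x) \<in> N" "w1 \<in> ker_power l N (complex_of_real r1) (Suc 0)"
    "\<not> (AE x in interval_measure l. w1 x = 0)" using eigenvalue_imp_generalized [OF eig(1)] by blast
  obtain w2 where w2: "(w2, \<lambda>x. complex_of_real r2 *\<^sub>C w2 x) \<in> N" "w2 \<in> ker_power l N (complex_of_real r2) (Suc 0)"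
    "\<not> (AE x in interval_measure l. w2 x = 0)" using eigenvalue_imp_generalized [OF eig(2)] by blast
  obtain c1 c2 where c: "c1 \<noteq> 0 \<or> c2 \<noteq> 0" "AE x in interval_measure l. c1 *\<^sub>C w1 x + c2 *\<^sub>C w2 x = 0"
    using generalized_eigenvectors_dependent [OF ne pos w1(2) w2(2)] by blast
  have N: "(\<lambda>x. c1 *\<^sub>C w1 x + c2 *\<^sub>C w2 x, \<lambda>x. c1 *\<^sub>C complex_of_real r1 *\<^sub>C w1 x + c2 *\<^sub>C complex_of_real r2 *\<^sub>C w2 x) \<in> N"
    by (rule N_op_lincomb [OF l w1(1) w2(1)])
  have sc: "0 *\<^sub>C x = 0" for x :: "complex \<times> complex" by (simp add: scaleC_eq_0)
  have N0: "(\<lambda>x. 0 *\<^sub>C w1 x + 0 *\<^sub>C w2 x, \<lambda>x. 0 *\<^sub>C complex_of_real r1 *\<^sub>C w1 x + 0 *\<^sub>C complex_of_real r2 *\<^sub>C w2 x) \<in> N"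
    by (rule N_op_lincomb [OF l w1(1) w2(1)])
  have "AE x in interval_measure l. c1 *\<^sub>C w1 x + c2 *\<^sub>C w2 x = 0 *\<^sub>C w1 x + 0 *\<^sub>C w2 x"
    using c(2) by (simp add: sc)
  from N_op_unique [OF l N N0 this]
  have "AE x in interval_measure l. c1 *\<^sub>C complex_of_real r1 *\<^sub>C w1 x + c2 *\<^sub>C complex_of_real r2 *\<^sub>C w2 x = 0"
    by (simp add: sc)
  with c(2) have both: "AE x in interval_measure l. c1 *\<^sub>C w1 x = 0 \<and> c2 *\<^sub>C w2 x = 0"
  proof eventually_elim
    case (elim x)
    have a: "c1 * fst (w1 x) + c2 * fst (w2 x) = 0" "c1 * snd (w1 x) + c2 * snd (w2 x) = 0"
      "c1 * (of_real r1 * fst (w1 x)) + c2 * (of_real r2 * fst (w2 x)) = 0"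
      "c1 * (of_real r1 * snd (w1 x)) + c2 * (of_real r2 * snd (w2 x)) = 0"
      using elim by (simp_all add: scaleC_prod_def scaleC_complex_def zero_prod_def)
    have key: "p = 0 \<and> q = 0" if "p + q = 0" "of_real r1 * p + of_real r2 * q = 0" for p q :: complex
    proof -
      have "q = - p" using that(1) by (simp add: add_eq_0_iff)
      then have "(of_real r1 - of_real r2) * p = 0" using that(2) by (simp add: algebra_simps)
      then show ?thesis using neq \<open>q = - p\<close> by simp
    qed
    have "c1 * fst (w1 x) = 0 \<and> c2 * fst (w2 x) = 0"
      using a(1,3) by (intro key) (simp_all add: mult.left_commute)
    moreover have "c1 * snd (w1 x) = 0 \<and> c2 * snd (w2 x) = 0"
      using a(2,4) by (intro key) (simp_all add: mult.left_commute)
    ultimately show ?case by (simp add: scaleC_prod_def scaleC_complex_def zero_prod_def)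
  qed
  show False
  proof (cases "c1 = 0")
    case True
    then have "c2 \<noteq> 0" using c(1) by simp
    then have "AE x in interval_measure l. w2 x = 0" using both by (auto simp: scaleC_eq_0 elim: eventually_mono)
    then show False using w2(3) by simp
  next
    case False
    then have "AE x in interval_measure l. w1 x = 0" using both by (auto simp: scaleC_eq_0 elim: eventually_mono)
    then show False using w1(3) by simp
  qed
qed

lemma num_positive_eq_1:
  assumes pos: "0 < Re (ip l uh v0)"
  shows "num_positive l N = 1"
proof -
  have ne: "Re (ip l uh v0) \<noteq> 0" using pos by simp
  obtain r u v where r: "0 < r" and uv: "(u, \<lambda>x. complex_of_real r * v x) \<in> schroedinger_op l g"
    "(v, \<lambda>x. - (complex_of_real r * u x)) \<in> schroedinger_op l h"
    "\<not> (AE x in interval_measure l. u x = 0 \<and> v x = 0)"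
    using positive_eigenvalue_exists [OF l g h v0 ch(1) ch(2) onto e(1) e(3) e(2) uh pos] by blast
  have eig: "eigenvalue l N (complex_of_real r)"
    unfolding eigenvalue_def
  proof (intro exI conjI)
    show "(\<lambda>x. (u x, v x), \<lambda>x. complex_of_real r *\<^sub>C (u x, v x)) \<in> N"
      using uv by (simp add: N_op_iff scaleC_prod_def scaleC_complex_def)
    show "\<not> (AE x in interval_measure l. (u x, v x) = 0)"
      using uv(3) by (simp add: zero_prod_def)
  qed
  have "enat (card {complex_of_real r}) \<le> num_positive l N"
    unfolding num_positive_def using eig r by (intro num_eigenvalues_ge) auto
  moreover have "num_positive l N \<le> 1"
    unfolding num_positive_def num_eigenvalues_def
  proof (rule SUP_least)
    fix F assume "F \<in> {F. finite F \<and> F \<subseteq> {\<mu> \<in> complex_of_real ` {0<..}. eigenvalue l N \<mu>}}"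
    then have F: "\<And>\<mu>. \<mu> \<in> F \<Longrightarrow> \<exists>s>0. \<mu> = complex_of_real s \<and> eigenvalue l N \<mu>" by auto
    have "F \<subseteq> {complex_of_real r}"
    proof
      fix \<mu> assume "\<mu> \<in> F"
      then obtain s where "0 < s" "\<mu> = complex_of_real s" "eigenvalue l N (complex_of_real s)" using F by blast
      then show "\<mu> \<in> {complex_of_real r}"
        using positive_eigenvalue_unique [OF ne _ r _ eig] by simp
    qed
    then have "F = {} \<or> F = {complex_of_real r}" by blast
    then show "(\<Sum>\<mu>\<in>F. multiplicity l N \<mu>) \<le> 1"
      using multiplicity_le_1 [OF ne r] by auto
  qed
  ultimately show ?thesis by (simp add: one_enat_def order_antisym)
qed

text \<open>
  If \<open>\<langle>uh, v0\<rangle> < 0\<close> then \<open>uh\<close> is a negative direction of \<open>\<langle>L\<^sub>+ u, u\<rangle>\<close>. As there is only one such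
  direction, the form is nonnegative on the complement of \<open>uh\<close> with respect to the form itself, which
  consists of the \<open>u\<close> orthogonal to \<open>v0 = L\<^sub>+ uh\<close>. An eigenvector for an eigenvalue off the imaginary
  axis has such a first component and zero energy; as both parts of the energy are nonnegative, it vanishes.
\<close>

lemma no_unstable_eigenvector:
  assumes neg: "Re (ip l uh v0) < 0" and \<mu>: "Re \<mu> \<noteq> 0" and w: "(w, \<lambda>x. \<mu> *\<^sub>C w x) \<in> N"
  shows "AE x in interval_measure l. w x = 0"
proof -
  define u where "u = (\<lambda>x. fst (w x))"
  define v where "v = (\<lambda>x. snd (w x))"
  have gS: "(u, \<lambda>x. \<mu> * v x) \<in> schroedinger_op l g" and hS: "(v, \<lambda>x. - (\<mu> * u x)) \<in> schroedinger_op l h"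
    using w by (simp_all add: N_op_iff scaleC_prod_def scaleC_complex_def u_def v_def)
  have \<mu>0: "\<mu> \<noteq> 0" using \<mu> by auto
  note uL = schroedinger_L2 [OF gS] and vL = schroedinger_L2 [OF hS] and uhL = schroedinger_L2 [OF uh]
  have eL: "e \<in> L2 l" by (rule schroedinger_L2 [OF e(1)])
  have wk: "w \<in> ker_power l N \<mu> (Suc 0)" using w by (auto intro!: exI [of _ "\<lambda>x. \<mu> *\<^sub>C w x"])
  have "\<mu> + cnj \<mu> \<noteq> 0" using \<mu> by (simp add: complex_add_cnj)
  from symp_generalized_eigenvectors [OF l g h this wk wk]
  have "ip l v u - ip l u v = 0" by (simp add: symp_def u_def v_def)
  then have "ip l (\<lambda>x. \<mu> * v x) u + ip l (\<lambda>x. - (\<mu> * u x)) v = 0"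
    by (simp add: ip_cmult_left ip_uminus_left)
  then have energy: "Re (ip l (\<lambda>x. \<mu> * v x) u) + Re (ip l (\<lambda>x. - (\<mu> * u x)) v) = 0"
    by (metis plus_complex.simps(1) zero_complex.simps(1))
  have "ip l (\<lambda>x. - (\<mu> * u x)) v0 = 0" using schroedinger_symmetric [OF l h hS v0(1)] by simp
  then have uv0: "ip l u v0 = 0" using \<mu>0 by (simp add: ip_uminus_left ip_cmult_left)
  define \<rho> where "\<rho> = Re (ip l uh v0)"
  have uhe: "ip l uh e \<noteq> 0"
  proof
    assume "ip l uh e = 0"
    from cg(2) [OF uh this] have "cg * (L2_norm l uh)\<^sup>2 \<le> \<rho>" unfolding \<rho>_def ip_Re_commute [of l uh v0] .
    moreover have "0 \<le> cg * (L2_norm l uh)\<^sup>2" using cg(1) by simp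
    ultimately show False using neg by (simp add: \<rho>_def)
  qed
  \<comment> \<open>adding this multiple of \<open>uh\<close> moves \<open>u\<close> into the complement of \<open>e\<close>\<close>
  define s where "s = - ip l u e / ip l uh e"
  have S: "(\<lambda>x. 1 * u x + s * uh x, \<lambda>x. 1 * (\<mu> * v x) + s * v0 x) \<in> schroedinger_op l g"
    by (rule schroedinger_lincomb [OF l gS uh])
  have "ip l (\<lambda>x. 1 * u x + s * uh x) e = 0"
    using uL uhL eL uhe by (simp only: ip_add_left ip_cmult_left L2_cmult) (simp add: s_def)
  from cg(2) [OF S this]
  have "cg * (L2_norm l (\<lambda>x. 1 * u x + s * uh x))\<^sup>2 \<le> Re (ip l (\<lambda>x. 1 * (\<mu> * v x) + s * v0 x) (\<lambda>x. 1 * u x + s * uh x))" .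
  also have "ip l (\<lambda>x. 1 * (\<mu> * v x) + s * v0 x) (\<lambda>x. 1 * u x + s * uh x)
      = ip l (\<lambda>x. \<mu> * v x) u + cnj s * ip l (\<lambda>x. \<mu> * v x) uh + s * ip l v0 u + s * cnj s * ip l v0 uh"
    using uL uhL by (simp only: ip_add_left ip_add_right ip_cmult_left [of _ s] ip_cmult_left [of _ 1] ip_cmult_right L2_add L2_cmult)
      (simp add: algebra_simps)
  also have "ip l (\<lambda>x. \<mu> * v x) uh = 0" using schroedinger_symmetric [OF l g gS uh] uv0 by simp
  also have "ip l v0 u = 0" using arg_cong [OF uv0, of cnj] by (simp add: ip_cnj)
  also have "ip l v0 uh = complex_of_real \<rho>" unfolding \<rho>_def by (rule index_real)
  also have "s * cnj s = complex_of_real ((cmod s)\<^sup>2)" by (simp only: complex_norm_square)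
  also have "Re (ip l (\<lambda>x. \<mu> * v x) u + cnj s * 0 + s * 0 + complex_of_real ((cmod s)\<^sup>2) * complex_of_real \<rho>)
      = Re (ip l (\<lambda>x. \<mu> * v x) u) + (cmod s)\<^sup>2 * \<rho>" by (simp flip: of_real_mult of_real_power)
  finally have key: "cg * (L2_norm l (\<lambda>x. 1 * u x + s * uh x))\<^sup>2 \<le> Re (ip l (\<lambda>x. \<mu> * v x) u) + (cmod s)\<^sup>2 * \<rho>" .
  have le: "Re (ip l (\<lambda>x. \<mu> * v x) u) \<le> 0" using energy h_form(1) [OF hS] by linarith
  have p1: "0 \<le> cg * (L2_norm l (\<lambda>x. 1 * u x + s * uh x))\<^sup>2" using cg(1) by simp
  have p2: "(cmod s)\<^sup>2 * \<rho> \<le> 0" using neg by (simp add: \<rho>_def mult_nonneg_nonpos)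
  have "(cmod s)\<^sup>2 * \<rho> = 0" using key le p1 p2 by linarith
  then have s0: "s = 0" using neg by (simp add: \<rho>_def)
  have "cg * (L2_norm l (\<lambda>x. 1 * u x + s * uh x))\<^sup>2 = 0" using key le p1 p2 by linarith
  then have "L2_norm l u = 0" using cg(1) s0 by simp
  then have u0: "AE x in interval_measure l. u x = 0" using L2_norm_eq_0 [OF uL(1)] by simp
  have "AE x in interval_measure l. \<mu> * v x = 0" by (rule schroedinger_image_of_zero [OF l gS u0])
  then have "AE x in interval_measure l. v x = 0" using \<mu>0 by simp
  with u0 show ?thesis by eventually_elim (simp add: u_def v_def prod_eq_iff)
qed

text \<open>
  By the alternative for the coupled system, a point of the spectrum is an eigenvalue.
\<close>

lemma Spec_imaginary:
  assumes neg: "Re (ip l uh v0) < 0"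
  shows "Spec l N \<subseteq> {z. Re z = 0}"
proof
  fix \<mu> assume "\<mu> \<in> Spec l N"
  show "\<mu> \<in> {z. Re z = 0}"
  proof (rule ccontr)
    assume "\<mu> \<notin> {z. Re z = 0}"
    then have \<mu>: "Re \<mu> \<noteq> 0" by simp
    have "\<mu> \<in> resolvent_set l N"
    proof (rule system_alternative [OF l g h, of \<mu> "- \<mu>"])
      fix u v assume uv: "(u, \<lambda>x. \<mu> * v x) \<in> schroedinger_op l g" "(v, \<lambda>x. - \<mu> * u x) \<in> schroedinger_op l h"
        "\<not> (AE x in interval_measure l. u x = 0 \<and> v x = 0)"
      have "(\<lambda>x. (u x, v x), \<lambda>x. \<mu> *\<^sub>C (u x, v x)) \<in> N"
        using uv by (simp add: N_op_iff scaleC_prod_def scaleC_complex_def)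
      from no_unstable_eigenvector [OF neg \<mu> this] show ?thesis using uv(3) by (simp add: zero_prod_def)
    next
      fix C assume "0 \<le> C" and C: "\<And>f k. f \<in> L2 l \<Longrightarrow> k \<in> L2 l \<Longrightarrow>
        \<exists>u v. (u, \<lambda>x. f x + \<mu> * v x) \<in> schroedinger_op l g \<and>
        (v, \<lambda>x. k x + - \<mu> * u x) \<in> schroedinger_op l h \<and>
        L2_norm l u \<le> C * L2_norm l (\<lambda>x. (f x, k x)) \<and> L2_norm l v \<le> C * L2_norm l (\<lambda>x. (f x, k x))"
      have solve: "\<exists>y z. (y, z) \<in> N \<and> (\<forall>x. z x - \<mu> *\<^sub>C y x = w x) \<and> L2_norm l y \<le> 2 * C * L2_norm l w"
        if w: "w \<in> L2 l" for w :: "real \<Rightarrow> complex \<times> complex"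
      proof -
        have wL: "(\<lambda>x. snd (w x)) \<in> L2 l" "(\<lambda>x. - fst (w x)) \<in> L2 l"
          using w by (simp_all add: L2_pair L2_uminus)
        obtain u v where uv: "(u, \<lambda>x. snd (w x) + \<mu> * v x) \<in> schroedinger_op l g"
          "(v, \<lambda>x. - fst (w x) + - \<mu> * u x) \<in> schroedinger_op l h"
          "L2_norm l u \<le> C * L2_norm l (\<lambda>x. (snd (w x), - fst (w x)))"
          "L2_norm l v \<le> C * L2_norm l (\<lambda>x. (snd (w x), - fst (w x)))"
          using C [OF wL] by blast
        have nw: "L2_norm l (\<lambda>x. (snd (w x), - fst (w x))) = L2_norm l w"
          by (simp add: L2_norm_def norm_prod_def add.commute)
        have "L2_norm l (\<lambda>x. (u x, v x)) \<le> L2_norm l u + L2_norm l v"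
        proof (rule power2_le_imp_le)
          have "(L2_norm l (\<lambda>x. (u x, v x)))\<^sup>2 = (L2_norm l u)\<^sup>2 + (L2_norm l v)\<^sup>2"
            unfolding L2_norm_sq using schroedinger_L2(1) [OF uv(1)] schroedinger_L2(1) [OF uv(2)]
            by (simp add: norm_prod_def L2_integrable_sq)
          then show "(L2_norm l (\<lambda>x. (u x, v x)))\<^sup>2 \<le> (L2_norm l u + L2_norm l v)\<^sup>2"
            by (simp add: power2_sum)
        qed simp
        then have "L2_norm l (\<lambda>x. (u x, v x)) \<le> 2 * C * L2_norm l w" using uv(3,4) nw by simp
        moreover have "(\<lambda>x. (u x, v x), \<lambda>x. w x + \<mu> *\<^sub>C (u x, v x)) \<in> N"
          using uv(1,2) by (simp add: N_op_iff scaleC_prod_def scaleC_complex_def)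
        ultimately show ?thesis
          by (intro exI [of _ "\<lambda>x. (u x, v x)"] exI [of _ "\<lambda>x. w x + \<mu> *\<^sub>C (u x, v x)"]) auto
      qed
      show ?thesis
        unfolding resolvent_set_def
      proof (intro CollectI conjI ballI)
        fix w :: "real \<Rightarrow> complex \<times> complex" assume "w \<in> L2 l"
        then show "\<exists>u z. (u, z) \<in> N \<and> (AE x in interval_measure l. z x - \<mu> *\<^sub>C u x = w x)"
          using solve [of w] by fastforce
      next
        have "L2_norm l u \<le> 2 * C * L2_norm l (\<lambda>x. z x - \<mu> *\<^sub>C u x)" if uz: "(u, z) \<in> N" for u z
        proof -
          note L = N_op_L2 [OF uz]
          have one: "1 *\<^sub>C x = x" "(- c) *\<^sub>C x = - (c *\<^sub>C x)" "c *\<^sub>C (x - y) = c *\<^sub>C x - c *\<^sub>C y"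
            for x y :: "complex \<times> complex" and c
            by (simp_all add: scaleC_prod_def scaleC_complex_def prod_eq_iff right_diff_distrib)
          have "(\<lambda>x. - \<mu> *\<^sub>C u x) \<in> L2 l"
            using L(1) unfolding L2_pair by (simp add: scaleC_prod_def scaleC_complex_def L2_cmult L2_uminus)
          from L2_add [OF L(2) this] have "(\<lambda>x. z x - \<mu> *\<^sub>C u x) \<in> L2 l" by (simp add: one)
          then obtain y y' where y: "(y, y') \<in> N" "\<And>x. y' x - \<mu> *\<^sub>C y x = z x - \<mu> *\<^sub>C u x"
            "L2_norm l y \<le> 2 * C * L2_norm l (\<lambda>x. z x - \<mu> *\<^sub>C u x)" using solve by blast
          have "(\<lambda>x. 1 *\<^sub>C u x + (- 1) *\<^sub>C y x, \<lambda>x. 1 *\<^sub>C z x + (- 1) *\<^sub>C y' x) \<in> N"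
            by (rule N_op_lincomb [OF l uz y(1)])
          moreover have "z x - y' x = \<mu> *\<^sub>C (u x - y x)" for x
            using y(2) [of x] by (simp add: one algebra_simps)
          ultimately have "(\<lambda>x. u x - y x, \<lambda>x. \<mu> *\<^sub>C (u x - y x)) \<in> N" by (simp add: one)
          from no_unstable_eigenvector [OF neg \<mu> this] have "AE x in interval_measure l. u x = y x" by simp
          then have "L2_norm l u = L2_norm l y" by (rule L2_norm_AE_cong [OF N_op_L2(1) [OF y(1)]])
          then show ?thesis using y(3) by simp
        qed
        then show "\<exists>C. \<forall>(u, z)\<in>N. L2_norm l u \<le> C * L2_norm l (\<lambda>x. z x - \<mu> *\<^sub>C u x)" by blast
      qed
    qed
    then show False using \<open>\<mu> \<in> Spec l N\<close> by (simp add: Spec_def)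
  qed
qed

end

section \<open>Exchanging the two potentials\<close>

text \<open>
  Conjugation with \<open>(u, v) \<mapsto> (v, - u)\<close> exchanges the roles of \<open>g\<close> and \<open>h\<close> in \<open>N\<close>. It reduces the
  second part of the theorem to the first, with \<open>- v_hat\<close> in the role of \<open>u_hat\<close>.
\<close>

definition quarter_turn :: "(real \<Rightarrow> complex \<times> complex) \<Rightarrow> real \<Rightarrow> complex \<times> complex" where
  "quarter_turn w = (\<lambda>x. (snd (w x), - fst (w x)))"

lemma quarter_turn_N_op:
  assumes "0 < l" "(w, z) \<in> N_op l g h"
  shows "(quarter_turn w, quarter_turn z) \<in> N_op l h g"
proof -
  note S = assms(2) [unfolded N_op_iff]
  have "(\<lambda>x. - fst (w x), \<lambda>x. - snd (z x)) \<in> schroedinger_op l g"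
    using schroedinger_cmult [OF assms(1) conjunct2 [OF S], of "- 1"] by simp
  then show ?thesis using S by (simp add: N_op_iff quarter_turn_def)
qed

lemma quarter_turn_scaleC: "quarter_turn (\<lambda>x. z x - \<mu> *\<^sub>C w x) = (\<lambda>x. quarter_turn z x - \<mu> *\<^sub>C quarter_turn w x)"
  by (simp add: quarter_turn_def scaleC_prod_def scaleC_complex_def fun_eq_iff)

lemma quarter_turn_eq_0: "quarter_turn w x = 0 \<longleftrightarrow> w x = 0"
  by (auto simp: quarter_turn_def zero_prod_def prod_eq_iff)

lemma quarter_turn_L2: "w \<in> L2 l \<Longrightarrow> quarter_turn w \<in> L2 l"
  by (simp add: L2_pair quarter_turn_def L2_uminus)

lemma quarter_turn_L2_norm: "L2_norm l (quarter_turn w) = L2_norm l w"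
  by (simp add: L2_norm_def quarter_turn_def norm_prod_def add.commute)

lemma quarter_turn_surj: "quarter_turn (\<lambda>x. (- snd (w x), fst (w x))) = w"
  by (simp add: quarter_turn_def)

lemma quarter_turn_ker_power:
  assumes "0 < l"
  shows "w \<in> ker_power l (N_op l g h) \<mu> k \<Longrightarrow> quarter_turn w \<in> ker_power l (N_op l h g) \<mu> k"
proof (induction k arbitrary: w)
  case 0
  then show ?case by (simp add: quarter_turn_L2 quarter_turn_eq_0)
next
  case (Suc k)
  then obtain z where z: "(w, z) \<in> N_op l g h" "(\<lambda>x. z x - \<mu> *\<^sub>C w x) \<in> ker_power l (N_op l g h) \<mu> k" by auto
  have "(\<lambda>x. quarter_turn z x - \<mu> *\<^sub>C quarter_turn w x) \<in> ker_power l (N_op l h g) \<mu> k"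
    using Suc.IH [OF z(2)] by (simp add: quarter_turn_scaleC)
  then show ?case using quarter_turn_N_op [OF assms z(1)] by auto
qed

lemma exchange_eigenvalue:
  assumes "0 < l" "eigenvalue l (N_op l g h) \<mu>"
  shows "eigenvalue l (N_op l h g) \<mu>"
proof -
  obtain w where w: "(w, \<lambda>x. \<mu> *\<^sub>C w x) \<in> N_op l g h" "\<not> (AE x in interval_measure l. w x = 0)"
    using assms(2) by (auto simp: eigenvalue_def)
  have "quarter_turn (\<lambda>x. \<mu> *\<^sub>C w x) = (\<lambda>x. \<mu> *\<^sub>C quarter_turn w x)"
    by (simp add: quarter_turn_def scaleC_prod_def scaleC_complex_def fun_eq_iff)
  then have "(quarter_turn w, \<lambda>x. \<mu> *\<^sub>C quarter_turn w x) \<in> N_op l h g"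
    using quarter_turn_N_op [OF assms(1) w(1)] by simp
  moreover have "\<not> (AE x in interval_measure l. quarter_turn w x = 0)"
    using w(2) by (simp add: quarter_turn_eq_0)
  ultimately show ?thesis unfolding eigenvalue_def by blast
qed

lemma exchange_multiplicity_le:
  assumes l: "0 < l"
  shows "multiplicity l (N_op l g h) \<mu> \<le> multiplicity l (N_op l h g) \<mu>"
  unfolding multiplicity_def ae_dim_def
proof (rule SUP_subset_mono)
  let ?V = "\<lambda>g h. \<Union>k. ker_power l (N_op l g h) \<mu> k"
  let ?D = "\<lambda>V. {n. \<exists>b :: nat \<Rightarrow> real \<Rightarrow> complex \<times> complex. (\<forall>i<n. b i \<in> V) \<and>
      (\<forall>c. (AE x in interval_measure l. (\<Sum>i<n. c i *\<^sub>C b i x) = 0) \<longrightarrow> (\<forall>i<n. c i = 0))}"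
  show "?D (?V g h) \<subseteq> ?D (?V h g)"
  proof
    fix n assume "n \<in> ?D (?V g h)"
    then obtain b :: "nat \<Rightarrow> real \<Rightarrow> complex \<times> complex" where b: "\<And>i. i < n \<Longrightarrow> b i \<in> ?V g h"
      and ind: "\<And>c. (AE x in interval_measure l. (\<Sum>i<n. c i *\<^sub>C b i x) = 0) \<Longrightarrow> \<forall>i<n. c i = 0" by blast
    have "quarter_turn (b i) \<in> ?V h g" if "i < n" for i
      using b [OF that] quarter_turn_ker_power [OF l] by blast
    moreover have "\<forall>i<n. c i = 0"
      if "AE x in interval_measure l. (\<Sum>i<n. c i *\<^sub>C quarter_turn (b i) x) = 0" for c
    proof (rule ind)
      have "(\<Sum>i<n. c i *\<^sub>C quarter_turn (b i) x) = quarter_turn (\<lambda>x. \<Sum>i<n. c i *\<^sub>C b i x) x" for x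
        by (simp add: quarter_turn_def scaleC_prod_def scaleC_complex_def prod_eq_iff fst_sum snd_sum sum_negf)
      then show "AE x in interval_measure l. (\<Sum>i<n. c i *\<^sub>C b i x) = 0"
        using that by (simp add: quarter_turn_eq_0)
    qed
    ultimately show "n \<in> ?D (?V h g)"
      by (intro CollectI exI [of _ "\<lambda>i. quarter_turn (b i)"]) blast
  qed
qed simp

lemma exchange_num_positive:
  assumes "0 < l"
  shows "num_positive l (N_op l g h) = num_positive l (N_op l h g)"
proof -
  have "eigenvalue l (N_op l g h) = eigenvalue l (N_op l h g)"
    using exchange_eigenvalue [OF assms] by blast
  moreover have "multiplicity l (N_op l g h) = multiplicity l (N_op l h g)"
    using exchange_multiplicity_le [OF assms] by (intro ext order_antisym)
  ultimately show ?thesis by (simp add: num_positive_def num_eigenvalues_def)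
qed

lemma exchange_Spec_subset:
  assumes l: "0 < l"
  shows "Spec l (N_op l g h) \<subseteq> Spec l (N_op l h g)"
proof -
  have "\<mu> \<in> resolvent_set l (N_op l g h)" if res: "\<mu> \<in> resolvent_set l (N_op l h g)" for \<mu>
    unfolding resolvent_set_def
  proof (intro CollectI conjI ballI)
    fix w :: "real \<Rightarrow> complex \<times> complex" assume "w \<in> L2 l"
    define w' where "w' = (\<lambda>x. (- snd (w x), fst (w x)))"
    have "w' \<in> L2 l" using \<open>w \<in> L2 l\<close> by (simp add: w'_def L2_pair L2_uminus)
    then obtain u z where uz: "(u, z) \<in> N_op l h g" "AE x in interval_measure l. z x - \<mu> *\<^sub>C u x = w' x"
      using res unfolding resolvent_set_def by blast
    have "AE x in interval_measure l. quarter_turn z x - \<mu> *\<^sub>C quarter_turn u x = w x"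
      using uz(2)
    proof eventually_elim
      case (elim x)
      have "quarter_turn (\<lambda>x. z x - \<mu> *\<^sub>C u x) x = quarter_turn w' x"
        by (simp only: quarter_turn_def elim)
      then show ?case by (simp add: quarter_turn_scaleC w'_def quarter_turn_surj)
    qed
    then show "\<exists>u z. (u, z) \<in> N_op l g h \<and> (AE x in interval_measure l. z x - \<mu> *\<^sub>C u x = w x)"
      using quarter_turn_N_op [OF l uz(1)] by blast
  next
    obtain C where C: "\<And>u z. (u, z) \<in> N_op l h g \<Longrightarrow> L2_norm l u \<le> C * L2_norm l (\<lambda>x. z x - \<mu> *\<^sub>C u x)"
      using res unfolding resolvent_set_def by blast
    have "L2_norm l u \<le> C * L2_norm l (\<lambda>x. z x - \<mu> *\<^sub>C u x)" if "(u, z) \<in> N_op l g h" for u z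
      using C [OF quarter_turn_N_op [OF l that]]
      by (simp only: quarter_turn_scaleC [symmetric] quarter_turn_L2_norm)
    then show "\<exists>C. \<forall>(u, z)\<in>N_op l g h. L2_norm l u \<le> C * L2_norm l (\<lambda>x. z x - \<mu> *\<^sub>C u x)" by blast
  qed
  then show ?thesis by (auto simp: Spec_def)
qed

section \<open>The index theorem\<close>

text \<open>
  The kernel element \<open>v0\<close> produced by the positivity lemma is a multiple \<open>c v\<close> of the given one. The
  preimage scales in the same way, so the sign of \<open>\<langle>u_hat, v\<rangle>\<close> is preserved.
\<close>

lemma index_theorem:
  fixes v u_hat :: "real \<Rightarrow> real"
  assumes l: "0 < l" and g: "continuous_on {0..l} g" and h: "continuous_on {0..l} h"
    and P: "num_negative l (schroedinger_op l g) = 1" and Q: "num_negative l (schroedinger_op l h) = 0"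
    and spec: "0 \<in> Spec l (schroedinger_op l h)" "0 \<notin> Spec l (schroedinger_op l g)"
    and span: "spans l (cplx v) (op_kernel (schroedinger_op l h))"
    and u: "(cplx u_hat, cplx v) \<in> schroedinger_op l g"
  shows "0 < L2_inner l u_hat v \<Longrightarrow> num_positive l (N_op l g h) = 1"
    and "L2_inner l u_hat v < 0 \<Longrightarrow> Spec l (N_op l g h) \<subseteq> {z. Re z = 0}"
proof -
  have neg_g: "eigenvalue l (schroedinger_op l g) (- complex_of_real \<sigma>)"
    if "(e, \<lambda>x. - (complex_of_real \<sigma> * e x)) \<in> schroedinger_op l g" "\<not> (AE x in interval_measure l. e x = 0)" for \<sigma> e
    using that unfolding schroedinger_eigenvalue_iff by (intro exI [of _ e]) simp
  have neg_mem: "- complex_of_real \<sigma> \<in> complex_of_real ` {..<0}" if "0 < \<sigma>" for \<sigma>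
    using that by (intro image_eqI [of _ _ "- \<sigma>"]) auto
  obtain \<mu> where \<mu>: "\<mu> \<in> complex_of_real ` {..<0}" "eigenvalue l (schroedinger_op l g) \<mu>"
    using num_eigenvalues_eq_1_exists [OF P [unfolded num_negative_def]] by blast
  then obtain t where t: "t < 0" "\<mu> = complex_of_real t" by auto
  define \<tau> where "\<tau> = - t"
  have \<tau>: "0 < \<tau>" "\<mu> = - complex_of_real \<tau>" using t by (simp_all add: \<tau>_def)
  obtain e0 where e0: "(e0, \<lambda>x. - (complex_of_real \<tau> * e0 x)) \<in> schroedinger_op l g"
      "\<not> (AE x in interval_measure l. e0 x = 0)"
    using \<mu>(2) unfolding schroedinger_eigenvalue_iff \<tau>(2) by auto
  have only_g: "\<sigma> = \<tau>" if "0 \<le> \<sigma>" "(e, \<lambda>x. - (complex_of_real \<sigma> * e x)) \<in> schroedinger_op l g"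
      "\<not> (AE x in interval_measure l. e x = 0)" for \<sigma> e
  proof (cases "\<sigma> = 0")
    case True
    then have "0 \<in> Spec l (schroedinger_op l g)"
      using neg_g [OF that(2,3)] by (intro eigenvalue_in_Spec [OF schroedinger_L2(1)]) auto
    then show ?thesis using spec by simp
  next
    case False
    then have "- complex_of_real \<sigma> = \<mu>"
      using num_eigenvalues_eq_1_unique [OF P [unfolded num_negative_def] neg_mem \<mu>(1) neg_g [OF that(2,3)] \<mu>(2)] that(1)
      by simp
    then show ?thesis using \<tau> by simp
  qed
  obtain e cg where e: "(e, \<lambda>x. - (complex_of_real \<tau> * e x)) \<in> schroedinger_op l g"
    "\<not> (AE x in interval_measure l. e x = 0)" "0 < cg"
    and cg: "\<And>u a. (u, a) \<in> schroedinger_op l g \<Longrightarrow> ip l u e = 0 \<Longrightarrow> cg * (L2_norm l u)\<^sup>2 \<le> Re (ip l a u)"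
  proof (rule schroedinger_positive_on_complement [OF l g less_imp_le [OF \<tau>(1)] e0 only_g])
    fix e c assume a: "(e, \<lambda>x. - (complex_of_real \<tau> * e x)) \<in> schroedinger_op l g"
      "\<not> (AE x in interval_measure l. e x = 0)" "0 < c"
      and b: "\<And>u a. (u, a) \<in> schroedinger_op l g \<Longrightarrow> ip l u e = 0 \<Longrightarrow> c * (L2_norm l u)\<^sup>2 \<le> Re (ip l a u)"
    show thesis by (rule that [OF a b])
  qed
  obtain k0 where k0: "(k0, \<lambda>x. 0) \<in> schroedinger_op l h" "\<not> (AE x in interval_measure l. k0 x = 0)"
    using zero_in_Spec_imp_kernel [OF l h spec(1)] by blast
  have only_h: "\<sigma> = 0" if "0 \<le> \<sigma>" "(e, \<lambda>x. - (complex_of_real \<sigma> * e x)) \<in> schroedinger_op l h"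
      "\<not> (AE x in interval_measure l. e x = 0)" for \<sigma> e
  proof (rule ccontr)
    assume "\<sigma> \<noteq> 0"
    then have "- complex_of_real \<sigma> \<in> complex_of_real ` {..<0}" using that(1) by (intro neg_mem) simp
    from num_eigenvalues_eq_0 [OF Q [unfolded num_negative_def] this]
    show False using that(2,3) unfolding schroedinger_eigenvalue_iff by auto
  qed
  have k0': "(k0, \<lambda>x. - (complex_of_real 0 * k0 x)) \<in> schroedinger_op l h" using k0(1) by simp
  obtain v0 ch where v0: "(v0, \<lambda>x. - (complex_of_real 0 * v0 x)) \<in> schroedinger_op l h"
    "\<not> (AE x in interval_measure l. v0 x = 0)" "0 < ch"
    and ch: "\<And>u a. (u, a) \<in> schroedinger_op l h \<Longrightarrow> ip l u v0 = 0 \<Longrightarrow> ch * (L2_norm l u)\<^sup>2 \<le> Re (ip l a u)"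
    and onto: "\<And>f. f \<in> L2 l \<Longrightarrow> ip l f v0 = 0 \<Longrightarrow> \<exists>w. (w, \<lambda>x. f x - complex_of_real 0 * w x) \<in> schroedinger_op l h"
  proof (rule schroedinger_positive_on_complement [OF l h order_refl k0' k0(2) only_h])
    fix v0 c assume a: "(v0, \<lambda>x. - (complex_of_real 0 * v0 x)) \<in> schroedinger_op l h"
      "\<not> (AE x in interval_measure l. v0 x = 0)" "0 < c"
      and b: "\<And>u a. (u, a) \<in> schroedinger_op l h \<Longrightarrow> ip l u v0 = 0 \<Longrightarrow> c * (L2_norm l u)\<^sup>2 \<le> Re (ip l a u)"
      and d: "\<And>f. f \<in> L2 l \<Longrightarrow> ip l f v0 = 0 \<Longrightarrow> \<exists>w. (w, \<lambda>x. f x - complex_of_real 0 * w x) \<in> schroedinger_op l h"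
    show thesis by (rule that [OF a b d])
  qed
  have v0S: "(v0, \<lambda>x. 0) \<in> schroedinger_op l h" using v0(1) by simp
  then have "v0 \<in> op_kernel (schroedinger_op l h)" by (simp add: op_kernel_def)
  then obtain c where c: "AE x in interval_measure l. v0 x = c * cplx v x"
    using span unfolding spans_def scaleC_complex_def by blast
  have c0: "c \<noteq> 0" using c v0(2) by auto
  have uS: "(\<lambda>x. c * cplx u_hat x, v0) \<in> schroedinger_op l g"
    using c by (intro schroedinger_AE_cong [OF l schroedinger_cmult [OF l u, of c]]) auto
  interpret index_one_pair l g h e v0 "\<lambda>x. c * cplx u_hat x" \<tau> cg ch
    using onto by unfold_locales (use l g h e \<tau> cg v0S v0 ch uS in auto)
  have uL: "cplx u_hat \<in> L2 l" "cplx v \<in> L2 l" using schroedinger_L2 [OF u] by auto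
  have "ip l (\<lambda>x. c * cplx u_hat x) v0 = ip l (\<lambda>x. c * cplx u_hat x) (\<lambda>x. c * cplx v x)"
    using c by (intro ip_AE_cong L2_cmult uL) auto
  also have "\<dots> = (c * cnj c) * ip l (cplx u_hat) (cplx v)"
    by (simp add: ip_cmult_left ip_cmult_right)
  also have "c * cnj c = complex_of_real ((cmod c)\<^sup>2)" by (simp only: complex_norm_square)
  also have "ip l (cplx u_hat) (cplx v) = complex_of_real (L2_inner l u_hat v)"
    by (simp add: ip_def L2_inner_def flip: of_real_mult)
  finally have "Re (ip l (\<lambda>x. c * cplx u_hat x) v0) = (cmod c)\<^sup>2 * L2_inner l u_hat v"
    by (simp flip: of_real_mult of_real_power)
  moreover have "0 < (cmod c)\<^sup>2" using c0 by simp
  ultimately show "0 < L2_inner l u_hat v \<Longrightarrow> num_positive l (N_op l g h) = 1"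
    and "L2_inner l u_hat v < 0 \<Longrightarrow> Spec l (N_op l g h) \<subseteq> {z. Re z = 0}"
    using num_positive_eq_1 Spec_imaginary by (simp_all add: zero_less_mult_iff mult_less_0_iff)
qed

lemma schroedinger_op_cong:
  assumes "\<And>x. x \<in> {0..l} \<Longrightarrow> q x = q' x"
  shows "schroedinger_op l q = schroedinger_op l q'"
proof -
  have "(AE x in interval_measure l. w x = - u2 x - complex_of_real (q x) * u x) \<longleftrightarrow>
      (AE x in interval_measure l. w x = - u2 x - complex_of_real (q' x) * u x)" for w u2 u
    using assms by (intro AE_cong) auto
  then show ?thesis unfolding schroedinger_op_def by simp
qed

lemma arises_from_N_op:
  assumes "arises_from l g h f \<beta> \<phi>"
  shows "N_op l (nls_g f \<beta> \<phi>) (nls_h f \<beta> \<phi>) = N_op l g h"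
proof -
  have "schroedinger_op l (nls_g f \<beta> \<phi>) = schroedinger_op l g" "schroedinger_op l (nls_h f \<beta> \<phi>) = schroedinger_op l h"
    using assms by (auto simp: arises_from_def intro!: schroedinger_op_cong)
  then show ?thesis by (simp add: N_op_def)
qed

lemma positive_eigenvalue_unstable:
  assumes "arises_from l g h f \<beta> \<phi>" "num_positive l (N_op l g h) = 1"
  shows "spectrally_unstable l f \<beta> \<phi>"
proof -
  obtain \<mu> where \<mu>: "\<mu> \<in> complex_of_real ` {0<..}" "eigenvalue l (N_op l g h) \<mu>"
    using num_eigenvalues_eq_1_exists [OF assms(2) [unfolded num_positive_def]] by blast
  then have "\<mu> \<in> Spec l (N_op l g h)" by (intro eigenvalue_in_Spec [OF N_op_L2(1)]) auto
  then show ?thesis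
    unfolding spectrally_unstable_def arises_from_N_op [OF assms(1)] using \<mu>(1) by (intro bexI [of _ \<mu>]) auto
qed

lemma imaginary_Spec_stable:
  assumes "arises_from l g h f \<beta> \<phi>" "Spec l (N_op l g h) \<subseteq> {z. Re z = 0}"
  shows "spectrally_stable l f \<beta> \<phi>"
  using assms(2) unfolding spectrally_stable_def spectrally_unstable_def arises_from_N_op [OF assms(1)] by force

lemma Ck_on_imp_continuous: "Ck_on 2 f S \<Longrightarrow> continuous_on S f"
proof -
  assume "Ck_on 2 f S"
  then obtain D :: "nat \<Rightarrow> real \<Rightarrow> real" where D: "\<forall>x\<in>S. D 0 x = f x"
     "\<forall>i<2. \<forall>x\<in>S. (D i has_real_derivative D (Suc i) x) (at x within S)"
    unfolding Ck_on_def by blast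
  have "(D 0 has_real_derivative D (Suc 0) x) (at x within S)" if "x \<in> S" for x
    using D(2) that by simp
  then have "continuous_on S (D 0)"
    unfolding continuous_on_eq_continuous_within using DERIV_continuous by blast
  then show "continuous_on S f" by (rule continuous_on_eq) (use D(1) in auto)
qed

lemma quotient_sign:
  fixes c x d :: real
  assumes "0 < c"
  shows "c * (x / d\<^sup>2) > 0 \<Longrightarrow> x > 0" "c * (x / d\<^sup>2) < 0 \<Longrightarrow> x < 0"
  using assms by (auto simp: zero_less_mult_iff mult_less_0_iff zero_less_divide_iff divide_less_0_iff)

theorem theorem2p11:
  fixes l :: real and g h :: "real \<Rightarrow> real"
  assumes "l > 0" and "Ck_on 2 g {0..l}" and "Ck_on 2 h {0..l}"
  shows
   "(num_negative l (schroedinger_op l g) = 1 \<and> num_negative l (schroedinger_op l h) = 0 \<and>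
     0 \<in> Spec l (schroedinger_op l h) - Spec l (schroedinger_op l g) \<longrightarrow>
     (\<forall>v u_hat :: real \<Rightarrow> real.
        spans l (cplx v) (op_kernel (schroedinger_op l h)) \<and>
        (cplx u_hat, cplx v) \<in> schroedinger_op l g \<longrightarrow>
        (L2_inner l u_hat v > 0 \<longrightarrow> num_positive l (N_op l g h) = 1) \<and>
        (L2_inner l u_hat v < 0 \<longrightarrow> Spec l (N_op l g h) \<subseteq> {z. Re z = 0}) \<and>
        (\<forall>f \<beta> \<phi>. arises_from l g h f \<beta> \<phi> \<and>
           0 \<notin> Spec l (schroedinger_op l h) \<inter> Spec l (schroedinger_op l g) \<longrightarrow>
           (2 / l * (L2_inner l u_hat v / (right_end_deriv l v)\<^sup>2) > 0 \<longrightarrow>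
              spectrally_unstable l f \<beta> \<phi>) \<and>
           (2 / l * (L2_inner l u_hat v / (right_end_deriv l v)\<^sup>2) < 0 \<longrightarrow>
              spectrally_stable l f \<beta> \<phi>))))
    \<and>
    (num_negative l (schroedinger_op l h) = 1 \<and> num_negative l (schroedinger_op l g) = 0 \<and>
     0 \<in> Spec l (schroedinger_op l g) - Spec l (schroedinger_op l h) \<longrightarrow>
     (\<forall>u v_hat :: real \<Rightarrow> real.
        spans l (cplx u) (op_kernel (schroedinger_op l g)) \<and>
        (cplx v_hat, \<lambda>x. - cplx u x) \<in> schroedinger_op l h \<longrightarrow>
        (L2_inner l v_hat u < 0 \<longrightarrow> num_positive l (N_op l g h) = 1) \<and>
        (L2_inner l v_hat u > 0 \<longrightarrow> Spec l (N_op l g h) \<subseteq> {z. Re z = 0}) \<and>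
        (\<forall>f \<beta> \<phi>. arises_from l g h f \<beta> \<phi> \<and>
           0 \<notin> Spec l (schroedinger_op l h) \<inter> Spec l (schroedinger_op l g) \<longrightarrow>
           (- (2 / l) * (L2_inner l v_hat u / (right_end_deriv l u)\<^sup>2) > 0 \<longrightarrow>
              spectrally_unstable l f \<beta> \<phi>) \<and>
           (- (2 / l) * (L2_inner l v_hat u / (right_end_deriv l u)\<^sup>2) < 0 \<longrightarrow>
              spectrally_stable l f \<beta> \<phi>))))"
proof -
  note l = assms(1)
  have g: "continuous_on {0..l} g" and h: "continuous_on {0..l} h"
    using assms(2,3) by (simp_all add: Ck_on_imp_continuous)
  have l2: "0 < 2 / l" using l by simp
  have nls: "(2 / l * (x / d\<^sup>2) > 0 \<longrightarrow> spectrally_unstable l f \<beta> \<phi>) \<and>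
      (2 / l * (x / d\<^sup>2) < 0 \<longrightarrow> spectrally_stable l f \<beta> \<phi>)"
    if "arises_from l g h f \<beta> \<phi>" and "0 < x \<Longrightarrow> num_positive l (N_op l g h) = 1"
      and "x < 0 \<Longrightarrow> Spec l (N_op l g h) \<subseteq> {z. Re z = 0}" for f \<beta> \<phi> x d
    using quotient_sign [OF l2, of x d] positive_eigenvalue_unstable [OF that(1)]
      imaginary_Spec_stable [OF that(1)] that(2,3) by blast
  show ?thesis
  proof (intro conjI impI allI; elim conjE DiffE)
    fix v u_hat :: "real \<Rightarrow> real"
    assume hyps: "num_negative l (schroedinger_op l g) = 1" "num_negative l (schroedinger_op l h) = 0"
      "0 \<in> Spec l (schroedinger_op l h)" "0 \<notin> Spec l (schroedinger_op l g)"
      "spans l (cplx v) (op_kernel (schroedinger_op l h))" "(cplx u_hat, cplx v) \<in> schroedinger_op l g"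
    note main = index_theorem [OF l g h hyps]
    show "num_positive l (N_op l g h) = 1" if "L2_inner l u_hat v > 0" using main(1) that .
    show "Spec l (N_op l g h) \<subseteq> {z. Re z = 0}" if "L2_inner l u_hat v < 0" using main(2) that .
    fix f \<beta> \<phi> assume a: "arises_from l g h f \<beta> \<phi>"
    show "spectrally_unstable l f \<beta> \<phi>" if "2 / l * (L2_inner l u_hat v / (right_end_deriv l v)\<^sup>2) > 0"
      using nls [OF a main] that by blast
    show "spectrally_stable l f \<beta> \<phi>" if "2 / l * (L2_inner l u_hat v / (right_end_deriv l v)\<^sup>2) < 0"
      using nls [OF a main] that by blast
  next
    fix u v_hat :: "real \<Rightarrow> real"
    assume hyps: "num_negative l (schroedinger_op l h) = 1" "num_negative l (schroedinger_op l g) = 0"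
      "0 \<in> Spec l (schroedinger_op l g)" "0 \<notin> Spec l (schroedinger_op l h)"
      "spans l (cplx u) (op_kernel (schroedinger_op l g))"
      and v: "(cplx v_hat, \<lambda>x. - cplx u x) \<in> schroedinger_op l h"
    have v': "(cplx (\<lambda>x. - v_hat x), cplx u) \<in> schroedinger_op l h"
      using schroedinger_cmult [OF l v, of "- 1"] by simp
    have inner: "L2_inner l (\<lambda>x. - v_hat x) u = - L2_inner l v_hat u" by (simp add: L2_inner_def)
    have main: "0 < - L2_inner l v_hat u \<Longrightarrow> num_positive l (N_op l g h) = 1"
      "- L2_inner l v_hat u < 0 \<Longrightarrow> Spec l (N_op l g h) \<subseteq> {z. Re z = 0}"
      using index_theorem [OF l h g hyps v'] exchange_num_positive [OF l, of g h] exchange_Spec_subset [OF l, of g h]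
      unfolding inner by auto
    show "num_positive l (N_op l g h) = 1" if "L2_inner l v_hat u < 0" using main(1) that by simp
    show "Spec l (N_op l g h) \<subseteq> {z. Re z = 0}" if "L2_inner l v_hat u > 0" using main(2) that by simp
    fix f \<beta> \<phi> assume a: "arises_from l g h f \<beta> \<phi>"
    have sgn: "- (2 / l) * (L2_inner l v_hat u / d\<^sup>2) = 2 / l * (- L2_inner l v_hat u / d\<^sup>2)" for d by simp
    show "spectrally_unstable l f \<beta> \<phi>" if "- (2 / l) * (L2_inner l v_hat u / (right_end_deriv l u)\<^sup>2) > 0"
      using nls [OF a main] that unfolding sgn by blast
    show "spectrally_stable l f \<beta> \<phi>" if "- (2 / l) * (L2_inner l v_hat u / (right_end_deriv l u)\<^sup>2) < 0"
      using nls [OF a main] that unfolding sgn by blast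
  qed
qed

end
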